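(* Let $n\ge 2$, fix a lattice $\mathbb{Z}+\mathbb{Z}\tau$ ($\operatorname{Im}\tau>0$) with Weierstrass function $\wp$, and fix $\lambda_1,\dots,\lambda_n\in\mathbb{C}$ with $\lambda_i-\lambda_j\notin\mathbb{Z}+\mathbb{Z}\tau$ for $i\ne j$. Let $\mathcal{A}$ be the algebra described in the context, with Dunkl elements $\theta_i=\sum_{j\ne i}[ij]$ (which commute pairwise). Then for every subset $I\subset\{1,\dots,n\}$ and every integer $k\ge 0$, one has in $\mathcal{A}$ \[ E_k(\theta_i\mid i\in I)=\sum_{l=0}^{[k/2]}\ \sum_{I_0\subset I,\ \#I_0=2l}\phi(I_0)\sum_{( * )}[a_1\,b_1][a_2\,b_2]\cdots[a_{k-2l}\,b_{k-2l}], \] where the inner sum $( * )$ runs over all sequences $(a_1,b_1),\dots,(a_{k-2l},b_{k-2l})$ such that $a_i\in I\setminus I_0$, $b_i\notin I$, $a_1,\dots,a_{k-2l}$ are pairwise distinct, and $b_1\le b_2\le\cdots\le b_{k-2l}$.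
   Context: Write $x_1,\dots,x_n$ for the coordinates on $\mathbb{C}^n$, $x_{ij}=x_i-x_j$, $\lambda_{ij}=\lambda_i-\lambda_j$, and let $\mathcal{M}$ be the field of meromorphic functions on $\mathbb{C}^n$; for $i\ne j$ let $s_{ij}$ act on $\mathcal{M}$ by $(s_{ij}f)(x)=f(x')$ where $x'$ is $x$ with coordinates $x_i,x_j$ interchanged. The algebra $\mathcal{A}$ (denoted $\tilde{\mathcal{E}}_n(\psi_{ij})$ in the paper, for $\psi_{ij}(z)=A/z^2-(\wp(z)-\wp(\lambda_i-\lambda_j))$) is the $\mathbb{C}$-algebra generated by $\mathcal{M}$ (with its multiplication) and symbols $[ij]$, $1\le i\ne j\le n$, with $[ji]=-[ij]$, subject to the relations: (i) $[ij]^2=\wp(\lambda_{ij})-\wp(x_{ij})$; (ii) $[ij][kl]=[kl][ij]$ if $\{i,j\}\cap\{k,l\}=\emptyset$; (iii) $[ij][jk]+[jk][ki]+[ki][ij]=0$ for distinct $i,j,k$; (iv) $[ij]f=(s_{ij}f)[ij]$ for $f\in\mathcal{M}$. For $I_0\subset\{1,\dots,n\}$ with $\#I_0=2m$, $\phi(I_0)\in\mathcal{M}$ is $\sum\prod_{i=1}^m\wp(x_{a_ib_i})$, the sum over all ways of writing $I_0=\{a_1,\dots,a_m,b_1,\dots,b_m\}$ with $a_1<\cdots<a_m$ and $a_i<b_i$ (i.e. over perfect matchings of $I_0$); $\phi(\emptyset)=1$. For a finite set $I$ of indices, the deformed elementary symmetric polynomials $E_k(I)=E_k(X_i\mid i\in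 I)$ in commuting variables $X_i$ are defined by $E_0(I)=1$, $E_k(I)=0$ for $k<0$, $E_k(\emptyset)=0$ for $k>0$, and for $j\notin I$: $E_k(I\cup\{j\})=E_k(I)+E_{k-1}(I)X_j+\sum_{i\in I}\wp(\lambda_{ij})E_{k-2}(I\setminus\{i\})$. $E_k(\theta_i\mid i\in I)$ denotes the substitution $X_i=\theta_i$. *)

theory Defs
  imports "HOL-Analysis.Analysis"
begin

definition lattice :: "complex \<Rightarrow> complex set" where
  "lattice \<tau> = {of_int m + of_int k * \<tau> | m k. True}"

text \<open>Weierstrass wp-function of the lattice Z + Z tau (junk value at lattice points).\<close>
definition wp :: "complex \<Rightarrow> complex \<Rightarrow> complex" where
  "wp \<tau> z = 1 / z^2 + infsum (\<lambda>\<omega>. 1 / (z - \<omega>)^2 - 1 / \<omega>^2) (lattice \<tau> - {0})"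

text \<open>Points of C^n are functions x :: nat => complex; only coordinates 1..n matter.\<close>

definition dep_only :: "nat \<Rightarrow> ((nat \<Rightarrow> complex) \<Rightarrow> complex) \<Rightarrow> bool" where
  "dep_only n f \<longleftrightarrow> (\<forall>x y. (\<forall>i\<in>{1..n}. x i = y i) \<longrightarrow> f x = f y)"

text \<open>Holomorphic on an open set: continuous and separately holomorphic (Osgood).\<close>
definition holo_on :: "nat \<Rightarrow> (nat \<Rightarrow> complex) set \<Rightarrow> ((nat \<Rightarrow> complex) \<Rightarrow> complex) \<Rightarrow> bool" where
  "holo_on n U g \<longleftrightarrow> dep_only n g \<and> continuous_on U g \<and>
     (\<forall>x\<in>U. \<forall>i\<in>{1..n}. (\<lambda>z. g (x(i := z))) field_differentiable (at (x i)))"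

text \<open>A meromorphic function is represented by a total function whose values off the
  polar/indeterminacy set are those of the meromorphic function (values there are junk).\<close>
definition meromorphic :: "nat \<Rightarrow> ((nat \<Rightarrow> complex) \<Rightarrow> complex) \<Rightarrow> bool" where
  "meromorphic n f \<longleftrightarrow> dep_only n f \<and>
     (\<forall>p. \<exists>U g h. open U \<and> p \<in> U \<and> holo_on n U g \<and> holo_on n U h \<and>
        (\<forall>V. open V \<and> V \<subseteq> U \<and> V \<noteq> {} \<longrightarrow> (\<exists>x\<in>V. h x \<noteq> 0)) \<and>
        (\<forall>x\<in>U. h x \<noteq> 0 \<longrightarrow> f x = g x / h x))"

text \<open>Two representatives define the same meromorphic function iff they agree on a dense open set.\<close>
definition generic_eq :: "((nat \<Rightarrow> complex) \<Rightarrow> complex) \<Rightarrow> ((nat \<Rightarrow> complex) \<Rightarrow> complex) \<Rightarrow> bool" where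
  "generic_eq f g \<longleftrightarrow> (\<exists>S. open S \<and> closure S = UNIV \<and> (\<forall>x\<in>S. f x = g x))"

definition swapf :: "nat \<Rightarrow> nat \<Rightarrow> ((nat \<Rightarrow> complex) \<Rightarrow> complex) \<Rightarrow> ((nat \<Rightarrow> complex) \<Rightarrow> complex)" where
  "swapf i j f = (\<lambda>x. f (x(i := x j, j := x i)))"

text \<open>Recursion adding the elements of I in increasing order; c i j is the coefficient wp(lambda_ij),
  the fuel argument is the cardinality.\<close>
primrec Eaux :: "(nat \<Rightarrow> nat \<Rightarrow> 'r::ring_1) \<Rightarrow> (nat \<Rightarrow> 'r) \<Rightarrow> nat \<Rightarrow> nat \<Rightarrow> nat set \<Rightarrow> 'r" where
  "Eaux c X 0 k I = (if k = 0 then 1 else 0)"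
| "Eaux c X (Suc m) k I =
     (if I = {} then (if k = 0 then 1 else 0) else
       (let j = Max I; J = I - {j} in
          Eaux c X m k J
          + (if 1 \<le> k then Eaux c X m (k - 1) J * X j else 0)
          + (if 2 \<le> k then (\<Sum>i\<in>J. c i j * Eaux c X m (k - 2) (J - {i})) else 0)))"

definition Edef :: "(nat \<Rightarrow> nat \<Rightarrow> 'r::ring_1) \<Rightarrow> (nat \<Rightarrow> 'r) \<Rightarrow> nat \<Rightarrow> nat set \<Rightarrow> 'r" where
  "Edef c X k I = Eaux c X (card I) k I"

definition perfect_matchings :: "nat set \<Rightarrow> (nat \<times> nat) set set" where
  "perfect_matchings I0 = {M. (\<forall>(a, b)\<in>M. a < b \<and> a \<in> I0 \<and> b \<in> I0) \<and>
      (\<forall>p\<in>M. \<forall>q\<in>M. p \<noteq> q \<longrightarrow> {fst p, snd p} \<inter> {fst q, snd q} = {}) \<and>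
      (\<forall>v\<in>I0. \<exists>p\<in>M. v = fst p \<or> v = snd p)}"

definition phi :: "complex \<Rightarrow> nat set \<Rightarrow> ((nat \<Rightarrow> complex) \<Rightarrow> complex)" where
  "phi \<tau> I0 = (\<lambda>x. \<Sum>M\<in>perfect_matchings I0. \<Prod>(a, b)\<in>M. wp \<tau> (x a - x b))"

definition seqs :: "nat \<Rightarrow> nat set \<Rightarrow> nat set \<Rightarrow> nat \<Rightarrow> (nat \<times> nat) list set" where
  "seqs n I I0 m = {ps. length ps = m \<and> distinct (map fst ps) \<and> sorted (map snd ps) \<and>
      (\<forall>(a, b)\<in>set ps. a \<in> I - I0 \<and> b \<in> {1..n} - I)}"

end

theory Submission
  imports Defs "HOL-Complex_Analysis.Complex_Analysis" "HOL-Combinatorics.Multiset_Permutations"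
begin

text \<open>Let $F_k(I)$ be the right-hand side. One shows that it satisfies the recursion defining $E_k$,
  with $X_j = \theta_j$. Write $e(A,b)$ for the sum of $[a_1 b]\cdots[a_m b]$ over all orderings of
  $A$. Factors with distinct second and disjoint first indices commute, so when the complement of $I$
  contains $j$ the sum over sequences splits off a right factor $e(A,j)$. Multiply by
  $\theta_j = \sum_b [jb] - \sum_{i \in I} [ij]$. The terms $[jb]$, and $[ij]$ with $i \notin A$,
  recombine by the three-term relation to the sequences in which $j$ occurs as a first index. For
  $i \in A$ one meets the cyclic sums $\sum_{i \in C} [ij]\, e(C \setminus i, j)\, [ij]$. These
  equal $\sum_{i \in C} \wp(\lambda_{ij})\, e(C \setminus i, i)$, which is the term of the recursion
  involving $E_{k-2}$, except that for $C = \{i\}$ there is an additional $-\wp(x_{ij})$. Moved to the left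
  across $e(A,j)$, this function either stays $\wp(x_{ij})$, and yields the matchings containing
  $j$, or becomes some $\wp(x_{ia})$ followed by a final $[aj]$, and these terms cancel against the
  $[aj]$ with $a \in I_0$.\<close>

subsection \<open>Meromorphy of the Weierstrass function\<close>

text \<open>Adjoining j to I withdraws j from the admissible second indices of every word, whereas
  the term E_{k-2}(I - {i}) makes i admissible. The identities are therefore proved for one fixed
  set V, the union of I_0 and {a_1, a_2, ...}, with a variable set of second indices. As #V = k, the
  degree enters only when the sets V of size k are added up at the end. Accordingly the [ij] in
  theta_j play three parts: those with i outside V repair the loss of the second index j, those with
  i in V - I_0 act on the words, those with i in I_0 take part in the cancellation. The cyclic sums
  are not evaluated word by word. Both sides, as functions Z of C, obey Z(C + z) = sum_c [cz] Z(C -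
  c + z) - Z(C) sum_c [cz], with c running over C, so that everything goes back to the square
  [ij]^2. The algebra enters as an arbitrary ring with the given relations, where \<open>emb\<close>
  is additive and multiplicative on meromorphic functions. This is why wp(x_i - x_j) and phi have to
  be shown meromorphic, as local quotients around every point, poles included.\<close>

lemma lattice_coordinates_bound:
  assumes "Im \<tau> > 0"
  obtains K where "K > 0"
    "\<And>m k :: int. \<bar>of_int m\<bar> \<le> K * cmod (of_int m + of_int k * \<tau>) \<and> \<bar>of_int k\<bar> \<le> K * cmod (of_int m + of_int k * \<tau>)"
proof
  \<comment> \<open>For w = m + k \<tau> the imaginary part gives |k| <= |w| / Im \<tau>, and then m
    = w - k \<tau> gives |m| <= |w| + |k| |\<tau>|. \<open>?K\<close> is the sum of the two
    resulting constants.\<close>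
  let ?K = "1 + (1 + cmod \<tau>) / Im \<tau>"
  show "?K > 0" using assms by (simp add: add_pos_nonneg)
  fix m k :: int
  define w where "w = of_int m + of_int k * \<tau>"
  have "\<bar>real_of_int k\<bar> * Im \<tau> = \<bar>Im w\<bar>"
    using assms by (simp add: w_def abs_mult)
  also have "\<dots> \<le> cmod w" by (rule abs_Im_le_cmod)
  finally have k: "\<bar>real_of_int k\<bar> \<le> cmod w / Im \<tau>" using assms by (simp add: field_simps)
  have "complex_of_int m = w - of_int k * \<tau>" by (simp add: w_def)
  then have "\<bar>real_of_int m\<bar> \<le> cmod w + \<bar>real_of_int k\<bar> * cmod \<tau>"
    by (metis norm_of_int norm_triangle_ineq4 norm_mult)
  also have "\<dots> \<le> cmod w + cmod w / Im \<tau> * cmod \<tau>"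
    using k by (intro add_left_mono mult_right_mono) auto
  finally have m: "\<bar>real_of_int m\<bar> \<le> cmod w + cmod w / Im \<tau> * cmod \<tau>" .
  have K: "?K * cmod w = cmod w + cmod w / Im \<tau> + cmod w / Im \<tau> * cmod \<tau>"
    using assms by (simp add: field_simps)
  have "0 \<le> cmod w / Im \<tau>" "0 \<le> cmod w / Im \<tau> * cmod \<tau>" using assms by auto
  then show "\<bar>of_int m\<bar> \<le> ?K * cmod (of_int m + of_int k * \<tau>) \<and> \<bar>of_int k\<bar> \<le> ?K * cmod (of_int m + of_int k * \<tau>)"
    using m k K norm_ge_zero[of w] unfolding w_def[symmetric] by linarith
qed

lemma finite_lattice_cball:
  assumes "Im \<tau> > 0"
  shows "finite {\<omega> \<in> lattice \<tau>. cmod \<omega> \<le> r}"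
proof -
  obtain K where K: "K > 0"
    "\<And>m k :: int. \<bar>of_int m\<bar> \<le> K * cmod (of_int m + of_int k * \<tau>) \<and> \<bar>of_int k\<bar> \<le> K * cmod (of_int m + of_int k * \<tau>)"
    using lattice_coordinates_bound[OF assms] by blast
  define B where "B = {- \<lceil>K * r\<rceil>..\<lceil>K * r\<rceil>}"
  have "{\<omega> \<in> lattice \<tau>. cmod \<omega> \<le> r} \<subseteq> (\<lambda>(m, k). of_int m + of_int k * \<tau>) ` (B \<times> B)"
  proof clarify
    fix \<omega> assume "\<omega> \<in> lattice \<tau>" and r: "cmod \<omega> \<le> r"
    then obtain m k where \<omega>: "\<omega> = of_int m + of_int k * \<tau>" by (auto simp: lattice_def)
    have "K * cmod \<omega> \<le> K * r" using r K(1) by simp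
    then have "\<bar>real_of_int m\<bar> \<le> K * r" "\<bar>real_of_int k\<bar> \<le> K * r"
      using K(2)[of m k] \<omega> by auto
    then have "m \<in> B" "k \<in> B" unfolding B_def by (auto; linarith)+
    then show "\<omega> \<in> (\<lambda>(m, k). of_int m + of_int k * \<tau>) ` (B \<times> B)" using \<omega> by auto
  qed
  then show ?thesis by (rule finite_subset) (simp add: B_def)
qed

lemma summable_on_int_powr:
  assumes "s < -1"
  shows "(\<lambda>m::int. (1 + \<bar>of_int m\<bar>) powr s :: real) summable_on UNIV"
proof -
  have nat: "(\<lambda>n::nat. real (Suc n) powr s) summable_on UNIV"
    using assms summable_Suc_iff[of "\<lambda>n. real n powr s"]
    by (subst summable_on_UNIV_nonneg_real_iff) (auto simp: summable_real_powr_iff simp del: of_nat_Suc)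
  have "(\<lambda>m::int. (1 + \<bar>of_int m\<bar>) powr s :: real) summable_on range int"
    using nat by (subst summable_on_reindex) (auto simp: o_def add_ac)
  moreover have "(\<lambda>m::int. (1 + \<bar>of_int m\<bar>) powr s :: real) summable_on range (\<lambda>n. - int n)"
    using nat by (subst summable_on_reindex) (auto simp: o_def add_ac inj_on_def)
  ultimately have "(\<lambda>m::int. (1 + \<bar>of_int m\<bar>) powr s :: real) summable_on range int \<union> range (\<lambda>n. - int n)"
    by (rule summable_on_union)
  moreover have "range int \<union> range (\<lambda>n. - int n) = UNIV"
    by (metis (no_types, lifting) UNIV_eq_I UnI1 UnI2 int_cases2 rangeI)
  ultimately show ?thesis by simp
qed

text \<open>With r = |\<omega>| both 1 + |m| and 1 + |k| are at most 2 K r. Hence r^(-3), split into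
  two factors r^(-3/2), is dominated by a product of two one-dimensional series, which converge as
  -3/2 < -1.\<close>

lemma summable_lattice_cube:
  assumes "Im \<tau> > 0"
  shows "(\<lambda>\<omega>. 1 / cmod \<omega> ^ 3) summable_on (lattice \<tau> - {0})"
proof -
  obtain K where K: "K > 0"
    "\<And>m k :: int. \<bar>of_int m\<bar> \<le> K * cmod (of_int m + of_int k * \<tau>) \<and> \<bar>of_int k\<bar> \<le> K * cmod (of_int m + of_int k * \<tau>)"
    using lattice_coordinates_bound[OF assms] by blast
  let ?w = "\<lambda>(m, k). complex_of_int m + of_int k * \<tau>"
  let ?a = "\<lambda>m::int. (1 + \<bar>of_int m\<bar>) powr (-3/2) :: real"
  let ?D = "UNIV - {(0, 0)} :: (int \<times> int) set"
  have a: "?a summable_on UNIV" by (rule summable_on_int_powr) simp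
  have aa: "(\<lambda>(m, k). ?a m * ?a k) summable_on UNIV \<times> UNIV"
  proof (rule summable_on_SigmaI[where g = "\<lambda>m. ?a m * infsum ?a UNIV"])
    show "((\<lambda>k. case (m, k) of (m, k) \<Rightarrow> ?a m * ?a k) has_sum ?a m * infsum ?a UNIV) UNIV" for m
      unfolding prod.case by (rule has_sum_cmult_right[OF has_sum_infsum[OF a]])
    show "(\<lambda>m. ?a m * infsum ?a UNIV) summable_on UNIV"
      by (rule summable_on_cmult_left[OF a])
  qed simp
  have "(\<lambda>x. (2 * K) ^ 3 * (case x of (m, k) \<Rightarrow> ?a m * ?a k)) summable_on ?D"
    by (rule summable_on_cmult_right, rule summable_on_subset_banach[OF aa]) auto
  then have "(\<lambda>x. 1 / cmod (?w x) ^ 3) summable_on ?D"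
  proof (rule summable_on_comparison_test)
    fix x :: "int \<times> int" assume x: "x \<in> ?D"
    obtain m k where mk: "x = (m, k)" by (cases x)
    define r where "r = cmod (?w x)"
    have b: "\<bar>real_of_int m\<bar> \<le> K * r" "\<bar>real_of_int k\<bar> \<le> K * r"
      using K(2)[of m k] by (auto simp: r_def mk)
    \<comment> \<open>An integer point other than the origin has a coordinate of modulus at least 1.
      The resulting 1 <= K r absorbs the summand 1 in 1 + |m| and 1 + |k|.\<close>
    have "1 \<le> \<bar>real_of_int m\<bar> \<or> 1 \<le> \<bar>real_of_int k\<bar>" using x mk by auto
    then have "1 \<le> K * r" using b by linarith
    then have r: "r > 0" using K(1) by (metis less_le_trans zero_less_mult_pos zero_less_one)
    have le: "1 + \<bar>real_of_int m\<bar> \<le> 2 * K * r" "1 + \<bar>real_of_int k\<bar> \<le> 2 * K * r"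
      using b \<open>1 \<le> K * r\<close> by linarith+
    have lower: "(2 * K * r) powr (-3/2) \<le> ?a m" "(2 * K * r) powr (-3/2) \<le> ?a k"
      using le by (auto intro!: powr_mono2')
    have "1 / (2 * K * r) ^ 3 = (2 * K * r) powr (-3/2) * (2 * K * r) powr (-3/2)"
      using r K(1) by (simp flip: powr_add add: powr_minus_divide powr_realpow)
    also have "\<dots> \<le> ?a m * ?a k"
      using lower by (intro mult_mono) auto
    finally have "(2 * K) ^ 3 * (1 / (2 * K * r) ^ 3) \<le> (2 * K) ^ 3 * (?a m * ?a k)"
      using K(1) by (intro mult_left_mono) auto
    also have "(2 * K) ^ 3 * (1 / (2 * K * r) ^ 3) = 1 / r ^ 3"
      using K(1) r by (simp add: power_mult_distrib)
    finally show "1 / cmod (?w x) ^ 3 \<le> (2 * K) ^ 3 * (case x of (m, k) \<Rightarrow> ?a m * ?a k)"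
      by (simp add: r_def mk)
  qed auto
  moreover have "inj_on ?w ?D"
  proof (rule inj_onI)
    fix x y assume eq: "?w x = ?w y"
    obtain m k m' k' where xy: "x = (m, k)" "y = (m', k')" by (cases x, cases y)
    have "complex_of_int (m - m') + of_int (k - k') * \<tau> = 0"
      using eq by (simp add: xy algebra_simps)
    then show "x = y" using K(2)[of "m - m'" "k - k'"] by (auto simp: xy)
  qed
  ultimately have "(\<lambda>\<omega>. 1 / cmod \<omega> ^ 3) summable_on ?w ` ?D"
    by (subst summable_on_reindex) (auto simp: o_def)
  moreover have "lattice \<tau> - {0} \<subseteq> ?w ` ?D"
    unfolding lattice_def by force
  ultimately show ?thesis by (rule summable_on_subset_banach)
qed

text \<open>The difference equals z (2 \<omega> - z) / ((z - \<omega>)^2 \<omega>^2). With r =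
  |\<omega>| > 2 R the numerator is at most 3 R r and |z - \<omega>| is at least r / 2, which gives
  the constant 3 * 4 = 12. Subtracting 1 / \<omega>^2 improves the decay from r^(-2) to the summable
  r^(-3).\<close>

lemma wp_term_bound:
  assumes "cmod z \<le> R" "2 * R < cmod \<omega>"
  shows "cmod (1 / (z - \<omega>)\<^sup>2 - 1 / \<omega>\<^sup>2) \<le> 12 * R * (1 / cmod \<omega> ^ 3)"
proof -
  define r where "r = cmod \<omega>"
  have R: "0 \<le> R" using assms(1) norm_ge_zero order_trans by blast
  have r: "r > 0" "2 * R < r" using R assms(2) by (auto simp: r_def)
  have z\<omega>: "r / 2 \<le> cmod (z - \<omega>)"
    using norm_triangle_ineq2[of \<omega> z] assms by (simp add: r_def norm_minus_commute)
  have ne: "z - \<omega> \<noteq> 0" "\<omega> \<noteq> 0" using z\<omega> r by (auto simp: r_def)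
  have "1 / (z - \<omega>)\<^sup>2 - 1 / \<omega>\<^sup>2 = z * (2 * \<omega> - z) / ((z - \<omega>)\<^sup>2 * \<omega>\<^sup>2)"
  proof -
    have "1 / (z - \<omega>)\<^sup>2 - 1 / \<omega>\<^sup>2 = (\<omega>\<^sup>2 - (z - \<omega>)\<^sup>2) / ((z - \<omega>)\<^sup>2 * \<omega>\<^sup>2)"
      using ne by (simp add: diff_frac_eq)
    also have "\<omega>\<^sup>2 - (z - \<omega>)\<^sup>2 = z * (2 * \<omega> - z)"
      by (simp add: power2_eq_square algebra_simps)
    finally show ?thesis .
  qed
  then have "cmod (1 / (z - \<omega>)\<^sup>2 - 1 / \<omega>\<^sup>2) = cmod z * cmod (2 * \<omega> - z) / ((cmod (z - \<omega>))\<^sup>2 * r\<^sup>2)"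
    by (simp add: norm_mult norm_divide norm_power r_def)
  also have "\<dots> \<le> R * (3 * r) / ((r / 2)\<^sup>2 * r\<^sup>2)"
  proof (rule frac_le)
    have "cmod (2 * \<omega> - z) \<le> 2 * r + R"
      using norm_triangle_ineq4[of "2 * \<omega>" z] assms by (simp add: r_def norm_mult)
    then show "cmod z * cmod (2 * \<omega> - z) \<le> R * (3 * r)"
      using assms r R by (intro mult_mono) auto
    show "(r / 2)\<^sup>2 * r\<^sup>2 \<le> (cmod (z - \<omega>))\<^sup>2 * r\<^sup>2"
      using z\<omega> r by (intro mult_right_mono power_mono) auto
  qed (use r R in auto)
  also have "\<dots> = 12 * R * (1 / r ^ 3)"
    using r by (simp add: field_simps power2_eq_square power3_eq_cube)
  finally show ?thesis by (simp add: r_def)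
qed

text \<open>Lattice points of modulus at most 2 R are finitely many and are split off; the remaining
  terms converge uniformly by the bound 12 R / |\<omega>|^3, so their sum is holomorphic. The
  equation holds at lattice points too, since both sides evaluate 1 / 0 as 0.\<close>

lemma wp_local_decomposition:
  assumes "Im \<tau> > 0" "R > 0"
  obtains S H where "finite S" "H holomorphic_on ball 0 R"
    "\<And>z. z \<in> ball 0 R \<Longrightarrow> wp \<tau> z = 1 / z\<^sup>2 + (\<Sum>\<omega>\<in>S. 1 / (z - \<omega>)\<^sup>2 - 1 / \<omega>\<^sup>2) + H z"
proof
  define L where "L = lattice \<tau> - {0}"
  define S where "S = {\<omega> \<in> L. cmod \<omega> \<le> 2 * R}"
  define f where "f = (\<lambda>\<omega> z::complex. 1 / (z - \<omega>)\<^sup>2 - 1 / \<omega>\<^sup>2)"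
  define M where "M = (\<lambda>\<omega>::complex. 12 * R * (1 / cmod \<omega> ^ 3))"
  show finS: "finite S"
    by (rule finite_subset[OF _ finite_lattice_cball[OF assms(1), of "2 * R"]]) (auto simp: S_def L_def)
  have M: "M summable_on (L - S)"
    unfolding M_def L_def
    by (rule summable_on_cmult_right, rule summable_on_subset_banach[OF summable_lattice_cube[OF assms(1)]]) auto
  have bound: "norm (f \<omega> z) \<le> M \<omega>" if "\<omega> \<in> L - S" "z \<in> cball 0 R" for \<omega> z
    unfolding f_def M_def by (rule wp_term_bound) (use that in \<open>auto simp: S_def\<close>)
  have ulim: "uniform_limit (cball 0 R) (\<lambda>X z. \<Sum>\<omega>\<in>X. f \<omega> z) (\<lambda>z. \<Sum>\<^sub>\<infinity>\<omega>\<in>L - S. f \<omega> z) (finite_subsets_at_top (L - S))"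
    by (rule Weierstrass_m_test_general[OF bound M])
  have holo: "\<forall>\<^sub>F X in finite_subsets_at_top (L - S).
      continuous_on (cball 0 R) (\<lambda>z. \<Sum>\<omega>\<in>X. f \<omega> z) \<and> (\<lambda>z. \<Sum>\<omega>\<in>X. f \<omega> z) holomorphic_on ball 0 R"
  proof (rule eventually_finite_subsets_at_top_weakI)
    fix X assume X: "finite X" "X \<subseteq> L - S"
    have "z - \<omega> \<noteq> 0" "\<omega> \<noteq> 0" if "\<omega> \<in> X" "z \<in> cball 0 R" for z \<omega>
      using that X assms(2) by (auto simp: S_def L_def)
    then have "(\<lambda>z. \<Sum>\<omega>\<in>X. f \<omega> z) holomorphic_on cball 0 R"
      unfolding f_def by (auto intro!: holomorphic_intros)
    then show "continuous_on (cball 0 R) (\<lambda>z. \<Sum>\<omega>\<in>X. f \<omega> z) \<and> (\<lambda>z. \<Sum>\<omega>\<in>X. f \<omega> z) holomorphic_on ball 0 R"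
      using holomorphic_on_imp_continuous_on holomorphic_on_subset ball_subset_cball by blast
  qed
  show "(\<lambda>z. \<Sum>\<^sub>\<infinity>\<omega>\<in>L - S. f \<omega> z) holomorphic_on ball 0 R"
    using holomorphic_uniform_limit[OF holo ulim finite_subsets_at_top_neq_bot] .
  fix z :: complex assume z: "z \<in> ball 0 R"
  \<comment> \<open>\<open>infsum\<close> defaults to 0 on families that are not summable, so the
    tail has to be summable before the finite part can be separated from it.\<close>
  have "(\<lambda>\<omega>. f \<omega> z) summable_on (L - S)"
  proof (rule abs_summable_summable, rule Infinite_Sum.abs_summable_on_comparison_test'[OF M])
    fix \<omega> assume "\<omega> \<in> L - S"
    then show "norm (f \<omega> z) \<le> M \<omega>" using z by (intro bound) auto
  qed
  then have "infsum (\<lambda>\<omega>. f \<omega> z) (S \<union> (L - S)) = infsum (\<lambda>\<omega>. f \<omega> z) S + infsum (\<lambda>\<omega>. f \<omega> z) (L - S)"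
    using finS by (intro infsum_Un_disjoint) auto
  moreover have "S \<union> (L - S) = L" by (auto simp: S_def)
  ultimately show "wp \<tau> z = 1 / z\<^sup>2 + (\<Sum>\<omega>\<in>S. 1 / (z - \<omega>)\<^sup>2 - 1 / \<omega>\<^sup>2) + (\<Sum>\<^sub>\<infinity>\<omega>\<in>L - S. f \<omega> z)"
    using finS by (simp add: wp_def f_def L_def)
qed

lemma wp_minus: "wp \<tau> (- z) = wp \<tau> z"
proof -
  let ?L = "lattice \<tau> - {0}"
  have neg: "- \<omega> \<in> lattice \<tau>" if "\<omega> \<in> lattice \<tau>" for \<omega>
  proof -
    from that obtain m k where "\<omega> = of_int m + of_int k * \<tau>" by (auto simp: lattice_def)
    then have "- \<omega> = of_int (- m) + of_int (- k) * \<tau>" by simp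
    then show ?thesis unfolding lattice_def by blast
  qed
  have "(\<Sum>\<^sub>\<infinity>\<omega>\<in>?L. 1 / (- z - \<omega>)\<^sup>2 - 1 / \<omega>\<^sup>2) = (\<Sum>\<^sub>\<infinity>\<omega>\<in>?L. 1 / (z - \<omega>)\<^sup>2 - 1 / \<omega>\<^sup>2)"
  proof (rule infsum_reindex_bij_witness[where i = uminus and j = uminus])
    fix \<omega>
    have "(- z - \<omega>)\<^sup>2 = (z - (- \<omega>))\<^sup>2" by (simp add: power2_eq_square algebra_simps)
    then show "1 / (z - (- \<omega>))\<^sup>2 - 1 / (- \<omega>)\<^sup>2 = 1 / (- z - \<omega>)\<^sup>2 - 1 / \<omega>\<^sup>2" by simp
  qed (use neg in auto)
  then show ?thesis by (simp add: wp_def)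
qed

section \<open>Local quotients of holomorphic functions\<close>

definition mero_at :: "nat \<Rightarrow> ((nat \<Rightarrow> complex) \<Rightarrow> complex) \<Rightarrow> (nat \<Rightarrow> complex) \<Rightarrow> bool" where
  "mero_at n f p \<longleftrightarrow> (\<exists>U g h. open U \<and> p \<in> U \<and> holo_on n U g \<and> holo_on n U h \<and>
     (\<forall>V. open V \<and> V \<subseteq> U \<and> V \<noteq> {} \<longrightarrow> (\<exists>x\<in>V. h x \<noteq> 0)) \<and>
     (\<forall>x\<in>U. h x \<noteq> 0 \<longrightarrow> f x = g x / h x))"

lemma mero_atI:
  assumes "open U" "p \<in> U" "holo_on n U g" "holo_on n U h"
    and "\<And>V. open V \<Longrightarrow> V \<subseteq> U \<Longrightarrow> V \<noteq> {} \<Longrightarrow> \<exists>x\<in>V. h x \<noteq> 0"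
    and "\<And>x. x \<in> U \<Longrightarrow> h x \<noteq> 0 \<Longrightarrow> f x = g x / h x"
  shows "mero_at n f p"
  using assms unfolding mero_at_def by blast

lemma meromorphic_iff_mero_at: "meromorphic n f \<longleftrightarrow> dep_only n f \<and> (\<forall>p. mero_at n f p)"
  by (simp add: meromorphic_def mero_at_def)

lemma holo_on_subset: "holo_on n U g \<Longrightarrow> V \<subseteq> U \<Longrightarrow> holo_on n V g"
  unfolding holo_on_def using continuous_on_subset by blast

lemma holo_on_const: "holo_on n U (\<lambda>x. c)"
  by (auto simp: holo_on_def dep_only_def)

lemma holo_on_add: "holo_on n U g \<Longrightarrow> holo_on n U h \<Longrightarrow> holo_on n U (\<lambda>x. g x + h x)"
  unfolding holo_on_def dep_only_def
  by (auto intro!: continuous_intros field_differentiable_add) metis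

lemma holo_on_mult: "holo_on n U g \<Longrightarrow> holo_on n U h \<Longrightarrow> holo_on n U (\<lambda>x. g x * h x)"
  unfolding holo_on_def dep_only_def
  by (auto intro!: continuous_intros field_differentiable_mult) metis

text \<open>By continuity \<open>h\<close> is nonzero on a nonempty open part of V, and there
  \<open>k\<close> takes a nonzero value. This makes the condition on denominators stable under
  products.\<close>

lemma holo_nonzero_mult:
  assumes U: "open U" and h: "holo_on n U h"
    and h0: "\<And>V. open V \<Longrightarrow> V \<subseteq> U \<Longrightarrow> V \<noteq> {} \<Longrightarrow> \<exists>x\<in>V. h x \<noteq> 0"
    and k0: "\<And>V. open V \<Longrightarrow> V \<subseteq> U \<Longrightarrow> V \<noteq> {} \<Longrightarrow> \<exists>x\<in>V. k x \<noteq> 0"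
    and V: "open V" "V \<subseteq> U" "V \<noteq> {}"
  shows "\<exists>x\<in>V. h x * k x \<noteq> 0"
proof -
  define W where "W = V \<inter> (U \<inter> h -` (- {0}))"
  have "continuous_on U h" using h by (simp add: holo_on_def)
  then have "open (U \<inter> h -` (- {0}))"
    using U by (intro continuous_open_preimage) auto
  then have "open W" using V(1) by (auto simp: W_def)
  moreover have "W \<noteq> {}" using h0[OF V] V(2) by (auto simp: W_def)
  moreover have "W \<subseteq> U" by (auto simp: W_def)
  ultimately obtain x where "x \<in> W" "k x \<noteq> 0" using k0 by blast
  then show ?thesis by (auto simp: W_def)
qed

lemma mero_at_combine:
  assumes "mero_at n f p" "mero_at n f' p"
  obtains U g h g' h' where "open U" "p \<in> U" "holo_on n U g" "holo_on n U h" "holo_on n U g'" "holo_on n U h'"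
    "\<And>V. open V \<Longrightarrow> V \<subseteq> U \<Longrightarrow> V \<noteq> {} \<Longrightarrow> \<exists>x\<in>V. h x * h' x \<noteq> 0"
    "\<And>x. x \<in> U \<Longrightarrow> h x \<noteq> 0 \<Longrightarrow> f x = g x / h x"
    "\<And>x. x \<in> U \<Longrightarrow> h' x \<noteq> 0 \<Longrightarrow> f' x = g' x / h' x"
proof -
  from assms(1) obtain U g h where 1: "open U" "p \<in> U" "holo_on n U g" "holo_on n U h"
    and h: "\<And>V. open V \<Longrightarrow> V \<subseteq> U \<Longrightarrow> V \<noteq> {} \<Longrightarrow> \<exists>x\<in>V. h x \<noteq> 0"
    and f: "\<And>x. x \<in> U \<Longrightarrow> h x \<noteq> 0 \<Longrightarrow> f x = g x / h x"
    unfolding mero_at_def by auto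
  from assms(2) obtain U' g' h' where 2: "open U'" "p \<in> U'" "holo_on n U' g'" "holo_on n U' h'"
    and h': "\<And>V. open V \<Longrightarrow> V \<subseteq> U' \<Longrightarrow> V \<noteq> {} \<Longrightarrow> \<exists>x\<in>V. h' x \<noteq> 0"
    and f': "\<And>x. x \<in> U' \<Longrightarrow> h' x \<noteq> 0 \<Longrightarrow> f' x = g' x / h' x"
    unfolding mero_at_def by auto
  show ?thesis
  proof (rule that[of "U \<inter> U'" g h g' h'])
    show "holo_on n (U \<inter> U') g" "holo_on n (U \<inter> U') h" "holo_on n (U \<inter> U') g'" "holo_on n (U \<inter> U') h'"
      using 1 2 holo_on_subset by (meson Int_lower1 Int_lower2)+
    then show "\<exists>x\<in>V. h x * h' x \<noteq> 0" if "open V" "V \<subseteq> U \<inter> U'" "V \<noteq> {}" for V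
      using that 1(1) 2(1) h h' by (intro holo_nonzero_mult[of "U \<inter> U'" n h h']) auto
  qed (use 1 2 f f' in auto)
qed

lemma mero_at_mult:
  assumes "mero_at n f p" "mero_at n f' p"
  shows "mero_at n (\<lambda>x. f x * f' x) p"
proof -
  obtain U g h g' h' where *: "open U" "p \<in> U" "holo_on n U g" "holo_on n U h" "holo_on n U g'" "holo_on n U h'"
    "\<And>V. open V \<Longrightarrow> V \<subseteq> U \<Longrightarrow> V \<noteq> {} \<Longrightarrow> \<exists>x\<in>V. h x * h' x \<noteq> 0"
    "\<And>x. x \<in> U \<Longrightarrow> h x \<noteq> 0 \<Longrightarrow> f x = g x / h x"
    "\<And>x. x \<in> U \<Longrightarrow> h' x \<noteq> 0 \<Longrightarrow> f' x = g' x / h' x"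
    by (rule mero_at_combine[OF assms]) (rule that)
  show ?thesis
  proof (rule mero_atI[of U p n "\<lambda>x. g x * g' x" "\<lambda>x. h x * h' x"])
    show "f x * f' x = g x * g' x / (h x * h' x)" if "x \<in> U" "h x * h' x \<noteq> 0" for x
      using * that by simp
  qed (use * in \<open>auto intro: holo_on_mult\<close>)
qed

lemma mero_at_add:
  assumes "mero_at n f p" "mero_at n f' p"
  shows "mero_at n (\<lambda>x. f x + f' x) p"
proof -
  obtain U g h g' h' where *: "open U" "p \<in> U" "holo_on n U g" "holo_on n U h" "holo_on n U g'" "holo_on n U h'"
    "\<And>V. open V \<Longrightarrow> V \<subseteq> U \<Longrightarrow> V \<noteq> {} \<Longrightarrow> \<exists>x\<in>V. h x * h' x \<noteq> 0"
    "\<And>x. x \<in> U \<Longrightarrow> h x \<noteq> 0 \<Longrightarrow> f x = g x / h x"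
    "\<And>x. x \<in> U \<Longrightarrow> h' x \<noteq> 0 \<Longrightarrow> f' x = g' x / h' x"
    by (rule mero_at_combine[OF assms]) (rule that)
  show ?thesis
  proof (rule mero_atI[of U p n "\<lambda>x. g x * h' x + g' x * h x" "\<lambda>x. h x * h' x"])
    show "f x + f' x = (g x * h' x + g' x * h x) / (h x * h' x)" if "x \<in> U" "h x * h' x \<noteq> 0" for x
      using * that by (simp add: add_frac_eq)
  qed (use * in \<open>auto intro: holo_on_mult holo_on_add\<close>)
qed

lemma mero_at_holo:
  assumes "open U" "p \<in> U" "holo_on n U g" "\<And>x. x \<in> U \<Longrightarrow> f x = g x"
  shows "mero_at n f p"
  using assms by (intro mero_atI[of U p n g "\<lambda>x. 1"]) (auto intro: holo_on_const)

lemma mero_at_const: "mero_at n (\<lambda>x. c) p"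
  by (rule mero_at_holo[of UNIV]) (auto intro: holo_on_const)

lemma mero_at_cong:
  assumes "mero_at n f p" "open W" "p \<in> W" "\<And>x. x \<in> W \<Longrightarrow> f x = f' x"
  shows "mero_at n f' p"
proof -
  from assms(1) obtain U g h where "open U" "p \<in> U" "holo_on n U g" "holo_on n U h"
    and "\<forall>V. open V \<and> V \<subseteq> U \<and> V \<noteq> {} \<longrightarrow> (\<exists>x\<in>V. h x \<noteq> 0)"
    and "\<forall>x\<in>U. h x \<noteq> 0 \<longrightarrow> f x = g x / h x"
    unfolding mero_at_def by blast
  then show ?thesis
    using assms(2-4) by (intro mero_atI[of "U \<inter> W" p n g h]) (auto intro: holo_on_subset)
qed

lemma mero_at_sum:
  assumes "\<And>i. i \<in> A \<Longrightarrow> mero_at n (f i) p"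
  shows "mero_at n (\<lambda>x. \<Sum>i\<in>A. f i x) p"
  using assms by (induction A rule: infinite_finite_induct) (auto intro: mero_at_const mero_at_add)

lemma holo_on_compose_diff:
  assumes "i \<in> {1..n}" "j \<in> {1..n}" "i \<noteq> j" "open A" "\<phi> holomorphic_on A"
  shows "holo_on n ((\<lambda>x. x i - x j) -` A) (\<lambda>x. \<phi> (x i - x j))"
  unfolding holo_on_def
proof (intro conjI ballI)
  show "dep_only n (\<lambda>x. \<phi> (x i - x j))"
    unfolding dep_only_def using assms(1,2) by auto
  have "continuous_on ((\<lambda>x. x i - x j) -` A) (\<lambda>x::nat \<Rightarrow> complex. x i - x j)"
    by (intro continuous_on_diff continuous_on_subset[OF continuous_on_product_coordinates subset_UNIV])
  then show "continuous_on ((\<lambda>x. x i - x j) -` A) (\<lambda>x. \<phi> (x i - x j))"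
    by (rule continuous_on_compose2[OF holomorphic_on_imp_continuous_on[OF assms(5)]]) auto
  fix x l assume x: "x \<in> (\<lambda>x. x i - x j) -` A" and l: "l \<in> {1..n}"
  define q where "q = (\<lambda>z. (x(l := z)) i - (x(l := z)) j)"
  have qx: "q (x l) = x i - x j" by (simp add: q_def)
  have "q field_differentiable (at (x l))"
    unfolding q_def by (cases "l = i"; cases "l = j") (auto intro!: derivative_intros)
  moreover have "\<phi> field_differentiable (at (q (x l)))"
    using assms(4,5) x by (simp add: qx holomorphic_on_imp_differentiable_at)
  ultimately have "\<phi> \<circ> q field_differentiable (at (x l))"
    by (rule field_differentiable_compose)
  then show "(\<lambda>z. \<phi> ((x(l := z)) i - (x(l := z)) j)) field_differentiable (at (x l))"
    by (simp add: o_def q_def)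
qed

lemma open_vimage_diff: "open A \<Longrightarrow> open ((\<lambda>x::nat \<Rightarrow> complex. x i - x j) -` A)"
  by (intro open_vimage continuous_on_diff continuous_on_product_coordinates)

text \<open>In the product topology the slice of V along coordinate i is open in the plane. If x_i -
  x_j were constant on V, a slice through a point of V would be that single point, which is not
  open.\<close>

lemma open_exists_diff_neq:
  fixes V :: "(nat \<Rightarrow> complex) set"
  assumes "open V" "V \<noteq> {}" "i \<noteq> j"
  shows "\<exists>x\<in>V. x i - x j \<noteq> \<omega>"
proof (rule ccontr)
  assume "\<not> ?thesis"
  then have eq: "x i - x j = \<omega>" if "x \<in> V" for x using that by blast
  obtain x where x: "x \<in> V" using assms(2) by blast
  have "continuous_on UNIV (\<lambda>z. x(i := z))"
  proof (rule continuous_on_coordinatewise_then_product)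
    show "continuous_on UNIV (\<lambda>z. (x(i := z)) l)" for l
      by (cases "l = i") auto
  qed
  then have "open ((\<lambda>z. x(i := z)) -` V)"
    using assms(1) open_vimage by blast
  moreover have "x i \<in> (\<lambda>z. x(i := z)) -` V" using x by simp
  moreover have "(\<lambda>z. x(i := z)) -` V \<subseteq> {x i}"
    using eq eq[OF x] assms(3) by force
  ultimately have "open {x i}"
    by (metis empty_iff subset_singletonD)
  then show False by (simp add: not_open_singleton)
qed

lemma mero_at_pole:
  assumes "i \<in> {1..n}" "j \<in> {1..n}" "i \<noteq> j"
  shows "mero_at n (\<lambda>x. 1 / (x i - x j - \<omega>)\<^sup>2) p"
proof (rule mero_atI[of UNIV p n "\<lambda>x. 1" "\<lambda>x. (x i - x j - \<omega>)\<^sup>2"])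
  show "holo_on n UNIV (\<lambda>x. (x i - x j - \<omega>)\<^sup>2)"
    using holo_on_compose_diff[OF assms, of UNIV "\<lambda>z. (z - \<omega>)\<^sup>2"] by (simp add: holomorphic_intros)
  show "\<exists>x\<in>V. (x i - x j - \<omega>)\<^sup>2 \<noteq> 0" if "open V" "V \<noteq> {}" for V
    using open_exists_diff_neq[OF that assms(3), of \<omega>] by auto
qed (auto intro: holo_on_const)

lemma meromorphic_wp:
  assumes "Im \<tau> > 0" "i \<in> {1..n}" "j \<in> {1..n}" "i \<noteq> j"
  shows "meromorphic n (\<lambda>x. wp \<tau> (x i - x j))"
  unfolding meromorphic_iff_mero_at
proof (intro conjI allI)
  show "dep_only n (\<lambda>x. wp \<tau> (x i - x j))"
    using assms by (auto simp: dep_only_def)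
  fix p :: "nat \<Rightarrow> complex"
  define R where "R = cmod (p i - p j) + 1"
  have "R > 0" by (simp add: R_def add_nonneg_pos)
  obtain S H where SH: "finite S" "H holomorphic_on ball 0 R"
    "\<And>z. z \<in> ball 0 R \<Longrightarrow> wp \<tau> z = 1 / z\<^sup>2 + (\<Sum>\<omega>\<in>S. 1 / (z - \<omega>)\<^sup>2 - 1 / \<omega>\<^sup>2) + H z"
    using wp_local_decomposition[OF assms(1) \<open>R > 0\<close>] by blast
  define W where "W = (\<lambda>x::nat \<Rightarrow> complex. x i - x j) -` ball 0 R"
  have W: "open W" "p \<in> W"
    by (auto simp: W_def R_def intro: open_vimage_diff)
  have H: "mero_at n (\<lambda>x. H (x i - x j)) p"
    by (rule mero_at_holo[OF W]) (use holo_on_compose_diff[OF assms(2-4) _ SH(2)] in \<open>auto simp: W_def\<close>)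
  have pole: "mero_at n (\<lambda>x. 1 / (x i - x j - \<omega>)\<^sup>2 + - (1 / \<omega>\<^sup>2)) p" for \<omega>
    by (intro mero_at_add mero_at_const mero_at_pole assms)
  \<comment> \<open>The principal part at 0 is written as the pole with \<omega> = 0, so that
    \<open>mero_at_pole\<close> covers all poles alike.\<close>
  have "mero_at n (\<lambda>x. 1 / (x i - x j - 0)\<^sup>2 + (\<Sum>\<omega>\<in>S. 1 / (x i - x j - \<omega>)\<^sup>2 + - (1 / \<omega>\<^sup>2)) + H (x i - x j)) p"
    by (intro mero_at_add mero_at_sum mero_at_pole assms H mero_at_const)
  then show "mero_at n (\<lambda>x. wp \<tau> (x i - x j)) p"
    by (rule mero_at_cong[OF _ W]) (simp add: W_def SH(3))
qed

lemma meromorphic_const: "meromorphic n (\<lambda>x. c)"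
  unfolding meromorphic_iff_mero_at by (auto simp: dep_only_def mero_at_const)

lemma meromorphic_add: "meromorphic n f \<Longrightarrow> meromorphic n g \<Longrightarrow> meromorphic n (\<lambda>x. f x + g x)"
  unfolding meromorphic_iff_mero_at dep_only_def by (auto intro: mero_at_add) metis

lemma meromorphic_mult: "meromorphic n f \<Longrightarrow> meromorphic n g \<Longrightarrow> meromorphic n (\<lambda>x. f x * g x)"
  unfolding meromorphic_iff_mero_at dep_only_def by (auto intro: mero_at_mult) metis

lemma meromorphic_sum:
  assumes "\<And>i. i \<in> A \<Longrightarrow> meromorphic n (f i)"
  shows "meromorphic n (\<lambda>x. \<Sum>i\<in>A. f i x)"
  using assms by (induction A rule: infinite_finite_induct) (auto intro: meromorphic_const meromorphic_add)

lemma meromorphic_prod: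
  assumes "\<And>i. i \<in> A \<Longrightarrow> meromorphic n (f i)"
  shows "meromorphic n (\<lambda>x. \<Prod>i\<in>A. f i x)"
  using assms by (induction A rule: infinite_finite_induct) (auto intro: meromorphic_const meromorphic_mult)

subsection \<open>Sums over subsets\<close>

text \<open>Marking an element u of A and removing it gives a pair of u and a set avoiding u. The
  companion with u outside A reaches the same pairs, so the two together trade an element inside a
  set for one outside it.\<close>

lemma sum_Pow_remove:
  fixes f :: "'a \<Rightarrow> 'a set \<Rightarrow> 'b::comm_monoid_add"
  assumes "finite U"
  shows "(\<Sum>A\<in>Pow U. \<Sum>u\<in>A. f u (A - {u})) = (\<Sum>u\<in>U. \<Sum>A\<in>Pow (U - {u}). f u A)"
proof -
  have "(\<Sum>A\<in>Pow U. \<Sum>u\<in>A. f u (A - {u})) = (\<Sum>(A, u)\<in>Sigma (Pow U) (\<lambda>A. A). f u (A - {u}))"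
    by (rule sum.Sigma) (use assms finite_subset in auto)
  also have "\<dots> = (\<Sum>(u, A)\<in>Sigma U (\<lambda>u. Pow (U - {u})). f u A)"
    by (rule sum.reindex_bij_witness[where i = "\<lambda>(u, A). (insert u A, u)" and j = "\<lambda>(A, u). (u, A - {u})"]) auto
  also have "\<dots> = (\<Sum>u\<in>U. \<Sum>A\<in>Pow (U - {u}). f u A)"
    by (rule sum.Sigma[symmetric]) (use assms in auto)
  finally show ?thesis .
qed

lemma sum_Pow_outside:
  fixes f :: "'a \<Rightarrow> 'a set \<Rightarrow> 'b::comm_monoid_add"
  assumes "finite U"
  shows "(\<Sum>A\<in>Pow U. \<Sum>u\<in>U - A. f u A) = (\<Sum>u\<in>U. \<Sum>A\<in>Pow (U - {u}). f u A)"
proof -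
  have "(\<Sum>A\<in>Pow U. \<Sum>u\<in>U - A. f u A) = (\<Sum>(A, u)\<in>Sigma (Pow U) (\<lambda>A. U - A). f u A)"
    by (rule sum.Sigma) (use assms in auto)
  also have "\<dots> = (\<Sum>(u, A)\<in>Sigma U (\<lambda>u. Pow (U - {u})). f u A)"
    by (rule sum.reindex_bij_witness[where i = "\<lambda>(u, A). (A, u)" and j = "\<lambda>(A, u). (u, A)"]) auto
  also have "\<dots> = (\<Sum>u\<in>U. \<Sum>A\<in>Pow (U - {u}). f u A)"
    by (rule sum.Sigma[symmetric]) (use assms in auto)
  finally show ?thesis .
qed

text \<open>Meant for an F that sums over orderings of A: f u then collects those with u as first
  (or last) factor. The empty set has no such factor and appears separately.\<close>

lemma sum_Pow_rec:
  fixes F :: "'a set \<Rightarrow> 'b::comm_monoid_add"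
  assumes "finite U"
    and "\<And>A. A \<subseteq> U \<Longrightarrow> A \<noteq> {} \<Longrightarrow> F A = (\<Sum>u\<in>A. f u (A - {u}))"
  shows "(\<Sum>A\<in>Pow U. F A) = F {} + (\<Sum>u\<in>U. \<Sum>A\<in>Pow (U - {u}). f u A)"
proof -
  have "(\<Sum>A\<in>Pow U. F A) = (\<Sum>A\<in>Pow U. (if A = {} then F {} else 0) + (\<Sum>u\<in>A. f u (A - {u})))"
    using assms(2) by (intro sum.cong) auto
  also have "\<dots> = F {} + (\<Sum>u\<in>U. \<Sum>A\<in>Pow (U - {u}). f u A)"
    using assms(1) by (simp add: sum.distrib sum_Pow_remove)
  finally show ?thesis .
qed

lemma sum_distinct_pairs_swap:
  fixes f :: "'a \<Rightarrow> 'a \<Rightarrow> 'b::comm_monoid_add"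
  assumes "finite U"
  shows "(\<Sum>u\<in>U. \<Sum>v\<in>U - {u}. f u v) = (\<Sum>v\<in>U. \<Sum>u\<in>U - {v}. f u v)"
proof -
  have "(\<Sum>u\<in>U. \<Sum>v\<in>U - {u}. f u v) = (\<Sum>u\<in>U. \<Sum>v\<in>U. if u = v then 0 else f u v)"
    using assms by (intro sum.cong refl sum.mono_neutral_cong_left) auto
  also have "\<dots> = (\<Sum>v\<in>U. \<Sum>u\<in>U. if u = v then 0 else f u v)"
    by (rule sum.swap)
  also have "\<dots> = (\<Sum>v\<in>U. \<Sum>u\<in>U - {v}. f u v)"
    using assms by (intro sum.cong refl sum.mono_neutral_cong_right) auto
  finally show ?thesis .
qed

lemma sum_disjoint_pairs_swap:
  fixes f :: "'a set \<Rightarrow> 'a set \<Rightarrow> 'b::comm_monoid_add"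
  assumes "finite U"
  shows "(\<Sum>A\<in>Pow U. \<Sum>B\<in>Pow (U - A). f A B) = (\<Sum>B\<in>Pow U. \<Sum>A\<in>Pow (U - B). f A B)"
proof -
  have "(\<Sum>A\<in>Pow U. \<Sum>B\<in>Pow (U - A). f A B) = (\<Sum>(A, B)\<in>Sigma (Pow U) (\<lambda>A. Pow (U - A)). f A B)"
    by (rule sum.Sigma) (use assms in auto)
  also have "\<dots> = (\<Sum>(B, A)\<in>Sigma (Pow U) (\<lambda>A. Pow (U - A)). f A B)"
    by (rule sum.reindex_bij_witness[where i = "\<lambda>(u, A). (A, u)" and j = "\<lambda>(A, u). (u, A)"]) auto
  also have "\<dots> = (\<Sum>B\<in>Pow U. \<Sum>A\<in>Pow (U - B). f A B)"
    by (rule sum.Sigma[symmetric]) (use assms in auto)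
  finally show ?thesis .
qed

text \<open>A disjoint pair is recorded by its union C and its first member A. This merges words
  whose first indices are divided between two blocks.\<close>

lemma sum_disjoint_pairs_Un:
  fixes f :: "'a set \<Rightarrow> 'a set \<Rightarrow> 'b::comm_monoid_add"
  assumes "finite U"
  shows "(\<Sum>A\<in>Pow U. \<Sum>B\<in>Pow (U - A). f A B) = (\<Sum>C\<in>Pow U. \<Sum>A\<in>Pow C. f A (C - A))"
proof -
  have "(\<Sum>A\<in>Pow U. \<Sum>B\<in>Pow (U - A). f A B) = (\<Sum>(A, B)\<in>Sigma (Pow U) (\<lambda>A. Pow (U - A)). f A B)"
    by (rule sum.Sigma) (use assms in auto)
  also have "\<dots> = (\<Sum>(C, A)\<in>Sigma (Pow U) (\<lambda>C. Pow C). f A (C - A))"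
    by (rule sum.reindex_bij_witness[where i = "\<lambda>(C, A). (A, C - A)" and j = "\<lambda>(A, B). (A \<union> B, A)"])
      (auto, metis Un_Diff Diff_cancel Diff_triv Un_empty_left Int_commute inf.absorb_iff2 Diff_disjoint Diff_subset_conv Diff_Int2 Int_Diff)
  also have "\<dots> = (\<Sum>C\<in>Pow U. \<Sum>A\<in>Pow C. f A (C - A))"
    by (rule sum.Sigma[symmetric]) (use assms finite_subset in auto)
  finally show ?thesis .
qed

lemma sum_Pow_insert:
  fixes f :: "'a set \<Rightarrow> 'b::comm_monoid_add"
  assumes "finite U" "j \<notin> U"
  shows "(\<Sum>A\<in>Pow (insert j U). f A) = (\<Sum>A\<in>Pow U. f A) + (\<Sum>A\<in>Pow U. f (insert j A))"
proof -
  have "inj_on (insert j) (Pow U)"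
    using assms(2) by (auto intro!: inj_onI)
  then show ?thesis
    unfolding Pow_insert
    by (subst sum.union_disjoint) (use assms in \<open>auto simp: sum.reindex\<close>)
qed

lemma sum_commute_right:
  fixes f :: "'a \<Rightarrow> 'r::ring_1"
  assumes "\<And>x. x \<in> A \<Longrightarrow> f x * y = y * f x"
  shows "sum f A * y = y * sum f A"
  using assms by (simp add: sum_distrib_left sum_distrib_right)

lemma prod_list_commute_right:
  fixes y :: "'r::ring_1"
  assumes "\<And>x. x \<in> set xs \<Longrightarrow> x * y = y * x"
  shows "prod_list xs * y = y * prod_list xs"
  using assms
proof (induction xs)
  case (Cons a xs)
  then have "a * (prod_list xs * y) = (y * a) * prod_list xs"
    by (metis list.set_intros(1) list.set_intros(2) mult.assoc)
  then show ?case by (simp add: mult.assoc)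
qed simp

subsection \<open>Brackets and the recursion\<close>

text \<open>Here \<open>br i j\<close> is the bracket $[ij]$, and \<open>p i j\<close>, \<open>w i j\<close>, \<open>ph A\<close> stand for
  $\wp(\lambda_{ij})$, $\wp(x_{ij})$ and $\phi(A)$; of these only evenness of $\wp$ and the expansion
  of $\phi$ along one element matter.\<close>
locale dunkl_brackets =
  fixes br :: "'i::linorder \<Rightarrow> 'i \<Rightarrow> 'r::ring_1"
    and p w :: "'i \<Rightarrow> 'i \<Rightarrow> 'r"
    and ph :: "'i set \<Rightarrow> 'r"
  assumes br_anti: "i \<noteq> j \<Longrightarrow> br j i = - br i j"
    and br_square: "i \<noteq> j \<Longrightarrow> br i j * br i j = p i j - w i j"
    and br_commute: "distinct [i, j, k, l] \<Longrightarrow> br i j * br k l = br k l * br i j"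
    and br_cyclic: "distinct [i, j, k] \<Longrightarrow> br i j * br j k + br j k * br k i + br k i * br i j = 0"
    and p_br: "k \<noteq> l \<Longrightarrow> p i j * br k l = br k l * p i j"
    and p_ph: "p i j * ph A = ph A * p i j"
    and w_sym: "w i j = w j i"
    and w_ph: "w i j * ph A = ph A * w i j"
    and br_w: "distinct [a, i, j] \<Longrightarrow> br a j * w i j = w i a * br a j"
    and br_w_commute: "distinct [a, b, c, d] \<Longrightarrow> br a b * w c d = w c d * br a b"
    and ph_empty: "ph {} = 1"
    and ph_rec: "finite A \<Longrightarrow> a \<in> A \<Longrightarrow> ph A = (\<Sum>i\<in>A - {a}. w i a * ph (A - {i, a}))"
begin

section \<open>Ordered products with a common second index: e(A,b) is
  \<open>ord_sum A b\<close>\<close>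

definition ord_sum :: "'i set \<Rightarrow> 'i \<Rightarrow> 'r" where
  "ord_sum A b = (\<Sum>xs\<in>permutations_of_set A. prod_list (map (\<lambda>a. br a b) xs))"

lemma ord_sum_empty [simp]: "ord_sum {} b = 1"
  by (simp add: ord_sum_def)

lemma ord_sum_first:
  assumes "A \<noteq> {}" "finite A"
  shows "ord_sum A b = (\<Sum>a\<in>A. br a b * ord_sum (A - {a}) b)"
proof -
  have "ord_sum A b = (\<Sum>a\<in>A. \<Sum>xs\<in>(#) a ` permutations_of_set (A - {a}). prod_list (map (\<lambda>a. br a b) xs))"
    unfolding ord_sum_def permutations_of_set_nonempty[OF assms(1)]
    by (rule sum.UNION_disjoint) (use assms in auto)
  also have "\<dots> = (\<Sum>a\<in>A. br a b * ord_sum (A - {a}) b)"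
    by (simp add: sum.reindex ord_sum_def sum_distrib_left)
  finally show ?thesis .
qed

text \<open>Reversal permutes the orderings of A, so the last factor can be singled out just like
  the first.\<close>

lemma ord_sum_last:
  assumes "A \<noteq> {}" "finite A"
  shows "ord_sum A b = (\<Sum>a\<in>A. ord_sum (A - {a}) b * br a b)"
proof -
  have "ord_sum A b = (\<Sum>xs\<in>rev ` permutations_of_set A. prod_list (map (\<lambda>a. br a b) xs))"
    by (simp add: ord_sum_def)
  also have "\<dots> = (\<Sum>xs\<in>permutations_of_set A. prod_list (map (\<lambda>a. br a b) (rev xs)))"
    by (subst sum.reindex) (auto intro: inj_onI)
  also have "\<dots> = (\<Sum>a\<in>A. \<Sum>xs\<in>(#) a ` permutations_of_set (A - {a}). prod_list (map (\<lambda>a. br a b) (rev xs)))"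
    unfolding permutations_of_set_nonempty[OF assms(1)]
    by (rule sum.UNION_disjoint) (use assms in auto)
  also have "\<dots> = (\<Sum>a\<in>A. (\<Sum>xs\<in>permutations_of_set (A - {a}). prod_list (map (\<lambda>a. br a b) (rev xs))) * br a b)"
    by (simp add: sum.reindex sum_distrib_right)
  also have "\<dots> = (\<Sum>a\<in>A. (\<Sum>xs\<in>rev ` permutations_of_set (A - {a}). prod_list (map (\<lambda>a. br a b) xs)) * br a b)"
    by (subst sum.reindex) (auto intro: inj_onI)
  finally show ?thesis by (simp add: ord_sum_def)
qed

lemma ord_sum_singleton [simp]: "ord_sum {a} b = br a b"
  by (simp add: ord_sum_def)

lemma ord_sum_commute:
  assumes "\<And>a. a \<in> A \<Longrightarrow> br a b * y = y * br a b"
  shows "ord_sum A b * y = y * ord_sum A b"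
  unfolding ord_sum_def
  by (intro sum_commute_right prod_list_commute_right) (auto dest: permutations_of_setD intro: assms)

lemma ord_sum_br_commute:
  assumes "c \<notin> A" "d \<notin> A" "b \<notin> A" "distinct [b, c, d]"
  shows "ord_sum A b * br c d = br c d * ord_sum A b"
  by (rule ord_sum_commute, rule br_commute) (use assms in auto)

lemma ord_sum_ord_sum_commute:
  assumes "c \<notin> A" "b \<notin> A" "b \<notin> B" "c \<notin> B" "b \<noteq> c" "A \<inter> B = {}"
  shows "ord_sum A b * ord_sum B c = ord_sum B c * ord_sum A b"
  by (rule ord_sum_commute, rule ord_sum_br_commute[symmetric]) (use assms in auto)

text \<open>The three-term relation with [bu] = -[ub], read as a rule for moving [jb] to the right
  past [ub]. All uses of that relation go through this form.\<close>

lemma br_exchange: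
  assumes "distinct [u, b, j]"
  shows "br j b * br u b = br u j * br j b - br u b * br u j"
proof -
  have "br u j * br j b + br j b * br b u + br b u * br u j = 0"
    by (rule br_cyclic) (use assms in auto)
  moreover have "br b u = - br u b" by (rule br_anti) (use assms in auto)
  ultimately show ?thesis by (simp add: algebra_simps eq_neg_iff_add_eq_0)
qed

text \<open>[jb] travels through e(U,b) from left to right. At each [ub] the exchange rule either
  turns [ub] into [uj] and lets [jb] go on, or ends with [ub] [uj], where [jb] has disappeared.
  Going on to the end gives e(U,j) [jb]; stopping at u, with the elements of A already turned, gives
  the subtracted term after commuting factors with disjoint indices.\<close>

lemma br_ord_sum:
  assumes "finite U" "b \<notin> U" "j \<notin> U" "b \<noteq> j"
  shows "br j b * ord_sum U b = ord_sum U j * br j b -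
    (\<Sum>u\<in>U. \<Sum>A\<in>Pow (U - {u}). br u b * ord_sum (U - {u} - A) b * ord_sum A j * br u j)"
  using assms
proof (induction rule: finite_psubset_induct)
  case (psubset U)
  define X where "X = (\<lambda>U. \<Sum>u\<in>U. \<Sum>A\<in>Pow (U - {u}). br u b * ord_sum (U - {u} - A) b * ord_sum A j * br u j)"
  \<comment> \<open>\<open>Y\<close> is the part of \<open>X U\<close> with A empty.\<close>
  define Y where "Y = (\<Sum>u\<in>U. br u b * ord_sum (U - {u}) b * br u j)"
  show ?case
  proof (cases "U = {}")
    case False
    have "br j b * ord_sum U b = (\<Sum>u\<in>U. (br j b * br u b) * ord_sum (U - {u}) b)"
      using False psubset.hyps by (simp add: ord_sum_first[of U b] sum_distrib_left mult.assoc)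
    also have "\<dots> = (\<Sum>u\<in>U. br u j * (br j b * ord_sum (U - {u}) b) - br u b * ord_sum (U - {u}) b * br u j)"
    proof (rule sum.cong[OF refl])
      fix u assume u: "u \<in> U"
      have "br j b * br u b = br u j * br j b - br u b * br u j"
        by (rule br_exchange) (use u psubset.prems in auto)
      moreover have "ord_sum (U - {u}) b * br u j = br u j * ord_sum (U - {u}) b"
        by (rule ord_sum_br_commute) (use u psubset.prems in auto)
      ultimately show "br j b * br u b * ord_sum (U - {u}) b = br u j * (br j b * ord_sum (U - {u}) b) - br u b * ord_sum (U - {u}) b * br u j"
        by (simp add: left_diff_distrib mult.assoc)
    qed
    also have "\<dots> = (\<Sum>u\<in>U. br u j * (ord_sum (U - {u}) j * br j b - X (U - {u}))) - Y"
      unfolding Y_def sum_subtractf X_def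
      by (intro arg_cong2[where f = minus] sum.cong refl arg_cong2[where f = times] psubset.IH)
        (use psubset.prems in auto)
    also have "\<dots> = ord_sum U j * br j b - (\<Sum>u\<in>U. br u j * X (U - {u})) - Y"
      using False psubset.hyps
      by (simp add: ord_sum_first[of U j] sum_distrib_right sum_subtractf algebra_simps)
    \<comment> \<open>In the terms of \<open>X U\<close> with A nonempty the first factor [uj] of
      e(A,j) commutes with everything to its left. Moved to the front, it multiplies a term of
      \<open>X (U - {u})\<close>.\<close>
    also have "(\<Sum>u\<in>U. br u j * X (U - {u})) = X U - Y"
    proof -
      have "X U = (\<Sum>v\<in>U. br v b * ord_sum (U - {v}) b * br v j + (\<Sum>u\<in>U - {v}. \<Sum>A\<in>Pow (U - {v} - {u}).
           br v b * ord_sum (U - {v} - insert u A) b * (br u j * ord_sum A j) * br v j))"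
        unfolding X_def
      proof (rule sum.cong[OF refl])
        fix v assume v: "v \<in> U"
        show "(\<Sum>A\<in>Pow (U - {v}). br v b * ord_sum (U - {v} - A) b * ord_sum A j * br v j) =
            br v b * ord_sum (U - {v}) b * br v j + (\<Sum>u\<in>U - {v}. \<Sum>A\<in>Pow (U - {v} - {u}).
           br v b * ord_sum (U - {v} - insert u A) b * (br u j * ord_sum A j) * br v j)"
        proof (subst sum_Pow_rec[where f = "\<lambda>u A. br v b * ord_sum (U - {v} - insert u A) b * (br u j * ord_sum A j) * br v j"])
          fix A assume A: "A \<subseteq> U - {v}" "A \<noteq> {}"
          then have "finite A" using psubset.hyps finite_subset by auto
          with A show "br v b * ord_sum (U - {v} - A) b * ord_sum A j * br v j =
             (\<Sum>u\<in>A. br v b * ord_sum (U - {v} - insert u (A - {u})) b * (br u j * ord_sum (A - {u}) j) * br v j)"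
            by (simp add: ord_sum_first[of A j] sum_distrib_left sum_distrib_right insert_absorb)
        qed (use psubset.hyps in simp_all)
      qed
      also have "\<dots> = Y + (\<Sum>v\<in>U. \<Sum>u\<in>U - {v}. \<Sum>A\<in>Pow (U - {v} - {u}).
           br v b * ord_sum (U - {v} - insert u A) b * (br u j * ord_sum A j) * br v j)"
        by (simp add: sum.distrib Y_def)
      also have "(\<Sum>v\<in>U. \<Sum>u\<in>U - {v}. \<Sum>A\<in>Pow (U - {v} - {u}).
           br v b * ord_sum (U - {v} - insert u A) b * (br u j * ord_sum A j) * br v j) =
          (\<Sum>v\<in>U. \<Sum>u\<in>U - {v}. \<Sum>A\<in>Pow (U - {u} - {v}).
           br u j * (br v b * ord_sum (U - {u} - {v} - A) b * ord_sum A j * br v j))"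
      proof (intro sum.cong refl)
        fix u v A assume *: "v \<in> U" "u \<in> U - {v}" "A \<in> Pow (U - {u} - {v})"
        have "U - {v} - insert u A = U - {u} - {v} - A" by auto
        moreover have "ord_sum (U - {u} - {v} - A) b * br u j = br u j * ord_sum (U - {u} - {v} - A) b"
          by (rule ord_sum_br_commute) (use * psubset.prems in auto)
        moreover have "br v b * br u j = br u j * br v b"
          by (rule br_commute) (use * psubset.prems in auto)
        ultimately show "br v b * ord_sum (U - {v} - insert u A) b * (br u j * ord_sum A j) * br v j =
            br u j * (br v b * ord_sum (U - {u} - {v} - A) b * ord_sum A j * br v j)"
          by (metis mult.assoc)
      qed auto
      also have "\<dots> = (\<Sum>u\<in>U. br u j * X (U - {u}))"
        unfolding X_def sum_distrib_left
        using psubset.hyps(1) by (rule sum_distinct_pairs_swap)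
      finally show ?thesis by (simp add: algebra_simps)
    qed
    finally show ?thesis by (simp add: X_def)
  qed simp
qed

lemma ord_sum_insert_first:
  assumes "finite U" "j \<notin> U"
  shows "ord_sum (insert j U) b = br j b * ord_sum U b + (\<Sum>u\<in>U. br u b * ord_sum (insert j (U - {u})) b)"
proof -
  have "insert j U - {u} = insert j (U - {u})" if "u \<in> U" for u
    using that assms by auto
  then show ?thesis
    using assms by (simp add: ord_sum_first[of "insert j U"])
qed

text \<open>The words are sorted by their first factor. An initial [jb] is carried to the right by
  \<open>br_ord_sum\<close>. Behind an initial [ub] the induction hypothesis has a bracket lacking
  the summand -[uj]; the surplus this creates is exactly what \<open>br_ord_sum\<close>
  subtracts.\<close>

lemma ord_sum_insert_two:
  assumes "finite U" "b \<notin> U" "j \<notin> U" "b \<noteq> j"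
  shows "ord_sum (insert j U) b = (\<Sum>A\<in>Pow U. ord_sum (U - A) b * ord_sum A j * (br j b - (\<Sum>i\<in>U - A. br i j)))"
  using assms
proof (induction rule: finite_psubset_induct)
  case (psubset U)
  define D where "D = (\<lambda>A. br j b - (\<Sum>i\<in>U - A. br i j))"
  define X where "X = (\<Sum>u\<in>U. \<Sum>A\<in>Pow (U - {u}). br u b * ord_sum (U - {u} - A) b * ord_sum A j * br u j)"
  have fin: "finite U" by (rule psubset.hyps)
  have "(\<Sum>u\<in>U. br u b * ord_sum (insert j (U - {u})) b) =
    (\<Sum>u\<in>U. \<Sum>A\<in>Pow (U - {u}). br u b * ord_sum (U - {u} - A) b * ord_sum A j * D A) + X"
    unfolding X_def sum.distrib[symmetric]
  proof (rule sum.cong[OF refl])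
    fix u assume u: "u \<in> U"
    have "br u b * ord_sum (insert j (U - {u})) b = (\<Sum>A\<in>Pow (U - {u}). br u b * (ord_sum (U - {u} - A) b * ord_sum A j *
        (br j b - (\<Sum>i\<in>U - {u} - A. br i j))))"
      unfolding sum_distrib_left[symmetric]
      by (intro arg_cong2[where f = times] refl psubset.IH) (use u psubset.prems in auto)
    also have "\<dots> = (\<Sum>A\<in>Pow (U - {u}). br u b * ord_sum (U - {u} - A) b * ord_sum A j * D A + br u b * ord_sum (U - {u} - A) b * ord_sum A j * br u j)"
    proof (rule sum.cong[OF refl])
      fix A assume A: "A \<in> Pow (U - {u})"
      have "U - A - {u} = U - {u} - A" by auto
      then have "(\<Sum>i\<in>U - A. br i j) = br u j + (\<Sum>i\<in>U - {u} - A. br i j)"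
        using sum.remove[of "U - A" u "\<lambda>i. br i j"] fin u A by auto
      then have "br j b - (\<Sum>i\<in>U - {u} - A. br i j) = D A + br u j"
        by (simp add: D_def)
      then show "br u b * (ord_sum (U - {u} - A) b * ord_sum A j * (br j b - (\<Sum>i\<in>U - {u} - A. br i j))) =
         br u b * ord_sum (U - {u} - A) b * ord_sum A j * D A + br u b * ord_sum (U - {u} - A) b * ord_sum A j * br u j"
        by (simp add: distrib_left mult.assoc)
    qed
    finally show "br u b * ord_sum (insert j (U - {u})) b = (\<Sum>A\<in>Pow (U - {u}).
       br u b * ord_sum (U - {u} - A) b * ord_sum A j * D A + br u b * ord_sum (U - {u} - A) b * ord_sum A j * br u j)" .
  qed
  also have "(\<Sum>u\<in>U. \<Sum>A\<in>Pow (U - {u}). br u b * ord_sum (U - {u} - A) b * ord_sum A j * D A) =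
      (\<Sum>A\<in>Pow U. \<Sum>u\<in>U - A. br u b * ord_sum (U - {u} - A) b * ord_sum A j * D A)"
    by (rule sum_Pow_outside[OF fin, symmetric])
  \<comment> \<open>Summing over the first factor rebuilds e(U - A, b) except for A = U, where there
    is no first factor. The term e(U,j) [jb] lost there is supplied by
    \<open>br_ord_sum\<close>.\<close>
  also have "\<dots> = (\<Sum>A\<in>Pow U. ord_sum (U - A) b * ord_sum A j * D A - (if A = U then ord_sum U j * D U else 0))"
  proof (rule sum.cong[OF refl])
    fix A assume A: "A \<in> Pow U"
    have *: "U - {u} - A = U - A - {u}" for u by auto
    show "(\<Sum>u\<in>U - A. br u b * ord_sum (U - {u} - A) b * ord_sum A j * D A) =
       ord_sum (U - A) b * ord_sum A j * D A - (if A = U then ord_sum U j * D U else 0)"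
    proof (cases "A = U")
      case False
      then have "U - A \<noteq> {}" using A by auto
      then show ?thesis
        using False fin by (simp add: ord_sum_first[of "U - A" b] sum_distrib_right *)
    qed simp
  qed
  also have "\<dots> = (\<Sum>A\<in>Pow U. ord_sum (U - A) b * ord_sum A j * D A) - ord_sum U j * br j b"
    using fin by (simp add: sum_subtractf D_def)
  finally have "(\<Sum>u\<in>U. br u b * ord_sum (insert j (U - {u})) b) =
      (\<Sum>A\<in>Pow U. ord_sum (U - A) b * ord_sum A j * D A) - ord_sum U j * br j b + X" .
  moreover have "br j b * ord_sum U b = ord_sum U j * br j b - X"
    unfolding X_def using fin psubset.prems by (rule br_ord_sum)
  ultimately show ?case
    unfolding D_def ord_sum_insert_first[OF fin psubset.prems(2)] by simp
qed

text \<open>Apart from the words ending in [zi], e(U + z, i) is a difference of left and right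
  multiples by the [cz]. This is the source of the recursion shared by the cyclic sums and their
  values.\<close>

lemma ord_sum_shift:
  assumes "finite U" "i \<notin> U" "z \<notin> U" "i \<noteq> z"
  shows "ord_sum (insert z U) i =
    (\<Sum>c\<in>U. br c z * ord_sum (insert z (U - {c})) i) - ord_sum U i * (\<Sum>c\<in>U. br c z) + ord_sum U i * br z i"
  using assms
proof (induction rule: finite_psubset_induct)
  case (psubset U)
  have fin: "finite U" by (rule psubset.hyps)
  show ?case
  proof (cases "U = {}")
    case False
    define S where "S = (\<Sum>c\<in>U. br c z)"
    have IH: "br u i * ord_sum (insert z (U - {u})) i =
       (\<Sum>c\<in>U - {u}. br c z * (br u i * ord_sum (insert z (U - {c} - {u})) i)) - br u i * ord_sum (U - {u}) i * S
         + br u i * br u z * ord_sum (U - {u}) i + br u i * ord_sum (U - {u}) i * br z i" if u: "u \<in> U" for u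
    proof -
      have "ord_sum (insert z (U - {u})) i = (\<Sum>c\<in>U - {u}. br c z * ord_sum (insert z (U - {u} - {c})) i) -
         ord_sum (U - {u}) i * (\<Sum>c\<in>U - {u}. br c z) + ord_sum (U - {u}) i * br z i"
        by (rule psubset.IH) (use u psubset.prems in auto)
      moreover have "(\<Sum>c\<in>U - {u}. br c z) = S - br u z"
        using u fin by (simp add: S_def sum_diff1)
      moreover have "ord_sum (U - {u}) i * br u z = br u z * ord_sum (U - {u}) i"
        by (rule ord_sum_br_commute) (use u psubset.prems in auto)
      moreover have "br u i * (\<Sum>c\<in>U - {u}. br c z * ord_sum (insert z (U - {u} - {c})) i) =
         (\<Sum>c\<in>U - {u}. br c z * (br u i * ord_sum (insert z (U - {c} - {u})) i))"
        unfolding sum_distrib_left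
      proof (rule sum.cong[OF refl])
        fix c assume c: "c \<in> U - {u}"
        have "br u i * br c z = br c z * br u i"
          by (rule br_commute) (use u c psubset.prems in auto)
        moreover have "U - {u} - {c} = U - {c} - {u}" by auto
        ultimately show "br u i * (br c z * ord_sum (insert z (U - {u} - {c})) i) =
          br c z * (br u i * ord_sum (insert z (U - {c} - {u})) i)"
          by (simp add: mult.assoc[symmetric])
      qed
      ultimately show ?thesis
        by (simp add: distrib_left right_diff_distrib mult.assoc)
    qed
    have first: "(\<Sum>u\<in>U. br u i * ord_sum (U - {u}) i * y) = ord_sum U i * y" for y
      using False fin by (simp add: ord_sum_first[of U i] sum_distrib_right)
    have swap: "(\<Sum>u\<in>U. \<Sum>c\<in>U - {u}. br c z * (br u i * ord_sum (insert z (U - {c} - {u})) i)) =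
      (\<Sum>c\<in>U. br c z * ord_sum (insert z (U - {c})) i - br c z * br z i * ord_sum (U - {c}) i)"
      unfolding sum_distinct_pairs_swap[OF fin, of "\<lambda>u c. br c z * (br u i * ord_sum (insert z (U - {c} - {u})) i)"]
    proof (rule sum.cong[OF refl])
      fix c assume "c \<in> U"
      have "ord_sum (insert z (U - {c})) i = br z i * ord_sum (U - {c}) i + (\<Sum>u\<in>U - {c}. br u i * ord_sum (insert z (U - {c} - {u})) i)"
        by (rule ord_sum_insert_first) (use fin psubset.prems in auto)
      then show "(\<Sum>u\<in>U - {c}. br c z * (br u i * ord_sum (insert z (U - {c} - {u})) i)) =
          br c z * ord_sum (insert z (U - {c})) i - br c z * br z i * ord_sum (U - {c}) i"
        by (simp add: sum_distrib_left distrib_left mult.assoc)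
    qed
    have "ord_sum (insert z U) i = br z i * ord_sum U i + (\<Sum>u\<in>U. br u i * ord_sum (insert z (U - {u})) i)"
      using fin psubset.prems(2) by (rule ord_sum_insert_first)
    also have "(\<Sum>u\<in>U. br u i * ord_sum (insert z (U - {u})) i) =
      (\<Sum>c\<in>U. br c z * ord_sum (insert z (U - {c})) i - br c z * br z i * ord_sum (U - {c}) i)
       - ord_sum U i * S + (\<Sum>u\<in>U. br u i * br u z * ord_sum (U - {u}) i) + ord_sum U i * br z i"
    proof -
      have "(\<Sum>u\<in>U. br u i * ord_sum (insert z (U - {u})) i) =
        (\<Sum>u\<in>U. (\<Sum>c\<in>U - {u}. br c z * (br u i * ord_sum (insert z (U - {c} - {u})) i)) - br u i * ord_sum (U - {u}) i * S
         + br u i * br u z * ord_sum (U - {u}) i + br u i * ord_sum (U - {u}) i * br z i)"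
        by (rule sum.cong[OF refl IH])
      then show ?thesis by (simp only: sum.distrib sum_subtractf swap first)
    qed
    also have "br z i * ord_sum U i = (\<Sum>u\<in>U. br z i * br u i * ord_sum (U - {u}) i)"
      using False fin by (simp add: ord_sum_first[of U i] sum_distrib_left mult.assoc)
    finally have "ord_sum (insert z U) i = (\<Sum>c\<in>U. br c z * ord_sum (insert z (U - {c})) i) - ord_sum U i * S + ord_sum U i * br z i
       + (\<Sum>u\<in>U. (br z i * br u i - br u z * br z i + br u i * br u z) * ord_sum (U - {u}) i)"
      by (simp add: sum.distrib sum_subtractf algebra_simps)
    \<comment> \<open>What the induction hypothesis leaves over are words whose first two brackets
      have indices among z, u, i; their coefficient is the exchange rule.\<close>
    also have "(\<Sum>u\<in>U. (br z i * br u i - br u z * br z i + br u i * br u z) * ord_sum (U - {u}) i) = 0"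
    proof (rule sum.neutral, rule ballI)
      fix u assume u: "u \<in> U"
      have "br z i * br u i = br u z * br z i - br u i * br u z"
        by (rule br_exchange) (use u psubset.prems in auto)
      then show "(br z i * br u i - br u z * br z i + br u i * br u z) * ord_sum (U - {u}) i = 0" by simp
    qed
    finally show ?thesis by (simp add: S_def)
  qed simp
qed

section \<open>Cyclic sums: words that begin and end with the same bracket\<close>

definition cyc :: "'i set \<Rightarrow> 'i \<Rightarrow> 'r" where
  "cyc C j = (\<Sum>i\<in>C. br i j * ord_sum (C - {i}) j * br i j)"

text \<open>\<open>ord_sum_shift\<close> is applied to the inner sum of each cyclic word. The
  boundary terms, in which z meets the outer brackets [ij], cancel after the exchange rule has been
  used at both ends.\<close>

lemma cyc_insert:
  assumes "finite C" "C \<noteq> {}" "z \<notin> C" "j \<notin> C" "z \<noteq> j"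
  shows "cyc (insert z C) j = (\<Sum>c\<in>C. br c z * cyc (insert z (C - {c})) j) - cyc C j * (\<Sum>c\<in>C. br c z)"
proof -
  define S where "S = (\<Sum>c\<in>C. br c z)"
  define E where "E = (\<lambda>i. ord_sum (C - {i}) j)"
  have ins: "insert z C - {i} = insert z (C - {i})" if "i \<in> C" for i
    using that assms by auto
  have ins': "insert z (C - {c}) - {i} = insert z (C - {c} - {i})" if "i \<in> C" for i c
    using that assms by auto
  have step: "br i j * ord_sum (insert z (C - {i})) j * br i j =
      (\<Sum>c\<in>C - {i}. br c z * (br i j * ord_sum (insert z (C - {c} - {i})) j * br i j)) - br i j * E i * br i j * S
       + br i j * E i * br i j * br i z + br i j * E i * br z j * br i j" if i: "i \<in> C" for i
  proof -
    have "ord_sum (insert z (C - {i})) j = (\<Sum>c\<in>C - {i}. br c z * ord_sum (insert z (C - {i} - {c})) j) -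
       E i * (\<Sum>c\<in>C - {i}. br c z) + E i * br z j"
      unfolding E_def by (rule ord_sum_shift) (use i assms in auto)
    \<comment> \<open>[iz] shares an index with [ij] and does not commute with it. Writing the sum
      over c \<noteq> i as S - [iz] makes the factor S independent of i, at the price of one
      boundary term.\<close>
    moreover have "(\<Sum>c\<in>C - {i}. br c z) * br i j = br i j * (S - br i z)"
    proof -
      have "(\<Sum>c\<in>C - {i}. br c z) * br i j = br i j * (\<Sum>c\<in>C - {i}. br c z)"
        by (rule sum_commute_right, rule br_commute) (use i assms in auto)
      then show ?thesis using i assms by (simp add: S_def sum_diff1)
    qed
    moreover have "br i j * (\<Sum>c\<in>C - {i}. br c z * ord_sum (insert z (C - {i} - {c})) j) =
        (\<Sum>c\<in>C - {i}. br c z * (br i j * ord_sum (insert z (C - {c} - {i})) j))"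
      unfolding sum_distrib_left
    proof (rule sum.cong[OF refl])
      fix c assume c: "c \<in> C - {i}"
      have "br i j * br c z = br c z * br i j"
        by (rule br_commute) (use i c assms in auto)
      moreover have "C - {i} - {c} = C - {c} - {i}" by auto
      ultimately show "br i j * (br c z * ord_sum (insert z (C - {i} - {c})) j) =
        br c z * (br i j * ord_sum (insert z (C - {c} - {i})) j)"
        by (simp add: mult.assoc[symmetric])
    qed
    ultimately show ?thesis
      by (simp add: distrib_left right_diff_distrib distrib_right left_diff_distrib sum_distrib_right mult.assoc)
  qed
  have swap: "(\<Sum>i\<in>C. \<Sum>c\<in>C - {i}. br c z * (br i j * ord_sum (insert z (C - {c} - {i})) j * br i j)) =
     (\<Sum>c\<in>C. br c z * cyc (insert z (C - {c})) j - br c z * br z j * E c * br z j)"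
    unfolding sum_distinct_pairs_swap[OF assms(1), of "\<lambda>i c. br c z * (br i j * ord_sum (insert z (C - {c} - {i})) j * br i j)"]
  proof (rule sum.cong[OF refl])
    fix c assume "c \<in> C"
    have "cyc (insert z (C - {c})) j = br z j * E c * br z j +
      (\<Sum>i\<in>C - {c}. br i j * ord_sum (insert z (C - {c} - {i})) j * br i j)"
      unfolding cyc_def E_def using assms by (simp add: ins')
    then show "(\<Sum>i\<in>C - {c}. br c z * (br i j * ord_sum (insert z (C - {c} - {i})) j * br i j)) =
       br c z * cyc (insert z (C - {c})) j - br c z * br z j * E c * br z j"
      by (simp add: distrib_left sum_distrib_left mult.assoc)
  qed
  have "cyc (insert z C) j = br z j * ord_sum C j * br z j + (\<Sum>i\<in>C. br i j * ord_sum (insert z (C - {i})) j * br i j)"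
    unfolding cyc_def using assms by (simp add: ins)
  also have "(\<Sum>i\<in>C. br i j * ord_sum (insert z (C - {i})) j * br i j) =
    (\<Sum>c\<in>C. br c z * cyc (insert z (C - {c})) j - br c z * br z j * E c * br z j) - cyc C j * S
     + (\<Sum>i\<in>C. br i j * E i * br i j * br i z) + (\<Sum>i\<in>C. br i j * E i * br z j * br i j)"
  proof -
    have "(\<Sum>i\<in>C. br i j * ord_sum (insert z (C - {i})) j * br i j) =
      (\<Sum>i\<in>C. (\<Sum>c\<in>C - {i}. br c z * (br i j * ord_sum (insert z (C - {c} - {i})) j * br i j)) - br i j * E i * br i j * S
       + br i j * E i * br i j * br i z + br i j * E i * br z j * br i j)"
      by (rule sum.cong[OF refl step])
    moreover have "(\<Sum>i\<in>C. br i j * E i * br i j * S) = cyc C j * S"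
      by (simp add: cyc_def E_def sum_distrib_right)
    ultimately show ?thesis by (simp only: sum.distrib sum_subtractf swap)
  qed
  also have "br z j * ord_sum C j * br z j = (\<Sum>i\<in>C. br z j * br i j * E i * br z j)"
    using assms(1,2) by (simp add: ord_sum_first[of C] E_def sum_distrib_left sum_distrib_right mult.assoc)
  finally have "cyc (insert z C) j = (\<Sum>c\<in>C. br c z * cyc (insert z (C - {c})) j) - cyc C j * S
    + (\<Sum>i\<in>C. br z j * br i j * E i * br z j - br i z * br z j * E i * br z j
       + br i j * E i * br i j * br i z + br i j * E i * br z j * br i j)"
    by (simp add: sum.distrib sum_subtractf)
  also have "(\<Sum>i\<in>C. br z j * br i j * E i * br z j - br i z * br z j * E i * br z j
       + br i j * E i * br i j * br i z + br i j * E i * br z j * br i j) = 0"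
  proof (rule sum.neutral, rule ballI)
    fix i assume i: "i \<in> C"
    have ex: "br z j * br i j = br i z * br z j - br i j * br i z"
      by (rule br_exchange) (use i assms in auto)
    have "E i * br i z = br i z * E i"
      unfolding E_def by (rule ord_sum_br_commute) (use i assms in auto)
    then have "br z j * br i j * E i * br z j - br i z * br z j * E i * br z j = - (br i j * E i * br i z * br z j)"
      by (simp add: ex left_diff_distrib mult.assoc)
    moreover have "br i j * E i * br z j * br i j = br i j * E i * br i z * br z j - br i j * E i * br i j * br i z"
      by (simp add: ex right_diff_distrib mult.assoc)
    ultimately show "br z j * br i j * E i * br z j - br i z * br z j * E i * br z j
       + br i j * E i * br i j * br i z + br i j * E i * br z j * br i j = 0"
      by simp
  qed
  finally show ?thesis by (simp add: S_def)
qed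

text \<open>The sums \<open>R C\<close> of the values satisfy the recursion of
  \<open>cyc_insert\<close>. The square [ij]^2 starts the induction and brings in w i j, which
  cancels as soon as C has two elements and does not return for larger C.\<close>

lemma cyc_eq:
  assumes "finite C" "C \<noteq> {}" "j \<notin> C"
  shows "cyc C j = (\<Sum>i\<in>C. p i j * ord_sum (C - {i}) i) - (if card C = 1 then \<Sum>i\<in>C. w i j else 0)"
  using assms
proof (induction rule: finite_psubset_induct)
  case (psubset C)
  define R where "R = (\<lambda>C. \<Sum>i\<in>C. p i j * ord_sum (C - {i}) i)"
  from psubset.prems obtain z U where C: "C = insert z U" "z \<notin> U"
    by (metis all_not_in_conv mk_disjoint_insert)
  have fin: "finite U" and j: "j \<notin> U" "z \<noteq> j" using psubset C by auto
  show ?case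
  proof (cases "U = {}")
    case True
    then show ?thesis using C j by (simp add: cyc_def br_square)
  next
    case False
    have cardC: "card C \<noteq> 1"
      using C fin False by (simp add: card_eq_0_iff)
    have rec: "cyc C j = (\<Sum>c\<in>U. br c z * cyc (insert z (U - {c})) j) - cyc U j * (\<Sum>c\<in>U. br c z)"
      unfolding C(1) using fin False C(2) j by (rule cyc_insert)
    have "R C = p z j * ord_sum U z + (\<Sum>i\<in>U. p i j * ord_sum (insert z (U - {i})) i)"
    proof -
      have "insert z U - {i} = insert z (U - {i})" if "i \<in> U" for i using that C by auto
      then show ?thesis unfolding R_def C(1) using fin C(2) by simp
    qed
    also have "(\<Sum>i\<in>U. p i j * ord_sum (insert z (U - {i})) i) =
       (\<Sum>i\<in>U. (\<Sum>c\<in>U - {i}. br c z * (p i j * ord_sum (insert z (U - {c} - {i})) i))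
          - p i j * ord_sum (U - {i}) i * (\<Sum>c\<in>U. br c z))"
    proof (rule sum.cong[OF refl])
      fix i assume i: "i \<in> U"
      have "ord_sum (insert z (U - {i})) i = (\<Sum>c\<in>U - {i}. br c z * ord_sum (insert z (U - {i} - {c})) i) -
         ord_sum (U - {i}) i * (\<Sum>c\<in>U - {i}. br c z) + ord_sum (U - {i}) i * br z i"
        by (rule ord_sum_shift) (use i fin C in auto)
      \<comment> \<open>With this sign the last term of the shift becomes the missing summand c = i
        of the subtracted sum, so that the sum runs over all of U.\<close>
      moreover have "br z i = - br i z" by (rule br_anti) (use i C in auto)
      moreover have "(\<Sum>c\<in>U. br c z) = br i z + (\<Sum>c\<in>U - {i}. br c z)"
        using i fin by (simp add: sum.remove)
      moreover have "p i j * (\<Sum>c\<in>U - {i}. br c z * ord_sum (insert z (U - {i} - {c})) i) =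
         (\<Sum>c\<in>U - {i}. br c z * (p i j * ord_sum (insert z (U - {c} - {i})) i))"
        unfolding sum_distrib_left
      proof (rule sum.cong[OF refl])
        fix c assume "c \<in> U - {i}"
        then have "p i j * br c z = br c z * p i j" by (intro p_br) (use C in auto)
        moreover have "U - {i} - {c} = U - {c} - {i}" by auto
        ultimately show "p i j * (br c z * ord_sum (insert z (U - {i} - {c})) i) =
           br c z * (p i j * ord_sum (insert z (U - {c} - {i})) i)"
          by (simp add: mult.assoc[symmetric])
      qed
      ultimately show "p i j * ord_sum (insert z (U - {i})) i =
        (\<Sum>c\<in>U - {i}. br c z * (p i j * ord_sum (insert z (U - {c} - {i})) i)) - p i j * ord_sum (U - {i}) i * (\<Sum>c\<in>U. br c z)"
        by (simp add: distrib_left right_diff_distrib mult.assoc)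
    qed
    also have "\<dots> = (\<Sum>c\<in>U. \<Sum>i\<in>U - {c}. br c z * (p i j * ord_sum (insert z (U - {c} - {i})) i)) - R U * (\<Sum>c\<in>U. br c z)"
      unfolding sum_subtractf R_def sum_distrib_right[symmetric]
      by (subst sum_distinct_pairs_swap[OF fin]) simp
    also have "(\<Sum>c\<in>U. \<Sum>i\<in>U - {c}. br c z * (p i j * ord_sum (insert z (U - {c} - {i})) i)) =
       (\<Sum>c\<in>U. br c z * R (insert z (U - {c})) - br c z * (p z j * ord_sum (U - {c}) z))"
    proof (rule sum.cong[OF refl])
      fix c assume "c \<in> U"
      have "insert z (U - {c}) - {i} = insert z (U - {c} - {i})" if "i \<in> U" for i using that C by auto
      then have "R (insert z (U - {c})) = p z j * ord_sum (U - {c}) z + (\<Sum>i\<in>U - {c}. p i j * ord_sum (insert z (U - {c} - {i})) i)"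
        unfolding R_def using fin C(2) by simp
      then show "(\<Sum>i\<in>U - {c}. br c z * (p i j * ord_sum (insert z (U - {c} - {i})) i)) =
         br c z * R (insert z (U - {c})) - br c z * (p z j * ord_sum (U - {c}) z)"
        by (simp add: sum_distrib_left distrib_left)
    qed
    \<comment> \<open>The terms i = z, which the double sum does not contain, add up to p z j * e(U,
      z) by the expansion along the first factor. They cancel the summand split off from
      \<open>R C\<close> at the start.\<close>
    also have "(\<Sum>c\<in>U. br c z * R (insert z (U - {c})) - br c z * (p z j * ord_sum (U - {c}) z)) =
       (\<Sum>c\<in>U. br c z * R (insert z (U - {c}))) - p z j * ord_sum U z"
    proof -
      have "br c z * (p z j * ord_sum (U - {c}) z) = p z j * (br c z * ord_sum (U - {c}) z)" if "c \<in> U" for c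
        using p_br[of c z z j] that C by (cases "c = z") (auto simp: mult.assoc[symmetric])
      then have "(\<Sum>c\<in>U. br c z * (p z j * ord_sum (U - {c}) z)) = p z j * ord_sum U z"
        using fin False by (simp add: ord_sum_first[of U z] sum_distrib_left)
      then show ?thesis by (simp add: sum_subtractf)
    qed
    finally have Rrec: "R C = (\<Sum>c\<in>U. br c z * R (insert z (U - {c}))) - R U * (\<Sum>c\<in>U. br c z)"
      by simp
    have IH: "cyc D j = R D - (if card D = 1 then \<Sum>i\<in>D. w i j else 0)" if "D \<subset> C" "D \<noteq> {}" for D
      unfolding R_def using that psubset.prems by (intro psubset.IH) auto
    show ?thesis
    proof (cases "card U = 1")
      case True
      then obtain c where U: "U = {c}" using card_1_singletonE by blast
      have "cyc {z} j = R {z} - w z j" "cyc {c} j = R {c} - w c j"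
        using IH[of "{z}"] IH[of "{c}"] C U by auto
      \<comment> \<open>Since [cz] exchanges x_c and x_z, the corrections of the two singletons {z}
        and {c} cancel in the recursion for C = {c, z}.\<close>
      moreover have "br c z * w z j = w c j * br c z"
        using br_w[of c j z] C U j by (auto simp: w_sym[of z j] w_sym[of j c])
      ultimately have "cyc C j = R C"
        using rec Rrec U by (simp add: right_diff_distrib left_diff_distrib)
      then show ?thesis using cardC by (simp add: R_def)
    next
      case cU: False
      have "cyc (insert z (U - {c})) j = R (insert z (U - {c}))" if c: "c \<in> U" for c
      proof -
        have "U - {c} \<noteq> {}" 
        proof
          assume "U - {c} = {}"
          then have "U = {c}" using c by auto
          then show False using cU by simp
        qed
        then have "card (insert z (U - {c})) \<noteq> 1" using fin C by (simp add: card_eq_0_iff)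
        moreover have "insert z (U - {c}) \<subset> C" using c C by auto
        ultimately show ?thesis using IH[of "insert z (U - {c})"] by simp
      qed
      moreover have "cyc U j = R U"
        using IH[of U] cU False C by auto
      ultimately have "cyc C j = R C" using rec Rrec by simp
      then show ?thesis using cardC by (simp add: R_def)
    qed
  qed
qed

text \<open>A word of e(A,j) contains [ij] exactly once. With [ij] appended, the part from that
  occurrence on is a cyclic word; C is its set of first indices, and the part before it is a word of
  e(A - C, j).\<close>

lemma ord_sum_br_sum:
  assumes "finite A" "j \<notin> A"
  shows "(\<Sum>i\<in>A. ord_sum A j * br i j) = (\<Sum>C\<in>Pow A. ord_sum (A - C) j * cyc C j)"
  using assms
proof (induction rule: finite_psubset_induct)
  case (psubset A)
  have fin: "finite A" by (rule psubset.hyps)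
  show ?case
  proof (cases "A = {}")
    case True
    then show ?thesis by (simp add: cyc_def)
  next
    case False
    have "(\<Sum>i\<in>A. ord_sum A j * br i j) = (\<Sum>i\<in>A. \<Sum>u\<in>A. br u j * ord_sum (A - {u}) j * br i j)"
      using False fin by (simp add: ord_sum_first[of A] sum_distrib_right)
    also have "\<dots> = (\<Sum>u\<in>A. \<Sum>i\<in>A. br u j * ord_sum (A - {u}) j * br i j)"
      by (rule sum.swap)
    also have "\<dots> = (\<Sum>u\<in>A. br u j * ord_sum (A - {u}) j * br u j + (\<Sum>i\<in>A - {u}. br u j * ord_sum (A - {u}) j * br i j))"
      by (intro sum.cong refl sum.remove fin)
    also have "\<dots> = (\<Sum>u\<in>A. \<Sum>i\<in>A - {u}. br u j * ord_sum (A - {u}) j * br i j) + cyc A j"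
      by (simp add: sum.distrib cyc_def)
    also have "(\<Sum>u\<in>A. \<Sum>i\<in>A - {u}. br u j * ord_sum (A - {u}) j * br i j) =
        (\<Sum>u\<in>A. \<Sum>C\<in>Pow (A - {u}). br u j * ord_sum (A - {u} - C) j * cyc C j)"
    proof (rule sum.cong[OF refl])
      fix u assume u: "u \<in> A"
      have "(\<Sum>i\<in>A - {u}. ord_sum (A - {u}) j * br i j) = (\<Sum>C\<in>Pow (A - {u}). ord_sum (A - {u} - C) j * cyc C j)"
        by (rule psubset.IH) (use u psubset.prems in auto)
      then show "(\<Sum>i\<in>A - {u}. br u j * ord_sum (A - {u}) j * br i j) =
          (\<Sum>C\<in>Pow (A - {u}). br u j * ord_sum (A - {u} - C) j * cyc C j)"
        by (simp add: mult.assoc flip: sum_distrib_left)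
    qed
    also have "\<dots> = (\<Sum>C\<in>Pow A. \<Sum>u\<in>A - C. br u j * ord_sum (A - {u} - C) j * cyc C j)"
      by (rule sum_Pow_outside[OF fin, symmetric])
    also have "\<dots> = (\<Sum>C\<in>Pow A. ord_sum (A - C) j * cyc C j - (if C = A then cyc A j else 0))"
    proof (rule sum.cong[OF refl])
      fix C assume C: "C \<in> Pow A"
      have *: "A - {u} - C = A - C - {u}" for u by auto
      show "(\<Sum>u\<in>A - C. br u j * ord_sum (A - {u} - C) j * cyc C j) =
         ord_sum (A - C) j * cyc C j - (if C = A then cyc A j else 0)"
      proof (cases "C = A")
        case False
        then have "A - C \<noteq> {}" using C by auto
        then show ?thesis
          using False fin by (simp add: ord_sum_first[of "A - C"] sum_distrib_right *)
      qed simp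
    qed
    also have "\<dots> = (\<Sum>C\<in>Pow A. ord_sum (A - C) j * cyc C j) - cyc A j"
      using fin by (simp add: sum_subtractf)
    finally show ?thesis by simp
  qed
qed

section \<open>Words with sorted second indices\<close>

definition bseqs :: "'i set \<Rightarrow> 'i set \<Rightarrow> ('i \<times> 'i) list set" where
  "bseqs T B = {ps. distinct (map fst ps) \<and> sorted (map snd ps) \<and> fst ` set ps = T \<and> snd ` set ps \<subseteq> B}"

text \<open>The innermost sum of the theorem, restricted to the words whose set of first indices is
  exactly T. Their length is then card T, and T and B can vary independently.\<close>

definition seq_sum :: "'i set \<Rightarrow> 'i set \<Rightarrow> 'r" where
  "seq_sum T B = (\<Sum>ps\<in>bseqs T B. prod_list (map (\<lambda>(a, b). br a b) ps))"

lemma finite_bseqs: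
  assumes "finite T" "finite B"
  shows "finite (bseqs T B)"
proof (rule finite_subset)
  show "bseqs T B \<subseteq> {ps. set ps \<subseteq> T \<times> B \<and> length ps = card T}"
  proof
    fix ps assume ps: "ps \<in> bseqs T B"
    then have "length ps = card (set (map fst ps))"
      unfolding bseqs_def using distinct_card by fastforce
    then show "ps \<in> {ps. set ps \<subseteq> T \<times> B \<and> length ps = card T}"
      using ps by (force simp: bseqs_def)
  qed
qed (use assms in \<open>auto intro: finite_lists_length_eq\<close>)

lemma seq_sum_empty_left [simp]: "seq_sum {} B = 1"
proof -
  have "bseqs {} B = {[]}" by (auto simp: bseqs_def)
  then show ?thesis by (simp add: seq_sum_def)
qed

lemma seq_sum_empty_right: "seq_sum T {} = (if T = {} then 1 else 0)"
proof (cases "T = {}")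
  case False
  then have "bseqs T {} = {}" by (auto simp: bseqs_def)
  then show ?thesis using False by (simp add: seq_sum_def)
qed simp

lemma seq_sum_commute:
  assumes "\<And>a b. a \<in> T \<Longrightarrow> b \<in> B \<Longrightarrow> br a b * y = y * br a b"
  shows "seq_sum T B * y = y * seq_sum T B"
  unfolding seq_sum_def
  by (intro sum_commute_right prod_list_commute_right) (force simp: bseqs_def intro!: assms)

text \<open>As b lies below all of B, sortedness forces the pairs with second index b to the front.
  A nonempty sequence therefore starts with such a pair or contains none.\<close>

lemma bseqs_insert_min:
  assumes "T \<noteq> {}" "\<And>x. x \<in> B \<Longrightarrow> b < x"
  shows "bseqs T (insert b B) = (\<Union>a\<in>T. (#) (a, b) ` bseqs (T - {a}) (insert b B)) \<union> bseqs T B"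
proof (intro equalityI subsetI)
  fix ps assume ps: "ps \<in> bseqs T (insert b B)"
  with assms(1) obtain a c qs where ps_eq: "ps = (a, c) # qs"
    by (cases ps) (auto simp: bseqs_def)
  show "ps \<in> (\<Union>a\<in>T. (#) (a, b) ` bseqs (T - {a}) (insert b B)) \<union> bseqs T B"
  proof (cases "c = b")
    case True
    then have "qs \<in> bseqs (T - {a}) (insert b B)" "a \<in> T"
      using ps unfolding ps_eq bseqs_def by (auto simp: image_iff)
    then show ?thesis using ps_eq True by blast
  next
    case False
    then have "c \<in> B" using ps by (auto simp: ps_eq bseqs_def)
    then have "b < c" by (rule assms(2))
    then have "snd q \<noteq> b" if "q \<in> set ps" for q
      using ps that unfolding ps_eq bseqs_def by auto
    then have "ps \<in> bseqs T B" using ps by (auto simp: bseqs_def)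
    then show ?thesis by simp
  qed
next
  fix ps assume "ps \<in> (\<Union>a\<in>T. (#) (a, b) ` bseqs (T - {a}) (insert b B)) \<union> bseqs T B"
  then show "ps \<in> bseqs T (insert b B)"
  proof
    assume "ps \<in> (\<Union>a\<in>T. (#) (a, b) ` bseqs (T - {a}) (insert b B))"
    then obtain a qs where qs: "a \<in> T" "ps = (a, b) # qs" "qs \<in> bseqs (T - {a}) (insert b B)"
      by auto
    have "b \<le> x" if "x \<in> snd ` set qs" for x
    proof -
      have "x \<in> insert b B" using that qs(3) by (auto simp: bseqs_def)
      then show ?thesis using assms(2)[of x] by auto
    qed
    moreover have "a \<notin> fst ` set qs" "insert a (fst ` set qs) = T"
      using qs by (auto simp: bseqs_def)
    ultimately show ?thesis using qs by (auto simp: bseqs_def)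
  qed (auto simp: bseqs_def)
qed

lemma seq_sum_insert_min_first:
  assumes "finite T" "finite B" "T \<noteq> {}" "\<And>x. x \<in> B \<Longrightarrow> b < x"
  shows "seq_sum T (insert b B) = (\<Sum>a\<in>T. br a b * seq_sum (T - {a}) (insert b B)) + seq_sum T B"
proof -
  let ?f = "\<lambda>ps. prod_list (map (\<lambda>(a, b). br a b) ps)"
  have fin: "finite ((#) (a, b) ` bseqs (T - {a}) (insert b B))" for a
    using assms by (intro finite_imageI finite_bseqs) auto
  have "(\<Union>a\<in>T. (#) (a, b) ` bseqs (T - {a}) (insert b B)) \<inter> bseqs T B = {}"
    using assms(4) by (fastforce simp: bseqs_def)
  then have disj: "sum ?f ((\<Union>a\<in>T. (#) (a, b) ` bseqs (T - {a}) (insert b B)) \<union> bseqs T B) =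
      sum ?f (\<Union>a\<in>T. (#) (a, b) ` bseqs (T - {a}) (insert b B)) + sum ?f (bseqs T B)"
    using assms(1,2) fin by (intro sum.union_disjoint) (auto intro: finite_bseqs)
  have "bseqs T (insert b B) = (\<Union>a\<in>T. (#) (a, b) ` bseqs (T - {a}) (insert b B)) \<union> bseqs T B"
    by (rule bseqs_insert_min) (use assms in auto)
  with disj have "seq_sum T (insert b B) = sum ?f (\<Union>a\<in>T. (#) (a, b) ` bseqs (T - {a}) (insert b B)) + seq_sum T B"
    by (simp only: seq_sum_def)
  also have "sum ?f (\<Union>a\<in>T. (#) (a, b) ` bseqs (T - {a}) (insert b B)) =
      (\<Sum>a\<in>T. sum ?f ((#) (a, b) ` bseqs (T - {a}) (insert b B)))"
    by (rule sum.UNION_disjoint) (use assms fin in auto)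
  also have "\<dots> = (\<Sum>a\<in>T. br a b * seq_sum (T - {a}) (insert b B))"
    by (simp add: sum.reindex seq_sum_def sum_distrib_left)
  finally show ?thesis .
qed

text \<open>The initial pairs with second index b may come in any order, so for a given set A of
  their first indices they sum to e(A,b).\<close>

lemma seq_sum_insert_min:
  assumes "finite T" "finite B" "\<And>x. x \<in> B \<Longrightarrow> b < x"
  shows "seq_sum T (insert b B) = (\<Sum>A\<in>Pow T. ord_sum A b * seq_sum (T - A) B)"
  using assms(1)
proof (induction rule: finite_psubset_induct)
  case (psubset T)
  have fin: "finite T" by (rule psubset.hyps)
  show ?case
  proof (cases "T = {}")
    case False
    have "seq_sum T (insert b B) = seq_sum T B + (\<Sum>a\<in>T. br a b * seq_sum (T - {a}) (insert b B))"
      using seq_sum_insert_min_first[OF fin assms(2) False assms(3)] by simp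
    also have "(\<Sum>a\<in>T. br a b * seq_sum (T - {a}) (insert b B)) =
        (\<Sum>a\<in>T. \<Sum>A\<in>Pow (T - {a}). br a b * ord_sum A b * seq_sum (T - insert a A) B)"
    proof (rule sum.cong[OF refl])
      fix a assume "a \<in> T"
      then have "seq_sum (T - {a}) (insert b B) = (\<Sum>A\<in>Pow (T - {a}). ord_sum A b * seq_sum (T - {a} - A) B)"
        by (intro psubset.IH) auto
      moreover have "T - {a} - A = T - insert a A" for A by auto
      ultimately show "br a b * seq_sum (T - {a}) (insert b B) =
          (\<Sum>A\<in>Pow (T - {a}). br a b * ord_sum A b * seq_sum (T - insert a A) B)"
        by (simp add: sum_distrib_left mult.assoc)
    qed
    also have "seq_sum T B + \<dots> = (\<Sum>A\<in>Pow T. ord_sum A b * seq_sum (T - A) B)"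
    proof (subst sum_Pow_rec[where F = "\<lambda>A. ord_sum A b * seq_sum (T - A) B" and
          f = "\<lambda>a A. br a b * ord_sum A b * seq_sum (T - insert a A) B", OF fin])
      fix A assume A: "A \<subseteq> T" "A \<noteq> {}"
      then have "finite A" using fin finite_subset by auto
      then show "ord_sum A b * seq_sum (T - A) B = (\<Sum>u\<in>A. br u b * ord_sum (A - {u}) b * seq_sum (T - insert u (A - {u})) B)"
        using A by (simp add: ord_sum_first[of A] sum_distrib_right insert_absorb)
    qed simp
    finally show ?thesis .
  qed simp
qed

text \<open>Factors with disjoint indices commute, so the order of the second indices is immaterial.\<close>
lemma seq_sum_insert:
  assumes "finite B" "finite T" "j \<notin> B" "j \<notin> T" "T \<inter> B = {}"
  shows "seq_sum T (insert j B) = (\<Sum>A\<in>Pow T. seq_sum (T - A) B * ord_sum A j)"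
  using assms
proof (induction arbitrary: T rule: finite_linorder_min_induct)
  case empty
  then show ?case
    by (subst seq_sum_insert_min) (auto intro!: sum.cong simp: seq_sum_empty_right)
next
  case (insert b B)
  have finT: "finite T" by (rule insert.prems)
  show ?case
  proof (cases "j < b")
    case True
    then have "seq_sum T (insert j (insert b B)) = (\<Sum>A\<in>Pow T. ord_sum A j * seq_sum (T - A) (insert b B))"
      using insert by (intro seq_sum_insert_min) (auto intro: less_trans)
    also have "\<dots> = (\<Sum>A\<in>Pow T. seq_sum (T - A) (insert b B) * ord_sum A j)"
    proof (rule sum.cong[OF refl])
      fix A assume A: "A \<in> Pow T"
      show "ord_sum A j * seq_sum (T - A) (insert b B) = seq_sum (T - A) (insert b B) * ord_sum A j"
        by (rule seq_sum_commute[symmetric], rule ord_sum_br_commute[symmetric]) (use A insert in auto)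
    qed
    finally show ?thesis .
  next
    case False
    then have "b < j" using insert.prems by auto
    \<comment> \<open>Now b is the minimum: its block is split off on the left, that of j on the
      right by the induction hypothesis, and the two choices of first indices are
      interchanged.\<close>
    then have "seq_sum T (insert b (insert j B)) = (\<Sum>A\<in>Pow T. ord_sum A b * seq_sum (T - A) (insert j B))"
      using insert by (intro seq_sum_insert_min) auto
    also have "\<dots> = (\<Sum>A\<in>Pow T. \<Sum>C\<in>Pow (T - A). ord_sum A b * seq_sum (T - A - C) B * ord_sum C j)"
    proof (rule sum.cong[OF refl])
      fix A assume "A \<in> Pow T"
      have "seq_sum (T - A) (insert j B) = (\<Sum>C\<in>Pow (T - A). seq_sum (T - A - C) B * ord_sum C j)"
        by (rule insert.IH) (use insert.prems in auto)
      then show "ord_sum A b * seq_sum (T - A) (insert j B) = (\<Sum>C\<in>Pow (T - A). ord_sum A b * seq_sum (T - A - C) B * ord_sum C j)"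
        by (simp add: sum_distrib_left mult.assoc)
    qed
    also have "\<dots> = (\<Sum>C\<in>Pow T. \<Sum>A\<in>Pow (T - C). ord_sum A b * seq_sum (T - A - C) B * ord_sum C j)"
      by (rule sum_disjoint_pairs_swap[OF finT])
    also have "\<dots> = (\<Sum>C\<in>Pow T. seq_sum (T - C) (insert b B) * ord_sum C j)"
    proof (rule sum.cong[OF refl])
      fix C assume "C \<in> Pow T"
      have "seq_sum (T - C) (insert b B) = (\<Sum>A\<in>Pow (T - C). ord_sum A b * seq_sum (T - C - A) B)"
        by (rule seq_sum_insert_min) (use insert in auto)
      moreover have "T - C - A = T - A - C" for A by auto
      ultimately show "(\<Sum>A\<in>Pow (T - C). ord_sum A b * seq_sum (T - A - C) B * ord_sum C j) = seq_sum (T - C) (insert b B) * ord_sum C j"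
        by (simp add: sum_distrib_right)
    qed
    finally show ?thesis by (simp add: insert_commute)
  qed
qed

text \<open>The bracketed factor, a part of theta_j, turns j from a second into a first index. In
  the induction on J the words on the right are divided by whether the second index of j is the new
  c or lies in J; the former case is \<open>ord_sum_insert_two\<close>.\<close>

lemma seq_sum_insert_left:
  assumes "finite J" "finite T" "j \<notin> J" "j \<notin> T" "T \<inter> J = {}"
  shows "(\<Sum>A\<in>Pow T. seq_sum (T - A) J * ord_sum A j * ((\<Sum>b\<in>J. br j b) - (\<Sum>i\<in>T - A. br i j))) = seq_sum (insert j T) J"
  using assms
proof (induction arbitrary: T rule: finite_induct)
  case empty
  \<comment> \<open>Without second indices only A = T contributes, and then both sums in the bracket
    are empty.\<close>
  have "seq_sum (T - A) {} * ord_sum A j * ((\<Sum>b\<in>{}. br j b) - (\<Sum>i\<in>T - A. br i j)) = 0" for A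
  proof (cases "T - A = {}")
    case True
    then show ?thesis by (simp only: sum.empty) simp
  qed (simp add: seq_sum_empty_right)
  then show ?case by (simp only: sum.neutral_const) (simp add: seq_sum_empty_right)
next
  case (insert c J)
  have fin: "finite T" by (rule insert.prems)
  \<comment> \<open>With B the set of first indices paired with c, the bracket is
    \<open>D1 (A \<union> B) + D2 B\<close>. \<open>D2\<close> gives j the second index c,
    \<open>D1\<close> one in J.\<close>
  define D1 where "D1 = (\<lambda>C. (\<Sum>b\<in>J. br j b) - (\<Sum>i\<in>T - C. br i j))"
  define D2 where "D2 = (\<lambda>B. br j c - (\<Sum>i\<in>B. br i j))"
  have split: "seq_sum (T - A) (insert c J) * ord_sum A j * ((\<Sum>b\<in>insert c J. br j b) - (\<Sum>i\<in>T - A. br i j)) =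
     (\<Sum>B\<in>Pow (T - A). seq_sum (T - (A \<union> B)) J * ord_sum A j * D1 (A \<union> B) * ord_sum B c)
     + (\<Sum>B\<in>Pow (T - A). seq_sum (T - (A \<union> B)) J * ord_sum B c * ord_sum A j * D2 B)" if A: "A \<in> Pow T" for A
  proof -
    have ins: "seq_sum (T - A) (insert c J) = (\<Sum>B\<in>Pow (T - A). seq_sum (T - A - B) J * ord_sum B c)"
      by (rule seq_sum_insert) (use A insert in auto)
    have "seq_sum (T - A) (insert c J) * ord_sum A j * ((\<Sum>b\<in>insert c J. br j b) - (\<Sum>i\<in>T - A. br i j)) =
       (\<Sum>B\<in>Pow (T - A). seq_sum (T - (A \<union> B)) J * ord_sum A j * D1 (A \<union> B) * ord_sum B c + seq_sum (T - (A \<union> B)) J * ord_sum B c * ord_sum A j * D2 B)"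
      unfolding ins sum_distrib_right
    proof (rule sum.cong[OF refl])
      fix B assume B: "B \<in> Pow (T - A)"
      have "(\<Sum>i\<in>T - A. br i j) = (\<Sum>i\<in>T - (A \<union> B). br i j) + (\<Sum>i\<in>B. br i j)"
        using sum.subset_diff[of B "T - A" "\<lambda>i. br i j"] B fin by (simp add: Diff_Diff_Int set_diff_eq conj_assoc)
      then have D: "(\<Sum>b\<in>insert c J. br j b) - (\<Sum>i\<in>T - A. br i j) = D1 (A \<union> B) + D2 B"
        using insert.hyps by (simp add: D1_def D2_def)
      have eD: "ord_sum B c * (ord_sum A j * D1 (A \<union> B)) = (ord_sum A j * D1 (A \<union> B)) * ord_sum B c"
      proof -
        have "ord_sum B c * ord_sum A j = ord_sum A j * ord_sum B c"
          by (rule ord_sum_ord_sum_commute) (use A B insert in auto)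
        moreover have "(\<Sum>b\<in>J. br j b) * ord_sum B c = ord_sum B c * (\<Sum>b\<in>J. br j b)"
          by (rule sum_commute_right, rule ord_sum_br_commute[symmetric]) (use A B insert in auto)
        moreover have "(\<Sum>i\<in>T - (A \<union> B). br i j) * ord_sum B c = ord_sum B c * (\<Sum>i\<in>T - (A \<union> B). br i j)"
          by (rule sum_commute_right, rule ord_sum_br_commute[symmetric]) (use A B insert in auto)
        ultimately show ?thesis
          by (simp add: D1_def left_diff_distrib right_diff_distrib mult.assoc[symmetric])
            (simp add: mult.assoc)
      qed
      have "T - A - B = T - (A \<union> B)" by auto
      then show "seq_sum (T - A - B) J * ord_sum B c * ord_sum A j * ((\<Sum>b\<in>insert c J. br j b) - (\<Sum>i\<in>T - A. br i j)) =
         seq_sum (T - (A \<union> B)) J * ord_sum A j * D1 (A \<union> B) * ord_sum B c + seq_sum (T - (A \<union> B)) J * ord_sum B c * ord_sum A j * D2 B"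
        using eD by (simp only: D distrib_left mult.assoc)
    qed
    then show ?thesis by (simp only: sum.distrib)
  qed
  have "(\<Sum>A\<in>Pow T. \<Sum>B\<in>Pow (T - A). seq_sum (T - (A \<union> B)) J * ord_sum A j * D1 (A \<union> B) * ord_sum B c) =
    (\<Sum>B\<in>Pow T. \<Sum>A\<in>Pow (T - B). seq_sum (T - (A \<union> B)) J * ord_sum A j * D1 (A \<union> B) * ord_sum B c)"
    by (rule sum_disjoint_pairs_swap[OF fin])
  also have "\<dots> = (\<Sum>B\<in>Pow T. seq_sum (insert j T - B) J * ord_sum B c)"
  proof (rule sum.cong[OF refl])
    fix B assume B: "B \<in> Pow T"
    have "(\<Sum>A\<in>Pow (T - B). seq_sum (T - B - A) J * ord_sum A j * ((\<Sum>b\<in>J. br j b) - (\<Sum>i\<in>T - B - A. br i j))) = seq_sum (insert j (T - B)) J"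
      by (rule insert.IH) (use insert in auto)
    moreover have "insert j (T - B) = insert j T - B" using B insert.prems by auto
    moreover have "T - B - A = T - (A \<union> B)" for A by auto
    ultimately show "(\<Sum>A\<in>Pow (T - B). seq_sum (T - (A \<union> B)) J * ord_sum A j * D1 (A \<union> B) * ord_sum B c) = seq_sum (insert j T - B) J * ord_sum B c"
      by (simp add: D1_def flip: sum_distrib_right)
  qed
  finally have first: "(\<Sum>A\<in>Pow T. \<Sum>B\<in>Pow (T - A). seq_sum (T - (A \<union> B)) J * ord_sum A j * D1 (A \<union> B) * ord_sum B c) =
    (\<Sum>B\<in>Pow T. seq_sum (insert j T - B) J * ord_sum B c)" .
  have "(\<Sum>A\<in>Pow T. \<Sum>B\<in>Pow (T - A). seq_sum (T - (A \<union> B)) J * ord_sum B c * ord_sum A j * D2 B) =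
     (\<Sum>C\<in>Pow T. \<Sum>A\<in>Pow C. seq_sum (T - (A \<union> (C - A))) J * ord_sum (C - A) c * ord_sum A j * D2 (C - A))"
    by (rule sum_disjoint_pairs_Un[OF fin])
  also have "\<dots> = (\<Sum>C\<in>Pow T. seq_sum (insert j T - insert j C) J * ord_sum (insert j C) c)"
  proof (rule sum.cong[OF refl])
    fix C assume C: "C \<in> Pow T"
    have "(\<Sum>A\<in>Pow C. seq_sum (T - (A \<union> (C - A))) J * ord_sum (C - A) c * ord_sum A j * D2 (C - A)) =
       seq_sum (T - C) J * (\<Sum>A\<in>Pow C. ord_sum (C - A) c * ord_sum A j * D2 (C - A))"
      unfolding sum_distrib_left
    proof (rule sum.cong[OF refl])
      fix A assume "A \<in> Pow C"
      then have "A \<union> (C - A) = C" by auto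
      then show "seq_sum (T - (A \<union> (C - A))) J * ord_sum (C - A) c * ord_sum A j * D2 (C - A) = seq_sum (T - C) J * (ord_sum (C - A) c * ord_sum A j * D2 (C - A))"
        by (simp add: mult.assoc)
    qed
    also have "(\<Sum>A\<in>Pow C. ord_sum (C - A) c * ord_sum A j * D2 (C - A)) = ord_sum (insert j C) c"
      unfolding D2_def by (rule ord_sum_insert_two[symmetric]) (use C insert fin in \<open>auto intro: finite_subset\<close>)
    also have "T - C = insert j T - insert j C" using insert.prems C by auto
    finally show "(\<Sum>A\<in>Pow C. seq_sum (T - (A \<union> (C - A))) J * ord_sum (C - A) c * ord_sum A j * D2 (C - A)) =
      seq_sum (insert j T - insert j C) J * ord_sum (insert j C) c" .
  qed
  finally have second: "(\<Sum>A\<in>Pow T. \<Sum>B\<in>Pow (T - A). seq_sum (T - (A \<union> B)) J * ord_sum B c * ord_sum A j * D2 B) =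
    (\<Sum>C\<in>Pow T. seq_sum (insert j T - insert j C) J * ord_sum (insert j C) c)" .
  have "seq_sum (insert j T) (insert c J) = (\<Sum>A\<in>Pow (insert j T). seq_sum (insert j T - A) J * ord_sum A c)"
    by (rule seq_sum_insert) (use insert in auto)
  also have "\<dots> = (\<Sum>B\<in>Pow T. seq_sum (insert j T - B) J * ord_sum B c) + (\<Sum>C\<in>Pow T. seq_sum (insert j T - insert j C) J * ord_sum (insert j C) c)"
    by (rule sum_Pow_insert) (use insert in auto)
  also have "\<dots> = (\<Sum>A\<in>Pow T. seq_sum (T - A) (insert c J) * ord_sum A j * ((\<Sum>b\<in>insert c J. br j b) - (\<Sum>i\<in>T - A. br i j)))"
    unfolding first[symmetric] second[symmetric] sum.distrib[symmetric]
    by (rule sum.cong[OF refl]) (simp only: split sum.distrib)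
  finally show ?case by simp
qed

text \<open>Once \<open>cyc_eq\<close> is inserted, e(C - {i}, i) joins the word as the block of a
  new second index i. The functions w come from the singletons C = {i}.\<close>

lemma sum_seq_sum_cyc:
  assumes "finite J" "finite T" "j \<notin> J" "j \<notin> T" "T \<inter> J = {}"
  shows "(\<Sum>C\<in>Pow T. seq_sum (T - C) (insert j J) * cyc C j) =
    (\<Sum>i\<in>T. p i j * seq_sum (T - {i}) (insert i (insert j J))) - (\<Sum>i\<in>T. seq_sum (T - {i}) (insert j J) * w i j)"
proof -
  let ?J = "insert j J"
  \<comment> \<open>The condition card C = 1 is rewritten as C - {i} = {}, and T - C as T - insert i
    (C - {i}), so that each summand depends on i and C - {i} alone, as \<open>sum_Pow_remove\<close>
    requires.\<close>
  have cyc: "seq_sum (T - C) ?J * cyc C j = (\<Sum>i\<in>C. p i j * (seq_sum (T - insert i (C - {i})) ?J * ord_sum (C - {i}) i))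
      - (\<Sum>i\<in>C. if C - {i} = {} then seq_sum (T - {i}) ?J * w i j else 0)" if C: "C \<in> Pow T" for C
  proof (cases "C = {}")
    case False
    have finC: "finite C" using C assms finite_subset by auto
    have "cyc C j = (\<Sum>i\<in>C. p i j * ord_sum (C - {i}) i) - (if card C = 1 then \<Sum>i\<in>C. w i j else 0)"
      by (rule cyc_eq) (use C assms False finC in auto)
    moreover have "seq_sum (T - C) ?J * (\<Sum>i\<in>C. p i j * ord_sum (C - {i}) i) =
        (\<Sum>i\<in>C. p i j * (seq_sum (T - insert i (C - {i})) ?J * ord_sum (C - {i}) i))"
      unfolding sum_distrib_left
    proof (rule sum.cong[OF refl])
      fix i assume i: "i \<in> C"
      have "seq_sum (T - C) ?J * p i j = p i j * seq_sum (T - C) ?J"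
        by (rule seq_sum_commute) (use assms C in \<open>auto intro!: p_br[symmetric]\<close>)
      then show "seq_sum (T - C) ?J * (p i j * ord_sum (C - {i}) i) = p i j * (seq_sum (T - insert i (C - {i})) ?J * ord_sum (C - {i}) i)"
        using i by (simp add: insert_absorb mult.assoc[symmetric])
    qed
    moreover have "seq_sum (T - C) ?J * (if card C = 1 then \<Sum>i\<in>C. w i j else 0) =
        (\<Sum>i\<in>C. if C - {i} = {} then seq_sum (T - {i}) ?J * w i j else 0)"
    proof (cases "card C = 1")
      case True
      then obtain c where "C = {c}" using card_1_singletonE by blast
      then show ?thesis by simp
    next
      case nc: False
      have "C - {i} \<noteq> {}" if "i \<in> C" for i
      proof
        assume "C - {i} = {}"
        then have "C = {i}" using that by auto
        then show False using nc by simp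
      qed
      then show ?thesis using nc by (intro trans[OF _ sum.neutral[symmetric]]) auto
    qed
    ultimately show ?thesis by (simp add: right_diff_distrib)
  qed (simp add: cyc_def)
  have "(\<Sum>C\<in>Pow T. seq_sum (T - C) ?J * cyc C j) =
      (\<Sum>C\<in>Pow T. \<Sum>i\<in>C. p i j * (seq_sum (T - insert i (C - {i})) ?J * ord_sum (C - {i}) i))
      - (\<Sum>C\<in>Pow T. \<Sum>i\<in>C. if C - {i} = {} then seq_sum (T - {i}) ?J * w i j else 0)"
    by (rule trans[OF sum.cong[OF refl cyc] sum_subtractf])
  also have "(\<Sum>C\<in>Pow T. \<Sum>i\<in>C. p i j * (seq_sum (T - insert i (C - {i})) ?J * ord_sum (C - {i}) i)) =
      (\<Sum>i\<in>T. \<Sum>B\<in>Pow (T - {i}). p i j * (seq_sum (T - insert i B) ?J * ord_sum B i))"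
    by (rule sum_Pow_remove[OF assms(2)])
  also have "\<dots> = (\<Sum>i\<in>T. p i j * seq_sum (T - {i}) (insert i ?J))"
  proof (rule sum.cong[OF refl])
    fix i assume i: "i \<in> T"
    have "seq_sum (T - {i}) (insert i ?J) = (\<Sum>B\<in>Pow (T - {i}). seq_sum (T - {i} - B) ?J * ord_sum B i)"
      by (rule seq_sum_insert) (use i assms in auto)
    moreover have "T - {i} - B = T - insert i B" for B by auto
    ultimately show "(\<Sum>B\<in>Pow (T - {i}). p i j * (seq_sum (T - insert i B) ?J * ord_sum B i)) = p i j * seq_sum (T - {i}) (insert i ?J)"
      by (simp add: sum_distrib_left)
  qed
  also have "(\<Sum>C\<in>Pow T. \<Sum>i\<in>C. if C - {i} = {} then seq_sum (T - {i}) ?J * w i j else 0) =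
     (\<Sum>i\<in>T. \<Sum>B\<in>Pow (T - {i}). if B = {} then seq_sum (T - {i}) ?J * w i j else 0)"
    by (rule sum_Pow_remove[OF assms(2)])
  also have "\<dots> = (\<Sum>i\<in>T. seq_sum (T - {i}) ?J * w i j)"
    using assms(2) by simp
  finally show ?thesis .
qed

text \<open>The recursion step for a fixed set T, before matchings enter. For the block e(A,j) of
  second index j, the [ij] with i in T - A help to build the words with first index j, and those
  with i in A produce the cyclic sums.\<close>

lemma seq_sum_theta:
  assumes "finite J" "finite T" "j \<notin> J" "j \<notin> T" "T \<inter> J = {}"
  shows "seq_sum T (insert j J) * ((\<Sum>b\<in>J. br j b) - (\<Sum>i\<in>T. br i j))
      + (\<Sum>i\<in>T. p i j * seq_sum (T - {i}) (insert i (insert j J))) =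
    seq_sum (insert j T) J + (\<Sum>i\<in>T. seq_sum (T - {i}) (insert j J) * w i j)"
proof -
  define S where "S = (\<Sum>b\<in>J. br j b)"
  have seq_sum_ins: "seq_sum T (insert j J) = (\<Sum>A\<in>Pow T. seq_sum (T - A) J * ord_sum A j)"
    using assms by (rule seq_sum_insert)
  have "seq_sum T (insert j J) * (S - (\<Sum>i\<in>T. br i j)) =
     (\<Sum>A\<in>Pow T. seq_sum (T - A) J * ord_sum A j * (S - (\<Sum>i\<in>T - A. br i j)) - seq_sum (T - A) J * (\<Sum>i\<in>A. ord_sum A j * br i j))"
    unfolding seq_sum_ins sum_distrib_right
  proof (rule sum.cong[OF refl])
    fix A assume "A \<in> Pow T"
    then have "(\<Sum>i\<in>T. br i j) = (\<Sum>i\<in>T - A. br i j) + (\<Sum>i\<in>A. br i j)"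
      using assms(2) by (intro sum.subset_diff) auto
    then have "S - (\<Sum>i\<in>T. br i j) = (S - (\<Sum>i\<in>T - A. br i j)) - (\<Sum>i\<in>A. br i j)"
      by simp
    then show "seq_sum (T - A) J * ord_sum A j * (S - (\<Sum>i\<in>T. br i j)) =
        seq_sum (T - A) J * ord_sum A j * (S - (\<Sum>i\<in>T - A. br i j)) - seq_sum (T - A) J * (\<Sum>i\<in>A. ord_sum A j * br i j)"
      by (simp only: right_diff_distrib mult.assoc sum_distrib_left[symmetric])
  qed
  also have "\<dots> = seq_sum (insert j T) J - (\<Sum>A\<in>Pow T. seq_sum (T - A) J * (\<Sum>i\<in>A. ord_sum A j * br i j))"
    unfolding sum_subtractf S_def seq_sum_insert_left[OF assms] ..
  also have "(\<Sum>A\<in>Pow T. seq_sum (T - A) J * (\<Sum>i\<in>A. ord_sum A j * br i j)) =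
     (\<Sum>A\<in>Pow T. \<Sum>C\<in>Pow A. seq_sum (T - (C \<union> (A - C))) J * ord_sum (A - C) j * cyc C j)"
  proof (rule sum.cong[OF refl])
    fix A assume A: "A \<in> Pow T"
    have "(\<Sum>i\<in>A. ord_sum A j * br i j) = (\<Sum>C\<in>Pow A. ord_sum (A - C) j * cyc C j)"
      by (rule ord_sum_br_sum) (use A assms in \<open>auto intro: finite_subset\<close>)
    moreover have "C \<union> (A - C) = A" if "C \<in> Pow A" for C using that by auto
    ultimately show "seq_sum (T - A) J * (\<Sum>i\<in>A. ord_sum A j * br i j) =
        (\<Sum>C\<in>Pow A. seq_sum (T - (C \<union> (A - C))) J * ord_sum (A - C) j * cyc C j)"
      by (simp add: sum_distrib_left mult.assoc)
  qed
  also have "\<dots> = (\<Sum>C\<in>Pow T. \<Sum>B\<in>Pow (T - C). seq_sum (T - (C \<union> B)) J * ord_sum B j * cyc C j)"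
    by (rule sum_disjoint_pairs_Un[OF assms(2), symmetric])
  also have "\<dots> = (\<Sum>C\<in>Pow T. seq_sum (T - C) (insert j J) * cyc C j)"
  proof (rule sum.cong[OF refl])
    fix C assume "C \<in> Pow T"
    have "seq_sum (T - C) (insert j J) = (\<Sum>B\<in>Pow (T - C). seq_sum (T - C - B) J * ord_sum B j)"
      by (rule seq_sum_insert) (use assms in auto)
    moreover have "T - C - B = T - (C \<union> B)" for B by auto
    ultimately show "(\<Sum>B\<in>Pow (T - C). seq_sum (T - (C \<union> B)) J * ord_sum B j * cyc C j) = seq_sum (T - C) (insert j J) * cyc C j"
      by (simp add: sum_distrib_right)
  qed
  finally show ?thesis
    using sum_seq_sum_cyc[OF assms] by (simp add: S_def)
qed

text \<open>The block of j, placed at the right end, is empty or has a last factor [ij]. Withdrawing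
  j from the second indices thus costs only right multiples of the [ij].\<close>

lemma seq_sum_insert_last:
  assumes "finite J" "finite T" "j \<notin> J" "j \<notin> T" "T \<inter> J = {}"
  shows "seq_sum T (insert j J) = seq_sum T J + (\<Sum>i\<in>T. seq_sum (T - {i}) (insert j J) * br i j)"
proof -
  have "seq_sum T (insert j J) = (\<Sum>A\<in>Pow T. seq_sum (T - A) J * ord_sum A j)"
    using assms by (rule seq_sum_insert)
  also have "\<dots> = seq_sum (T - {}) J * ord_sum {} j + (\<Sum>i\<in>T. \<Sum>A\<in>Pow (T - {i}). seq_sum (T - insert i A) J * ord_sum A j * br i j)"
  proof (rule sum_Pow_rec[OF assms(2)])
    fix A assume A: "A \<subseteq> T" "A \<noteq> {}"
    then have "finite A" using assms(2) finite_subset by auto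
    then show "seq_sum (T - A) J * ord_sum A j = (\<Sum>i\<in>A. seq_sum (T - insert i (A - {i})) J * ord_sum (A - {i}) j * br i j)"
      using A by (simp add: ord_sum_last[of A] sum_distrib_left insert_absorb mult.assoc)
  qed
  also have "(\<Sum>i\<in>T. \<Sum>A\<in>Pow (T - {i}). seq_sum (T - insert i A) J * ord_sum A j * br i j) =
      (\<Sum>i\<in>T. seq_sum (T - {i}) (insert j J) * br i j)"
  proof (rule sum.cong[OF refl])
    fix i assume "i \<in> T"
    have "seq_sum (T - {i}) (insert j J) = (\<Sum>A\<in>Pow (T - {i}). seq_sum (T - {i} - A) J * ord_sum A j)"
      by (rule seq_sum_insert) (use assms in auto)
    moreover have "T - {i} - A = T - insert i A" for A by auto
    ultimately show "(\<Sum>A\<in>Pow (T - {i}). seq_sum (T - insert i A) J * ord_sum A j * br i j) = seq_sum (T - {i}) (insert j J) * br i j"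
      by (simp add: sum_distrib_right)
  qed
  finally show ?thesis by simp
qed

text \<open>If the block of j is empty, w i j passes unchanged. Otherwise the last factor [aj] turns
  it into w i a, and as neither a nor i occurs in the remaining factors, it passes those
  freely.\<close>

lemma seq_sum_w:
  assumes "finite J" "finite T" "j \<notin> J" "j \<notin> T" "T \<inter> J = {}" "i \<notin> T" "i \<notin> J" "i \<noteq> j"
  shows "seq_sum T (insert j J) * w i j = w i j * seq_sum T J + (\<Sum>a\<in>T. w i a * seq_sum (T - {a}) (insert j J) * br a j)"
proof -
  have "seq_sum T (insert j J) * w i j = (\<Sum>A\<in>Pow T. seq_sum (T - A) J * ord_sum A j * w i j)"
    unfolding seq_sum_insert[OF assms(1-5)] by (rule sum_distrib_right)
  also have "\<dots> = seq_sum (T - {}) J * ord_sum {} j * w i j + (\<Sum>a\<in>T. \<Sum>A\<in>Pow (T - {a}). w i a * (seq_sum (T - insert a A) J * ord_sum A j * br a j))"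
  proof (rule sum_Pow_rec[OF assms(2)])
    fix A assume A: "A \<subseteq> T" "A \<noteq> {}"
    then have "finite A" using assms(2) finite_subset by auto
    then have "seq_sum (T - A) J * ord_sum A j * w i j = (\<Sum>a\<in>A. seq_sum (T - A) J * ord_sum (A - {a}) j * (br a j * w i j))"
      using A by (simp add: ord_sum_last[of A] sum_distrib_left sum_distrib_right mult.assoc)
    also have "\<dots> = (\<Sum>a\<in>A. w i a * (seq_sum (T - insert a (A - {a})) J * ord_sum (A - {a}) j * br a j))"
    proof (rule sum.cong[OF refl])
      fix a assume a: "a \<in> A"
      have "br a j * w i j = w i a * br a j"
        by (rule br_w) (use a A assms in auto)
      moreover have "ord_sum (A - {a}) j * w i a = w i a * ord_sum (A - {a}) j"
        by (rule ord_sum_commute, rule br_w_commute) (use a A assms in auto)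
      moreover have "seq_sum (T - A) J * w i a = w i a * seq_sum (T - A) J"
        by (rule seq_sum_commute, rule br_w_commute) (use a A assms in auto)
      moreover have "insert a (A - {a}) = A" using a by auto
      ultimately show "seq_sum (T - A) J * ord_sum (A - {a}) j * (br a j * w i j) =
          w i a * (seq_sum (T - insert a (A - {a})) J * ord_sum (A - {a}) j * br a j)"
        by (metis mult.assoc)
    qed
    finally show "seq_sum (T - A) J * ord_sum A j * w i j =
      (\<Sum>a\<in>A. w i a * (seq_sum (T - insert a (A - {a})) J * ord_sum (A - {a}) j * br a j))" .
  qed
  also have "(\<Sum>a\<in>T. \<Sum>A\<in>Pow (T - {a}). w i a * (seq_sum (T - insert a A) J * ord_sum A j * br a j)) =
      (\<Sum>a\<in>T. w i a * seq_sum (T - {a}) (insert j J) * br a j)"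
  proof (rule sum.cong[OF refl])
    fix a assume "a \<in> T"
    have "seq_sum (T - {a}) (insert j J) = (\<Sum>A\<in>Pow (T - {a}). seq_sum (T - {a} - A) J * ord_sum A j)"
      by (rule seq_sum_insert) (use assms in auto)
    moreover have "T - {a} - A = T - insert a A" for A by auto
    ultimately show "(\<Sum>A\<in>Pow (T - {a}). w i a * (seq_sum (T - insert a A) J * ord_sum A j * br a j)) =
        w i a * seq_sum (T - {a}) (insert j J) * br a j"
      by (simp add: sum_distrib_right sum_distrib_left mult.assoc)
  qed
  also have "seq_sum (T - {}) J * ord_sum {} j * w i j = w i j * seq_sum T J"
  proof -
    have "seq_sum T J * w i j = w i j * seq_sum T J"
      by (rule seq_sum_commute, rule br_w_commute) (use assms in auto)
    then show ?thesis by simp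
  qed
  finally show ?thesis .
qed

section \<open>Words together with matchings\<close>

definition level_sum :: "'i set \<Rightarrow> 'i set \<Rightarrow> 'r" where
  "level_sum V B = (\<Sum>I0\<in>Pow V. ph I0 * seq_sum (V - I0) B)"

lemma level_sum_empty [simp]: "level_sum {} B = 1"
  by (simp add: level_sum_def ph_empty)

lemma level_sum_insert_last:
  assumes "finite J" "finite V" "j \<notin> J" "j \<notin> V" "V \<inter> J = {}"
  shows "level_sum V (insert j J) = level_sum V J + (\<Sum>i\<in>V. level_sum (V - {i}) (insert j J) * br i j)"
proof -
  have "level_sum V (insert j J) = (\<Sum>I0\<in>Pow V. ph I0 * seq_sum (V - I0) J + (\<Sum>i\<in>V - I0. ph I0 * seq_sum (V - {i} - I0) (insert j J) * br i j))"
    unfolding level_sum_def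
  proof (rule sum.cong[OF refl])
    fix I0 assume "I0 \<in> Pow V"
    have "seq_sum (V - I0) (insert j J) = seq_sum (V - I0) J + (\<Sum>i\<in>V - I0. seq_sum (V - I0 - {i}) (insert j J) * br i j)"
      by (rule seq_sum_insert_last) (use assms in auto)
    moreover have "V - I0 - {i} = V - {i} - I0" for i by auto
    ultimately show "ph I0 * seq_sum (V - I0) (insert j J) =
        ph I0 * seq_sum (V - I0) J + (\<Sum>i\<in>V - I0. ph I0 * seq_sum (V - {i} - I0) (insert j J) * br i j)"
      by (simp add: distrib_left sum_distrib_left mult.assoc)
  qed
  also have "\<dots> = level_sum V J + (\<Sum>i\<in>V. \<Sum>I0\<in>Pow (V - {i}). ph I0 * seq_sum (V - {i} - I0) (insert j J) * br i j)"
    unfolding sum.distrib level_sum_def sum_Pow_outside[OF assms(2)] ..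
  finally show ?thesis by (simp add: level_sum_def sum_distrib_right)
qed

text \<open>On the left stand the functions w i a produced by moving w i j across the words, on the
  right the part of theta_j with a in I_0. Expanding ph I_0 by the partner i of a turns the right
  into the left, with I_0 - {i, a} in the role of I_0.\<close>

lemma sum_ph_outside:
  assumes "finite J" "finite V" "j \<notin> J" "j \<notin> V" "V \<inter> J = {}"
  shows "(\<Sum>I0\<in>Pow V. \<Sum>i\<in>V - I0. \<Sum>a\<in>V - I0 - {i}. ph I0 * (w i a * seq_sum (V - I0 - {i} - {a}) (insert j J) * br a j)) =
    (\<Sum>I0\<in>Pow V. \<Sum>a\<in>I0. ph I0 * seq_sum (V - I0) (insert j J) * br a j)"
proof -
  let ?f = "\<lambda>a i A. w i a * ph A * seq_sum (V - insert a (insert i A)) (insert j J) * br a j"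
  have "(\<Sum>I0\<in>Pow V. \<Sum>a\<in>I0. ph I0 * seq_sum (V - I0) (insert j J) * br a j) =
     (\<Sum>I0\<in>Pow V. \<Sum>a\<in>I0. \<Sum>i\<in>I0 - {a}. ?f a i (I0 - {a} - {i}))"
  proof (intro sum.cong refl)
    fix I0 a assume *: "I0 \<in> Pow V" "a \<in> I0"
    then have "finite I0" using assms(2) finite_subset by auto
    then have "ph I0 = (\<Sum>i\<in>I0 - {a}. w i a * ph (I0 - {i, a}))"
      using * by (intro ph_rec)
    moreover have "insert a (insert i (I0 - {a} - {i})) = I0" "I0 - {i, a} = I0 - {a} - {i}" if "i \<in> I0 - {a}" for i
      using that * by auto
    ultimately show "ph I0 * seq_sum (V - I0) (insert j J) * br a j = (\<Sum>i\<in>I0 - {a}. ?f a i (I0 - {a} - {i}))"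
      by (simp add: sum_distrib_right)
  qed
  also have "\<dots> = (\<Sum>a\<in>V. \<Sum>A\<in>Pow (V - {a}). \<Sum>i\<in>A. ?f a i (A - {i}))"
    by (rule sum_Pow_remove[OF assms(2), of "\<lambda>a A. \<Sum>i\<in>A. ?f a i (A - {i})"])
  also have "\<dots> = (\<Sum>a\<in>V. \<Sum>i\<in>V - {a}. \<Sum>A\<in>Pow (V - {a} - {i}). ?f a i A)"
    by (intro sum.cong refl sum_Pow_remove) (use assms in auto)
  also have "\<dots> = (\<Sum>i\<in>V. \<Sum>a\<in>V - {i}. \<Sum>A\<in>Pow (V - {a} - {i}). ?f a i A)"
    by (rule sum_distinct_pairs_swap[OF assms(2)])
  also have "\<dots> = (\<Sum>i\<in>V. \<Sum>a\<in>V - {i}. \<Sum>A\<in>Pow (V - {i} - {a}). ?f a i A)"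
  proof (intro sum.cong refl)
    fix i a show "Pow (V - {a} - {i}) = Pow (V - {i} - {a})" by auto
  qed
  also have "\<dots> = (\<Sum>i\<in>V. \<Sum>I0\<in>Pow (V - {i}). \<Sum>a\<in>V - {i} - I0. ?f a i I0)"
    by (intro sum.cong refl sum_Pow_outside[symmetric]) (use assms in auto)
  also have "\<dots> = (\<Sum>I0\<in>Pow V. \<Sum>i\<in>V - I0. \<Sum>a\<in>V - {i} - I0. ?f a i I0)"
    by (rule sum_Pow_outside[OF assms(2), symmetric])
  also have "\<dots> = (\<Sum>I0\<in>Pow V. \<Sum>i\<in>V - I0. \<Sum>a\<in>V - I0 - {i}. ph I0 * (w i a * seq_sum (V - I0 - {i} - {a}) (insert j J) * br a j))"
  proof (intro sum.cong refl)
    fix I0 i a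
    show "V - {i} - I0 = V - I0 - {i}" by auto
    have "V - insert a (insert i I0) = V - I0 - {i} - {a}" by auto
    then show "?f a i I0 = ph I0 * (w i a * seq_sum (V - I0 - {i} - {a}) (insert j J) * br a j)"
      by (simp add: w_ph mult.assoc[symmetric])
  qed
  finally show ?thesis by simp
qed

text \<open>\<open>seq_sum_theta\<close> is multiplied by ph I_0 and summed over I_0. Of the subsets
  of insert j V, those without j come from the words that gained the first index j, those with j
  from the functions w i j, which match j with i.\<close>

lemma level_sum_insert_theta:
  assumes "finite J" "finite V" "j \<notin> J" "j \<notin> V" "V \<inter> J = {}"
  shows "level_sum (insert j V) J = level_sum V (insert j J) * ((\<Sum>b\<in>J. br j b) - (\<Sum>i\<in>V. br i j))
    + (\<Sum>i\<in>V. p i j * level_sum (V - {i}) (insert i (insert j J)))"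
proof -
  let ?J = "insert j J"
  define S where "S = (\<Sum>b\<in>J. br j b)"
  have 1: "(\<Sum>i\<in>V. p i j * level_sum (V - {i}) (insert i ?J)) =
      (\<Sum>I0\<in>Pow V. \<Sum>i\<in>V - I0. ph I0 * (p i j * seq_sum (V - I0 - {i}) (insert i ?J)))"
  proof -
    have "(\<Sum>i\<in>V. p i j * level_sum (V - {i}) (insert i ?J)) =
        (\<Sum>i\<in>V. \<Sum>I0\<in>Pow (V - {i}). ph I0 * (p i j * seq_sum (V - I0 - {i}) (insert i ?J)))"
      unfolding level_sum_def sum_distrib_left
    proof (intro sum.cong refl)
      fix i I0
      have "V - {i} - I0 = V - I0 - {i}" by auto
      then show "p i j * (ph I0 * seq_sum (V - {i} - I0) (insert i ?J)) = ph I0 * (p i j * seq_sum (V - I0 - {i}) (insert i ?J))"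
        by (simp add: p_ph mult.assoc[symmetric])
    qed
    then show ?thesis by (simp only: sum_Pow_outside[OF assms(2)])
  qed
  \<comment> \<open>The four groups are words with first index j, functions w i j that passed
    unchanged, functions turned into w i a with a final [aj], and the [aj] with a in I_0. The last
    two cancel after summation over I_0, not for each I_0 separately.\<close>
  have 2: "level_sum V ?J * (S - (\<Sum>i\<in>V. br i j)) + (\<Sum>i\<in>V. p i j * level_sum (V - {i}) (insert i ?J)) =
     (\<Sum>I0\<in>Pow V. ph I0 * seq_sum (insert j (V - I0)) J
       + (\<Sum>i\<in>V - I0. ph I0 * (w i j * seq_sum (V - I0 - {i}) J))
       + (\<Sum>i\<in>V - I0. \<Sum>a\<in>V - I0 - {i}. ph I0 * (w i a * seq_sum (V - I0 - {i} - {a}) ?J * br a j))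
       - (\<Sum>a\<in>I0. ph I0 * seq_sum (V - I0) ?J * br a j))"
    unfolding 1 unfolding level_sum_def sum_distrib_right
  proof (rule trans[OF sum.distrib[symmetric]], rule sum.cong[OF refl])
    fix I0 assume I0: "I0 \<in> Pow V"
    define T where "T = V - I0"
    have T: "finite T" "j \<notin> T" "T \<inter> J = {}" using assms by (auto simp: T_def)
    have "(\<Sum>i\<in>V. br i j) = (\<Sum>i\<in>T. br i j) + (\<Sum>i\<in>I0. br i j)"
      unfolding T_def using assms(2) I0 by (intro sum.subset_diff) auto
    then have eq: "S - (\<Sum>i\<in>V. br i j) = (S - (\<Sum>i\<in>T. br i j)) - (\<Sum>i\<in>I0. br i j)"
      by simp
    have Q: "seq_sum T ?J * (S - (\<Sum>i\<in>T. br i j)) + (\<Sum>i\<in>T. p i j * seq_sum (T - {i}) (insert i ?J)) =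
       seq_sum (insert j T) J + (\<Sum>i\<in>T. seq_sum (T - {i}) ?J * w i j)"
      unfolding S_def by (rule seq_sum_theta) (use T assms in auto)
    have W: "(\<Sum>i\<in>T. seq_sum (T - {i}) ?J * w i j) =
        (\<Sum>i\<in>T. w i j * seq_sum (T - {i}) J + (\<Sum>a\<in>T - {i}. w i a * seq_sum (T - {i} - {a}) ?J * br a j))"
      by (intro sum.cong refl seq_sum_w) (use T assms in \<open>auto simp: T_def\<close>)
    have "ph I0 * seq_sum T ?J * (S - (\<Sum>i\<in>V. br i j)) + (\<Sum>i\<in>T. ph I0 * (p i j * seq_sum (T - {i}) (insert i ?J))) =
       ph I0 * (seq_sum T ?J * (S - (\<Sum>i\<in>T. br i j)) + (\<Sum>i\<in>T. p i j * seq_sum (T - {i}) (insert i ?J)))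
         - (\<Sum>a\<in>I0. ph I0 * seq_sum T ?J * br a j)"
      unfolding eq by (simp add: distrib_left right_diff_distrib sum_distrib_left mult.assoc)
    also have "\<dots> = ph I0 * seq_sum (insert j T) J + (\<Sum>i\<in>T. ph I0 * (w i j * seq_sum (T - {i}) J))
       + (\<Sum>i\<in>T. \<Sum>a\<in>T - {i}. ph I0 * (w i a * seq_sum (T - {i} - {a}) ?J * br a j))
       - (\<Sum>a\<in>I0. ph I0 * seq_sum T ?J * br a j)"
      unfolding Q W by (simp add: distrib_left sum_distrib_left sum.distrib)
    finally show "ph I0 * seq_sum (V - I0) ?J * (S - (\<Sum>i\<in>V. br i j)) + (\<Sum>i\<in>V - I0. ph I0 * (p i j * seq_sum (V - I0 - {i}) (insert i ?J))) =
      ph I0 * seq_sum (insert j (V - I0)) J + (\<Sum>i\<in>V - I0. ph I0 * (w i j * seq_sum (V - I0 - {i}) J))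
       + (\<Sum>i\<in>V - I0. \<Sum>a\<in>V - I0 - {i}. ph I0 * (w i a * seq_sum (V - I0 - {i} - {a}) ?J * br a j))
       - (\<Sum>a\<in>I0. ph I0 * seq_sum (V - I0) ?J * br a j)"
      by (simp only: T_def)
  qed
  also have "\<dots> = (\<Sum>I0\<in>Pow V. ph I0 * seq_sum (insert j (V - I0)) J)
     + (\<Sum>I0\<in>Pow V. \<Sum>i\<in>V - I0. ph I0 * (w i j * seq_sum (V - I0 - {i}) J))"
    unfolding sum.distrib sum_subtractf sum_ph_outside[OF assms] by simp
  also have "(\<Sum>I0\<in>Pow V. \<Sum>i\<in>V - I0. ph I0 * (w i j * seq_sum (V - I0 - {i}) J)) =
      (\<Sum>I0\<in>Pow V. ph (insert j I0) * seq_sum (V - I0) J)"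
  proof -
    have "(\<Sum>I0\<in>Pow V. ph (insert j I0) * seq_sum (V - I0) J) =
       (\<Sum>I0\<in>Pow V. \<Sum>i\<in>I0. w i j * ph (I0 - {i}) * seq_sum (V - insert i (I0 - {i})) J)"
    proof (rule sum.cong[OF refl])
      fix I0 assume I0: "I0 \<in> Pow V"
      then have "finite I0" "j \<notin> I0" using assms finite_subset by auto
      then have "ph (insert j I0) = (\<Sum>i\<in>insert j I0 - {j}. w i j * ph (insert j I0 - {i, j}))"
        by (intro ph_rec) auto
      also have "\<dots> = (\<Sum>i\<in>I0. w i j * ph (I0 - {i}))"
      proof (rule sum.cong)
        show "insert j I0 - {j} = I0" using \<open>j \<notin> I0\<close> by auto
        fix i
        have "insert j I0 - {i, j} = I0 - {i}" using \<open>j \<notin> I0\<close> by auto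
        then show "w i j * ph (insert j I0 - {i, j}) = w i j * ph (I0 - {i})" by simp
      qed
      finally show "ph (insert j I0) * seq_sum (V - I0) J =
          (\<Sum>i\<in>I0. w i j * ph (I0 - {i}) * seq_sum (V - insert i (I0 - {i})) J)"
        by (simp add: sum_distrib_right insert_absorb)
    qed
    also have "\<dots> = (\<Sum>i\<in>V. \<Sum>A\<in>Pow (V - {i}). w i j * ph A * seq_sum (V - insert i A) J)"
      by (rule sum_Pow_remove[OF assms(2), of "\<lambda>i A. w i j * ph A * seq_sum (V - insert i A) J"])
    also have "\<dots> = (\<Sum>I0\<in>Pow V. \<Sum>i\<in>V - I0. w i j * ph I0 * seq_sum (V - insert i I0) J)"
      by (rule sum_Pow_outside[OF assms(2), symmetric])
    also have "\<dots> = (\<Sum>I0\<in>Pow V. \<Sum>i\<in>V - I0. ph I0 * (w i j * seq_sum (V - I0 - {i}) J))"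
    proof (intro sum.cong refl)
      fix I0 i
      have "V - insert i I0 = V - I0 - {i}" by auto
      then show "w i j * ph I0 * seq_sum (V - insert i I0) J = ph I0 * (w i j * seq_sum (V - I0 - {i}) J)"
        by (simp add: w_ph mult.assoc)
    qed
    finally show ?thesis by simp
  qed
  also have "(\<Sum>I0\<in>Pow V. ph I0 * seq_sum (insert j (V - I0)) J) + (\<Sum>I0\<in>Pow V. ph (insert j I0) * seq_sum (V - I0) J) = level_sum (insert j V) J"
  proof -
    have "insert j V - I0 = insert j (V - I0)" "insert j V - insert j I0 = V - I0" if "I0 \<in> Pow V" for I0
      using that assms(4) by auto
    then show ?thesis
      unfolding level_sum_def sum_Pow_insert[OF assms(2,4)] by simp
  qed
  finally show ?thesis by (simp add: S_def)
qed

section \<open>The right-hand side of degree k and its recursion\<close>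

definition pieri_sum :: "'i set \<Rightarrow> nat \<Rightarrow> 'i set \<Rightarrow> 'r" where
  "pieri_sum N k I = (\<Sum>V\<in>Pow I. if card V = k then level_sum V (N - I) else 0)"

lemma pieri_sum_empty: "pieri_sum N k {} = (if k = 0 then 1 else 0)"
  by (simp add: pieri_sum_def)

text \<open>Sets V without j lose the second index j, which costs the [ij] with i outside V. Sets
  with j bring the [ij] with i in V and the terms p i j. Together the [ij] run over all of I and
  complete theta_j, as a right factor just as in \<open>Eaux\<close>.\<close>

lemma pieri_sum_insert:
  assumes "finite N" "insert j I \<subseteq> N" "j \<notin> I"
  shows "pieri_sum N k (insert j I) = pieri_sum N k I
    + (if 1 \<le> k then pieri_sum N (k - 1) I * (\<Sum>b\<in>N - {j}. br j b) else 0)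
    + (if 2 \<le> k then \<Sum>i\<in>I. p i j * pieri_sum N (k - 2) (I - {i}) else 0)"
proof -
  define J where "J = N - insert j I"
  define S where "S = (\<Sum>b\<in>J. br j b)"
  have finI: "finite I" and finJ: "finite J" and jJ: "j \<notin> J"
    using assms finite_subset by (auto simp: J_def)
  have disj: "V \<inter> J = {}" "finite V" "j \<notin> V" if "V \<in> Pow I" for V
    using that assms finI finite_subset by (auto simp: J_def)
  have NI: "N - I = insert j J" using assms by (auto simp: J_def)
  have NIi: "N - (I - {i}) = insert i (insert j J)" if "i \<in> I" for i
    using that assms by (auto simp: J_def)
  \<comment> \<open>For b in I the bracket [jb] is replaced by -[bj], which has j as second index
    like the words it is multiplied with.\<close>
  have \<theta>: "(\<Sum>b\<in>N - {j}. br j b) = S - (\<Sum>i\<in>I. br i j)"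
  proof -
    have "N - {j} = J \<union> I" "J \<inter> I = {}" using assms by (auto simp: J_def)
    then have "(\<Sum>b\<in>N - {j}. br j b) = S + (\<Sum>i\<in>I. br j i)"
      unfolding S_def using finI finJ by (simp add: sum.union_disjoint)
    also have "(\<Sum>i\<in>I. br j i) = (\<Sum>i\<in>I. - br i j)"
      by (intro sum.cong refl br_anti) (use assms in auto)
    finally show ?thesis by (simp add: sum_negf)
  qed
  have A: "(\<Sum>V\<in>Pow I. if card V = k then level_sum V J else 0) =
     pieri_sum N k I - (\<Sum>V\<in>Pow I. if card V + 1 = k then level_sum V (insert j J) * (\<Sum>i\<in>I - V. br i j) else 0)"
  proof -
    have "(\<Sum>V\<in>Pow I. if card V = k then level_sum V J else 0) =
      pieri_sum N k I - (\<Sum>V\<in>Pow I. \<Sum>i\<in>V. if card (V - {i}) + 1 = k then level_sum (V - {i}) (insert j J) * br i j else 0)"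
      unfolding pieri_sum_def NI sum_subtractf[symmetric]
    proof (rule sum.cong[OF refl])
      fix V assume V: "V \<in> Pow I"
      have "card (V - {i}) + 1 = card V" if "i \<in> V" for i
        using that disj(2)[OF V] card_Suc_Diff1 by fastforce
      then show "(if card V = k then level_sum V J else 0) = (if card V = k then level_sum V (insert j J) else 0)
          - (\<Sum>i\<in>V. if card (V - {i}) + 1 = k then level_sum (V - {i}) (insert j J) * br i j else 0)"
        using level_sum_insert_last[OF finJ disj(2)[OF V] jJ disj(3)[OF V] disj(1)[OF V]] by simp
    qed
    also have "(\<Sum>V\<in>Pow I. \<Sum>i\<in>V. if card (V - {i}) + 1 = k then level_sum (V - {i}) (insert j J) * br i j else 0) =
       (\<Sum>i\<in>I. \<Sum>V\<in>Pow (I - {i}). if card V + 1 = k then level_sum V (insert j J) * br i j else 0)"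
      by (rule sum_Pow_remove[OF finI])
    also have "\<dots> = (\<Sum>V\<in>Pow I. \<Sum>i\<in>I - V. if card V + 1 = k then level_sum V (insert j J) * br i j else 0)"
      by (rule sum_Pow_outside[OF finI, symmetric])
    also have "\<dots> = (\<Sum>V\<in>Pow I. if card V + 1 = k then level_sum V (insert j J) * (\<Sum>i\<in>I - V. br i j) else 0)"
      by (intro sum.cong refl) (simp add: sum_distrib_left)
    finally show ?thesis .
  qed
  have B: "(\<Sum>V\<in>Pow I. if card V + 1 = k then level_sum (insert j V) J else 0) =
      (\<Sum>V\<in>Pow I. if card V + 1 = k then level_sum V (insert j J) * (S - (\<Sum>i\<in>V. br i j)) else 0)
      + (\<Sum>i\<in>I. \<Sum>V\<in>Pow (I - {i}). if card V + 2 = k then p i j * level_sum V (insert i (insert j J)) else 0)"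
  proof -
    have "(\<Sum>V\<in>Pow I. if card V + 1 = k then level_sum (insert j V) J else 0) =
       (\<Sum>V\<in>Pow I. if card V + 1 = k then level_sum V (insert j J) * (S - (\<Sum>i\<in>V. br i j)) else 0)
      + (\<Sum>V\<in>Pow I. \<Sum>i\<in>V. if card (V - {i}) + 2 = k then p i j * level_sum (V - {i}) (insert i (insert j J)) else 0)"
      unfolding sum.distrib[symmetric]
    proof (rule sum.cong[OF refl])
      fix V assume V: "V \<in> Pow I"
      have "card (V - {i}) + 2 = card V + 1" if "i \<in> V" for i
        using that disj(2)[OF V] card_Suc_Diff1 by fastforce
      then show "(if card V + 1 = k then level_sum (insert j V) J else 0) =
        (if card V + 1 = k then level_sum V (insert j J) * (S - (\<Sum>i\<in>V. br i j)) else 0)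
        + (\<Sum>i\<in>V. if card (V - {i}) + 2 = k then p i j * level_sum (V - {i}) (insert i (insert j J)) else 0)"
        using level_sum_insert_theta[OF finJ disj(2)[OF V] jJ disj(3)[OF V] disj(1)[OF V]] by (simp add: S_def)
    qed
    also have "(\<Sum>V\<in>Pow I. \<Sum>i\<in>V. if card (V - {i}) + 2 = k then p i j * level_sum (V - {i}) (insert i (insert j J)) else 0) =
      (\<Sum>i\<in>I. \<Sum>V\<in>Pow (I - {i}). if card V + 2 = k then p i j * level_sum V (insert i (insert j J)) else 0)"
      by (rule sum_Pow_remove[OF finI])
    finally show ?thesis .
  qed
  have "pieri_sum N k (insert j I) = (\<Sum>V\<in>Pow I. if card V = k then level_sum V J else 0)
      + (\<Sum>V\<in>Pow I. if card V + 1 = k then level_sum (insert j V) J else 0)"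
    unfolding pieri_sum_def sum_Pow_insert[OF finI assms(3)] J_def[symmetric]
  proof (intro arg_cong2[where f = plus] refl sum.cong)
    fix V assume "V \<in> Pow I"
    then show "(if card (insert j V) = k then level_sum (insert j V) J else 0) = (if card V + 1 = k then level_sum (insert j V) J else 0)"
      using disj by simp
  qed
  also have "\<dots> = pieri_sum N k I + (\<Sum>V\<in>Pow I. if card V + 1 = k then level_sum V (insert j J) * (S - (\<Sum>i\<in>I. br i j)) else 0)
      + (\<Sum>i\<in>I. \<Sum>V\<in>Pow (I - {i}). if card V + 2 = k then p i j * level_sum V (insert i (insert j J)) else 0)"
  proof -
    have "(\<Sum>V\<in>Pow I. if card V + 1 = k then level_sum V (insert j J) * (S - (\<Sum>i\<in>I. br i j)) else 0) =
      (\<Sum>V\<in>Pow I. if card V + 1 = k then level_sum V (insert j J) * (S - (\<Sum>i\<in>V. br i j)) else 0)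
       - (\<Sum>V\<in>Pow I. if card V + 1 = k then level_sum V (insert j J) * (\<Sum>i\<in>I - V. br i j) else 0)"
      unfolding sum_subtractf[symmetric]
    proof (rule sum.cong[OF refl])
      fix V assume "V \<in> Pow I"
      then have "(\<Sum>i\<in>I. br i j) = (\<Sum>i\<in>I - V. br i j) + (\<Sum>i\<in>V. br i j)"
        using finI by (intro sum.subset_diff) auto
      then show "(if card V + 1 = k then level_sum V (insert j J) * (S - (\<Sum>i\<in>I. br i j)) else 0) =
         (if card V + 1 = k then level_sum V (insert j J) * (S - (\<Sum>i\<in>V. br i j)) else 0)
         - (if card V + 1 = k then level_sum V (insert j J) * (\<Sum>i\<in>I - V. br i j) else 0)"
        by (simp add: algebra_simps)
    qed
    note D = this
    show ?thesis unfolding A B D by (simp only: algebra_simps)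
  qed
  also have "(\<Sum>V\<in>Pow I. if card V + 1 = k then level_sum V (insert j J) * (S - (\<Sum>i\<in>I. br i j)) else 0) =
      (if 1 \<le> k then pieri_sum N (k - 1) I * (\<Sum>b\<in>N - {j}. br j b) else 0)"
  proof (cases "1 \<le> k")
    case True
    then have "card V + 1 = k \<longleftrightarrow> card V = k - 1" for V :: "'i set" by auto
    then show ?thesis
      using True unfolding pieri_sum_def NI \<theta> by (simp add: sum_distrib_right if_distrib[of "\<lambda>x. x * _"] cong: if_cong)
  qed (auto intro: sum.neutral)
  also have "(\<Sum>i\<in>I. \<Sum>V\<in>Pow (I - {i}). if card V + 2 = k then p i j * level_sum V (insert i (insert j J)) else 0) =
      (if 2 \<le> k then \<Sum>i\<in>I. p i j * pieri_sum N (k - 2) (I - {i}) else 0)"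
  proof (cases "2 \<le> k")
    case True
    then have "card V + 2 = k \<longleftrightarrow> card V = k - 2" for V :: "'i set" by auto
    then show ?thesis
      using True unfolding pieri_sum_def
      by (simp add: sum_distrib_left if_distrib[of "\<lambda>x. _ * x"] NIi cong: if_cong sum.cong)
  qed (auto intro!: sum.neutral)
  finally show ?thesis .
qed

text \<open>Each expansion removes two elements, and for a singleton the sum is empty. This reduces
  the sum over all I_0 to those of even size.\<close>

lemma ph_odd:
  assumes "finite A" "odd (card A)"
  shows "ph A = 0"
  using assms
proof (induction rule: finite_psubset_induct)
  case (psubset A)
  then obtain a where a: "a \<in> A" by (metis card.empty even_zero ex_in_conv)
  have "ph A = (\<Sum>i\<in>A - {a}. w i a * ph (A - {i, a}))"
    using psubset.hyps a by (rule ph_rec)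
  also have "\<dots> = 0"
  proof (rule sum.neutral, rule ballI)
    fix i assume i: "i \<in> A - {a}"
    then have "card A = card (insert i (insert a (A - {i, a})))"
      using a by (intro arg_cong[where f = card]) auto
    also have "\<dots> = Suc (Suc (card (A - {i, a})))"
      using psubset.hyps i by simp
    finally have "odd (card (A - {i, a}))" using psubset.prems by simp
    then have "ph (A - {i, a}) = 0"
      using a by (intro psubset.IH) auto
    then show "w i a * ph (A - {i, a}) = 0" by simp
  qed
  finally show ?case .
qed

text \<open>Words are classified by their set T of first indices, whose size is the length because
  the first indices are distinct.\<close>

lemma sum_seq_sum_card:
  assumes "finite A" "finite B"
  shows "(\<Sum>ps | length ps = m \<and> distinct (map fst ps) \<and> sorted (map snd ps) \<and> (\<forall>(a, b)\<in>set ps. a \<in> A \<and> b \<in> B).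
      prod_list (map (\<lambda>(a, b). br a b) ps)) = (\<Sum>T\<in>Pow A. if card T = m then seq_sum T B else 0)"
    (is "sum ?f ?S = _")
proof -
  have "?S = (\<Union>T\<in>{T \<in> Pow A. card T = m}. bseqs T B)"
  proof (intro equalityI subsetI)
    fix ps assume ps: "ps \<in> ?S"
    then have "card (fst ` set ps) = m" by (metis (mono_tags, lifting) distinct_card length_map list.set_map mem_Collect_eq)
    moreover have "ps \<in> bseqs (fst ` set ps) B" "fst ` set ps \<subseteq> A" using ps by (auto simp: bseqs_def)
    ultimately show "ps \<in> (\<Union>T\<in>{T \<in> Pow A. card T = m}. bseqs T B)" by blast
  next
    fix ps assume "ps \<in> (\<Union>T\<in>{T \<in> Pow A. card T = m}. bseqs T B)"
    then obtain T where T: "T \<subseteq> A" "card T = m" "ps \<in> bseqs T B" by blast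
    then have "distinct (map fst ps)" "set (map fst ps) = T" by (auto simp: bseqs_def)
    then have "length ps = m" using T(2) distinct_card[of "map fst ps"] by simp
    then show "ps \<in> ?S" using T by (auto simp: bseqs_def)
  qed
  also have "sum ?f \<dots> = (\<Sum>T\<in>{T \<in> Pow A. card T = m}. sum ?f (bseqs T B))"
  proof (rule sum.UNION_disjoint)
    show "\<forall>T\<in>{T \<in> Pow A. card T = m}. finite (bseqs T B)"
      using assms by (auto intro: finite_bseqs finite_subset)
  qed (use assms in \<open>auto simp: bseqs_def\<close>)
  also have "\<dots> = (\<Sum>T\<in>Pow A. if card T = m then seq_sum T B else 0)"
    using assms by (simp add: seq_sum_def sum.If_cases Int_def)
  finally show ?thesis .
qed

text \<open>V is divided into I_0 and the set T of first indices. The test card I_0 <= k guards the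
  truncated subtraction k - card I_0, which would let T = {} contribute for larger I_0.\<close>

lemma pieri_sum_expand:
  assumes "finite I"
  shows "pieri_sum N k I = (\<Sum>I0\<in>Pow I. if card I0 \<le> k
    then ph I0 * (\<Sum>T\<in>Pow (I - I0). if card T = k - card I0 then seq_sum T (N - I) else 0) else 0)"
proof -
  have "pieri_sum N k I = (\<Sum>V\<in>Pow I. \<Sum>I0\<in>Pow V. if card (I0 \<union> (V - I0)) = k then ph I0 * seq_sum (V - I0) (N - I) else 0)"
    unfolding pieri_sum_def level_sum_def by (intro sum.cong refl) (auto intro!: sum.cong simp: Un_absorb1)
  also have "\<dots> = (\<Sum>I0\<in>Pow I. \<Sum>T\<in>Pow (I - I0). if card (I0 \<union> T) = k then ph I0 * seq_sum T (N - I) else 0)"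
    by (rule sum_disjoint_pairs_Un[OF assms, symmetric])
  also have "\<dots> = (\<Sum>I0\<in>Pow I. if card I0 \<le> k
    then ph I0 * (\<Sum>T\<in>Pow (I - I0). if card T = k - card I0 then seq_sum T (N - I) else 0) else 0)"
  proof (rule sum.cong[OF refl])
    fix I0 assume I0: "I0 \<in> Pow I"
    have card: "card (I0 \<union> T) = card I0 + card T" if "T \<in> Pow (I - I0)" for T
      using that I0 assms by (intro card_Un_disjoint) (auto intro: finite_subset)
    show "(\<Sum>T\<in>Pow (I - I0). if card (I0 \<union> T) = k then ph I0 * seq_sum T (N - I) else 0) =
       (if card I0 \<le> k then ph I0 * (\<Sum>T\<in>Pow (I - I0). if card T = k - card I0 then seq_sum T (N - I) else 0) else 0)"
    proof (cases "card I0 \<le> k")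
      case True
      then have "(\<Sum>T\<in>Pow (I - I0). if card (I0 \<union> T) = k then ph I0 * seq_sum T (N - I) else 0) =
          (\<Sum>T\<in>Pow (I - I0). ph I0 * (if card T = k - card I0 then seq_sum T (N - I) else 0))"
        using card by (intro sum.cong refl) auto
      then show ?thesis using True by (simp add: sum_distrib_left)
    next
      case False
      then show ?thesis using card by (auto intro!: sum.neutral)
    qed
  qed
  finally show ?thesis .
qed

lemma pieri_sum_expand_even:
  assumes "finite I"
  shows "pieri_sum N k I = (\<Sum>l = 0..k div 2. \<Sum>I0\<in>{I0. I0 \<subseteq> I \<and> card I0 = 2 * l}.
    ph I0 * (\<Sum>T\<in>Pow (I - I0). if card T = k - 2 * l then seq_sum T (N - I) else 0))"
proof -
  let ?t = "\<lambda>I0 c. ph I0 * (\<Sum>T\<in>Pow (I - I0). if card T = k - c then seq_sum T (N - I) else 0)"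
  have "pieri_sum N k I = (\<Sum>I0\<in>Pow I. if card I0 \<le> k then ?t I0 (card I0) else 0)"
    using assms by (rule pieri_sum_expand)
  also have "\<dots> = (\<Sum>I0\<in>Pow I. \<Sum>l = 0..k div 2. if card I0 = 2 * l then ?t I0 (2 * l) else 0)"
  proof (rule sum.cong[OF refl])
    fix I0 assume "I0 \<in> Pow I"
    then have fin: "finite I0" using assms finite_subset by auto
    show "(if card I0 \<le> k then ?t I0 (card I0) else 0) = (\<Sum>l = 0..k div 2. if card I0 = 2 * l then ?t I0 (2 * l) else 0)"
    proof (cases "even (card I0)")
      case True
      then obtain m where m: "card I0 = 2 * m" by blast
      \<comment> \<open>Only l = m can contribute, and it lies in the range exactly when card I_0 <=
        k.\<close>
      have "(\<Sum>l = 0..k div 2. if card I0 = 2 * l then ?t I0 (2 * l) else 0) =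
          (\<Sum>l = 0..k div 2. if m = l then ?t I0 (card I0) else 0)"
        by (intro sum.cong refl) (auto simp: m)
      also have "\<dots> = (if card I0 \<le> k then ?t I0 (card I0) else 0)"
        by (auto simp: m)
      finally show ?thesis by simp
    next
      case False
      then have "(\<Sum>l = 0..k div 2. if card I0 = 2 * l then ?t I0 (2 * l) else 0) = 0"
        by (intro sum.neutral) auto
      then show ?thesis using ph_odd[OF fin False] by simp
    qed
  qed
  also have "\<dots> = (\<Sum>l = 0..k div 2. \<Sum>I0\<in>Pow I. if card I0 = 2 * l then ?t I0 (2 * l) else 0)"
    by (rule sum.swap)
  also have "\<dots> = (\<Sum>l = 0..k div 2. \<Sum>I0\<in>{I0. I0 \<subseteq> I \<and> card I0 = 2 * l}. ?t I0 (2 * l))"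
    using assms by (intro sum.cong refl sum.mono_neutral_cong_right) auto
  finally show ?thesis .
qed

end

text \<open>\<open>Eaux\<close> removes the maximum, which is one admissible choice of j. Its last
  term passes to J - {i} with more fuel than elements, so the claim is made for every fuel m that is
  at least card I.\<close>

lemma Eaux_unique:
  assumes empty: "\<And>k. G k {} = (if k = 0 then 1 else 0)"
    and insert: "\<And>k j I. insert j I \<subseteq> N \<Longrightarrow> j \<notin> I \<Longrightarrow> G k (insert j I) = G k I
      + (if 1 \<le> k then G (k - 1) I * X j else 0)
      + (if 2 \<le> k then \<Sum>i\<in>I. c i j * G (k - 2) (I - {i}) else 0)"
    and "finite I" "I \<subseteq> N" "card I \<le> m"
  shows "Eaux c X m k I = G k I"
  using assms(3-5)
proof (induction m arbitrary: k I)
  case 0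
  then show ?case by (simp add: empty)
next
  case (Suc m)
  show ?case
  proof (cases "I = {}")
    case False
    define j where "j = Max I"
    define J where "J = I - {j}"
    have j: "j \<in> I" using False Suc.prems by (simp add: j_def)
    have I: "I = insert j J" "j \<notin> J" using j by (auto simp: J_def)
    have J: "finite J" "J \<subseteq> N" "card J \<le> m" using Suc.prems j by (auto simp: J_def)
    have IH: "Eaux c X m k' J = G k' J" "Eaux c X m k' (J - {i}) = G k' (J - {i})" for k' i
      using J by (auto intro!: Suc.IH intro: card_Diff1_le[THEN order_trans])
    have "Eaux c X (Suc m) k I = Eaux c X m k J + (if 1 \<le> k then Eaux c X m (k - 1) J * X j else 0)
          + (if 2 \<le> k then (\<Sum>i\<in>J. c i j * Eaux c X m (k - 2) (J - {i})) else 0)"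
      using False by (simp add: Let_def flip: j_def J_def)
    also have "\<dots> = G k (insert j J)"
      using Suc.prems I by (subst insert) (auto simp: IH)
    finally show ?thesis using I by simp
  qed (simp add: empty)
qed

subsection \<open>Perfect matchings and the main theorem\<close>

lemma perfect_matchings_empty: "perfect_matchings {} = {{}}"
  by (auto simp: perfect_matchings_def)

lemma perfect_matchings_subset: "M \<in> perfect_matchings A \<Longrightarrow> M \<subseteq> A \<times> A"
  by (auto simp: perfect_matchings_def)

lemma perfect_matchings_pair_unique:
  assumes "M \<in> perfect_matchings A" "p \<in> M" "q \<in> M" "v \<in> {fst p, snd p}" "v \<in> {fst q, snd q}"
  shows "p = q"
  using assms unfolding perfect_matchings_def by blast

lemma perfect_matchings_insert_pair:
  assumes "a \<in> A" "i \<in> A" "i \<noteq> a" "M \<in> perfect_matchings (A - {i, a})"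
  shows "insert (min i a, max i a) M \<in> perfect_matchings A"
proof -
  have 1: "\<forall>(b, c)\<in>insert (min i a, max i a) M. b < c \<and> b \<in> A \<and> c \<in> A"
    using assms by (auto simp: perfect_matchings_def min_def max_def)
  have mm: "{min i a, max i a} = {i, a}" by (auto simp: min_def max_def)
  have new: "{min i a, max i a} \<inter> {fst q, snd q} = {}" if "q \<in> M" for q
    unfolding mm using perfect_matchings_subset[OF assms(4)] that by (cases q) auto
  have old: "{fst p, snd p} \<inter> {fst q, snd q} = {}" if "p \<in> M" "q \<in> M" "p \<noteq> q" for p q
    using perfect_matchings_pair_unique[OF assms(4) that(1,2)] that(3) by blast
  have 2: "{fst p, snd p} \<inter> {fst q, snd q} = {}"
    if "p \<in> insert (min i a, max i a) M" "q \<in> insert (min i a, max i a) M" "p \<noteq> q" for p q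
  proof (cases "p \<in> M")
    case True
    show ?thesis
    proof (cases "q \<in> M")
      case False
      then have "q = (min i a, max i a)" using that by simp
      then show ?thesis using new[OF True] by (simp only: fst_conv snd_conv Int_commute)
    qed (use old True that in blast)
  next
    case False
    then have "p = (min i a, max i a)" "q \<in> M" using that by auto
    then show ?thesis using new by (simp only: fst_conv snd_conv)
  qed
  have 3: "\<forall>v\<in>A. \<exists>p\<in>insert (min i a, max i a) M. v = fst p \<or> v = snd p"
  proof
    fix v assume "v \<in> A"
    show "\<exists>p\<in>insert (min i a, max i a) M. v = fst p \<or> v = snd p"
    proof (cases "v \<in> {i, a}")
      case True
      then show ?thesis using mm by auto
    next
      case False
      then have "v \<in> A - {i, a}" using \<open>v \<in> A\<close> by simp
      then show ?thesis using assms(4) unfolding perfect_matchings_def by blast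
    qed
  qed
  show ?thesis unfolding perfect_matchings_def using 1 2 3 by blast
qed

lemma perfect_matchings_remove_pair:
  assumes "M \<in> perfect_matchings A" "p \<in> M"
  shows "M - {p} \<in> perfect_matchings (A - {fst p, snd p})"
proof -
  note uniq = perfect_matchings_pair_unique[OF assms(1) _ assms(2)]
  have 1: "b < c \<and> b \<in> A - {fst p, snd p} \<and> c \<in> A - {fst p, snd p}" if bc: "(b, c) \<in> M - {p}" for b c
  proof -
    have "b < c" "b \<in> A" "c \<in> A" using bc assms(1) by (auto simp: perfect_matchings_def)
    moreover have "v \<notin> {fst p, snd p}" if "v \<in> {b, c}" for v
      using uniq[of "(b, c)" v] bc that by auto
    ultimately show ?thesis by auto
  qed
  have 2: "\<forall>q\<in>M - {p}. \<forall>q'\<in>M - {p}. q \<noteq> q' \<longrightarrow> {fst q, snd q} \<inter> {fst q', snd q'} = {}"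
    using assms(1) by (auto simp: perfect_matchings_def)
  have 3: "\<forall>v\<in>A - {fst p, snd p}. \<exists>q\<in>M - {p}. v = fst q \<or> v = snd q"
    using assms(1) by (auto simp: perfect_matchings_def)
  show ?thesis unfolding perfect_matchings_def using 1 2 3 by blast
qed

text \<open>Matchings are sorted by the partner i of a. Pairs carry their smaller element first,
  hence the minimum and maximum.\<close>

lemma perfect_matchings_rec:
  assumes "a \<in> A"
  shows "perfect_matchings A = (\<Union>i\<in>A - {a}. insert (min i a, max i a) ` perfect_matchings (A - {i, a}))"
proof (intro equalityI subsetI)
  fix M assume M: "M \<in> perfect_matchings A"
  then obtain p where p: "p \<in> M" "a = fst p \<or> a = snd p"
    using assms unfolding perfect_matchings_def by blast
  define i where "i = (if a = fst p then snd p else fst p)"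
  have lt: "fst p < snd p" "fst p \<in> A" "snd p \<in> A"
    using M p(1) by (auto simp: perfect_matchings_def)
  then have i: "i \<in> A - {a}" and pi: "p = (min i a, max i a)" and set: "{fst p, snd p} = {i, a}"
    using p(2) by (auto simp: i_def prod_eq_iff)
  have "M - {p} \<in> perfect_matchings (A - {i, a})"
    using perfect_matchings_remove_pair[OF M p(1)] set by simp
  moreover have "M = insert (min i a, max i a) (M - {p})"
    using p(1) pi by auto
  ultimately show "M \<in> (\<Union>i\<in>A - {a}. insert (min i a, max i a) ` perfect_matchings (A - {i, a}))"
    using i by blast
qed (use assms perfect_matchings_insert_pair in auto)

lemma finite_perfect_matchings: "finite A \<Longrightarrow> finite (perfect_matchings A)"
  by (rule finite_subset[of _ "Pow (A \<times> A)"]) (auto dest: perfect_matchings_subset)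

lemma phi_empty: "phi \<tau> {} = (\<lambda>x. 1)"
  by (simp add: phi_def perfect_matchings_empty)

text \<open>The pair containing a contributes wp(x_i - x_a) whichever of i and a is smaller, because
  wp is even. Different partners give disjoint families, as a lies in only one pair of a
  matching.\<close>

lemma phi_rec:
  assumes "finite A" "a \<in> A"
  shows "phi \<tau> A = (\<lambda>x. \<Sum>i\<in>A - {a}. wp \<tau> (x i - x a) * phi \<tau> (A - {i, a}) x)"
proof
  fix x :: "nat \<Rightarrow> complex"
  let ?f = "\<lambda>M. \<Prod>(a, b)\<in>M. wp \<tau> (x a - x b)"
  let ?ins = "\<lambda>i. insert (min i a, max i a)"
  have notin: "(min i a, max i a) \<notin> M" if "M \<in> perfect_matchings (A - {i, a})" for M i
    using perfect_matchings_subset[OF that] by (auto simp: min_def)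
  have inj: "inj_on (?ins i) (perfect_matchings (A - {i, a}))" for i
    using notin by (auto intro!: inj_onI dest: insert_ident[THEN iffD1, rotated 2])
  have disj: "?ins i ` perfect_matchings (A - {i, a}) \<inter> ?ins i' ` perfect_matchings (A - {i', a}) = {}"
    if "i \<in> A - {a}" "i' \<in> A - {a}" "i \<noteq> i'" for i i'
  proof (rule ccontr)
    assume "\<not> ?thesis"
    then obtain M M' where M: "M \<in> perfect_matchings (A - {i, a})" "M' \<in> perfect_matchings (A - {i', a})"
      and eq: "?ins i M = ?ins i' M'" by auto
    have "?ins i M \<in> perfect_matchings A"
      using M that assms by (intro perfect_matchings_insert_pair) auto
    moreover have "(min i' a, max i' a) \<in> ?ins i M" unfolding eq by simp
    ultimately have "(min i a, max i a) = (min i' a, max i' a)"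
      by (rule perfect_matchings_pair_unique[where v = a, OF _ insertI1]) (auto simp: min_def max_def)
    then show False using that by (auto simp: min_def max_def split: if_splits)
  qed
  have "phi \<tau> A x = sum ?f (\<Union>i\<in>A - {a}. ?ins i ` perfect_matchings (A - {i, a}))"
    unfolding phi_def by (subst perfect_matchings_rec[OF assms(2)]) simp
  also have "\<dots> = (\<Sum>i\<in>A - {a}. sum ?f (?ins i ` perfect_matchings (A - {i, a})))"
    by (rule sum.UNION_disjoint) (use assms disj in \<open>auto intro!: finite_imageI finite_perfect_matchings\<close>)
  also have "\<dots> = (\<Sum>i\<in>A - {a}. wp \<tau> (x i - x a) * phi \<tau> (A - {i, a}) x)"
  proof (rule sum.cong[OF refl])
    fix i assume "i \<in> A - {a}"
    have "sum ?f (?ins i ` perfect_matchings (A - {i, a})) = (\<Sum>M\<in>perfect_matchings (A - {i, a}). ?f (?ins i M))"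
      using inj by (simp add: sum.reindex)
    also have "\<dots> = (\<Sum>M\<in>perfect_matchings (A - {i, a}). wp \<tau> (x i - x a) * ?f M)"
    proof (rule sum.cong[OF refl])
      fix M assume M: "M \<in> perfect_matchings (A - {i, a})"
      have "finite M"
        using perfect_matchings_subset[OF M] assms(1) by (auto intro: finite_subset)
      moreover have "wp \<tau> (x (min i a) - x (max i a)) = wp \<tau> (x i - x a)"
        using wp_minus[of \<tau> "x i - x a"] by (auto simp: min_def max_def)
      ultimately show "?f (?ins i M) = wp \<tau> (x i - x a) * ?f M"
        using notin[OF M] by simp
    qed
    finally show "sum ?f (?ins i ` perfect_matchings (A - {i, a})) = wp \<tau> (x i - x a) * phi \<tau> (A - {i, a}) x"
      by (simp add: phi_def sum_distrib_left)
  qed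
  finally show "phi \<tau> A x = (\<Sum>i\<in>A - {a}. wp \<tau> (x i - x a) * phi \<tau> (A - {i, a}) x)" .
qed

lemma meromorphic_phi:
  assumes "Im \<tau> > 0" "A \<subseteq> {1..n}"
  shows "meromorphic n (phi \<tau> A)"
proof -
  have "meromorphic n (\<lambda>x. \<Prod>(a, b)\<in>M. wp \<tau> (x a - x b))" if "M \<in> perfect_matchings A" for M
  proof -
    have "meromorphic n (\<lambda>x. \<Prod>p\<in>M. wp \<tau> (x (fst p) - x (snd p)))"
    proof (rule meromorphic_prod)
      fix p assume "p \<in> M"
      then have "fst p < snd p" "fst p \<in> A" "snd p \<in> A"
        using that by (auto simp: perfect_matchings_def)
      then show "meromorphic n (\<lambda>x. wp \<tau> (x (fst p) - x (snd p)))"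
        using assms by (intro meromorphic_wp) auto
    qed
    then show ?thesis by (simp add: case_prod_beta)
  qed
  then show ?thesis unfolding phi_def by (rule meromorphic_sum)
qed

theorem theorem3p1:
  fixes n :: nat and \<tau> :: complex and lam :: "nat \<Rightarrow> complex"
    and emb :: "((nat \<Rightarrow> complex) \<Rightarrow> complex) \<Rightarrow> 'r::ring_1"
    and br :: "nat \<Rightarrow> nat \<Rightarrow> 'r"
    and I :: "nat set" and k :: nat
  assumes n2: "n \<ge> 2"
    and tau: "Im \<tau> > 0"
    and lam: "\<forall>i\<in>{1..n}. \<forall>j\<in>{1..n}. i \<noteq> j \<longrightarrow> lam i - lam j \<notin> lattice \<tau>"
    and emb_add: "\<forall>f g. meromorphic n f \<longrightarrow> meromorphic n g \<longrightarrow> emb (\<lambda>x. f x + g x) = emb f + emb g"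
    and emb_mult: "\<forall>f g. meromorphic n f \<longrightarrow> meromorphic n g \<longrightarrow> emb (\<lambda>x. f x * g x) = emb f * emb g"
    and emb_one: "emb (\<lambda>x. 1) = 1"
    and emb_eq: "\<forall>f g. meromorphic n f \<longrightarrow> meromorphic n g \<longrightarrow> generic_eq f g \<longrightarrow> emb f = emb g"
    and br_anti: "\<forall>i\<in>{1..n}. \<forall>j\<in>{1..n}. i \<noteq> j \<longrightarrow> br j i = - br i j"
    and rel1: "\<forall>i\<in>{1..n}. \<forall>j\<in>{1..n}. i \<noteq> j \<longrightarrow>
                 br i j * br i j = emb (\<lambda>x. wp \<tau> (lam i - lam j) - wp \<tau> (x i - x j))"
    and rel2: "\<forall>i\<in>{1..n}. \<forall>j\<in>{1..n}. \<forall>k\<in>{1..n}. \<forall>l\<in>{1..n}. i \<noteq> j \<longrightarrow> k \<noteq> l \<longrightarrow>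
                 {i, j} \<inter> {k, l} = {} \<longrightarrow> br i j * br k l = br k l * br i j"
    and rel3: "\<forall>i\<in>{1..n}. \<forall>j\<in>{1..n}. \<forall>k\<in>{1..n}. i \<noteq> j \<longrightarrow> j \<noteq> k \<longrightarrow> i \<noteq> k \<longrightarrow>
                 br i j * br j k + br j k * br k i + br k i * br i j = 0"
    and rel4: "\<forall>i\<in>{1..n}. \<forall>j\<in>{1..n}. i \<noteq> j \<longrightarrow>
                 (\<forall>f. meromorphic n f \<longrightarrow> br i j * emb f = emb (swapf i j f) * br i j)"
    and I: "I \<subseteq> {1..n}"
  shows "Edef (\<lambda>i j. emb (\<lambda>x. wp \<tau> (lam i - lam j))) (\<lambda>i. \<Sum>j\<in>{1..n} - {i}. br i j) k I =
         (\<Sum>l = 0..k div 2. \<Sum>I0\<in>{I0. I0 \<subseteq> I \<and> card I0 = 2 * l}.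
            emb (phi \<tau> I0) *
            (\<Sum>ps\<in>seqs n I I0 (k - 2 * l). prod_list (map (\<lambda>(a, b). br a b) ps)))"
proof -
  define N where "N = {1..n}"
  \<comment> \<open>Extended by 0 off \<open>N\<close>, the data satisfy all relations without conditions on the indices.\<close>
  define br0 where "br0 = (\<lambda>i j. if i \<in> N \<and> j \<in> N \<and> i \<noteq> j then br i j else 0)"
  define p0 where "p0 = (\<lambda>i j. if i \<in> N \<and> j \<in> N \<and> i \<noteq> j then emb (\<lambda>x. wp \<tau> (lam i - lam j)) else 0)"
  define w0 where "w0 = (\<lambda>i j. if i \<in> N \<and> j \<in> N \<and> i \<noteq> j then emb (\<lambda>x. wp \<tau> (x i - x j)) else 0)"
  define ph0 where "ph0 = (\<lambda>A. if A \<subseteq> N then emb (phi \<tau> A) else 0)"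
  have mw: "meromorphic n (\<lambda>x. wp \<tau> (x i - x j))" if "i \<in> N" "j \<in> N" "i \<noteq> j" for i j
    using that tau by (intro meromorphic_wp) (auto simp: N_def)
  have mph: "meromorphic n (phi \<tau> A)" if "A \<subseteq> N" for A
    using that tau by (intro meromorphic_phi) (auto simp: N_def)
  \<comment> \<open>The ring is noncommutative, but both products are the image of one and the same
    function.\<close>
  have emb_commute: "emb f * emb g = emb g * emb f" if "meromorphic n f" "meromorphic n g" for f g
  proof -
    have "(\<lambda>x. f x * g x) = (\<lambda>x. g x * f x)" by (simp add: mult.commute)
    then show ?thesis using emb_mult that by metis
  qed
  have emb_zero: "emb (\<lambda>x. 0) = 0"
    using emb_add[rule_format, OF meromorphic_const meromorphic_const, of 0 0] by simp
  have emb_sum: "emb (\<lambda>x. \<Sum>i\<in>A. f i x) = (\<Sum>i\<in>A. emb (f i))"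
    if "finite A" "\<And>i. i \<in> A \<Longrightarrow> meromorphic n (f i)" for A :: "nat set" and f
    using that
  proof (induction A rule: finite_induct)
    case (insert a A)
    then show ?case
      using emb_add[rule_format, of "f a" "\<lambda>x. \<Sum>i\<in>A. f i x"] by (simp add: meromorphic_sum)
  qed (simp add: emb_zero)
  have br_const: "br i j * emb (\<lambda>x. c) = emb (\<lambda>x. c) * br i j" if "i \<in> N" "j \<in> N" "i \<noteq> j" for i j c
    using rel4[rule_format, of i j "\<lambda>x. c"] that meromorphic_const by (simp add: N_def swapf_def)
  have br_emb_w: "br a b * emb (\<lambda>x. wp \<tau> (x i - x j)) = emb (swapf a b (\<lambda>x. wp \<tau> (x i - x j))) * br a b"
    if "a \<in> N" "b \<in> N" "a \<noteq> b" "i \<in> N" "j \<in> N" "i \<noteq> j" for a b i j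
    using rel4[rule_format, of a b "\<lambda>x. wp \<tau> (x i - x j)"] that mw[of i j] by (simp add: N_def)
  interpret dunkl_brackets br0 p0 w0 ph0
  proof
    show "br0 j i = - br0 i j" if "i \<noteq> j" for i j
      using that br_anti[rule_format, of i j] by (auto simp: br0_def N_def)
    show "br0 i j * br0 i j = p0 i j - w0 i j" if "i \<noteq> j" for i j
    proof (cases "i \<in> N \<and> j \<in> N")
      case True
      let ?c = "wp \<tau> (lam i - lam j)"
      \<comment> \<open>\<open>rel1\<close> speaks of the image of a difference, the locale of a
        difference of images. Additivity of \<open>emb\<close> presupposes meromorphic functions, so
        the difference is first exhibited as one.\<close>
      have "meromorphic n (\<lambda>x. ?c + - 1 * wp \<tau> (x i - x j))"
        using True that by (intro meromorphic_add meromorphic_mult meromorphic_const mw) auto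
      then have "meromorphic n (\<lambda>x. ?c - wp \<tau> (x i - x j))" by simp
      then have "emb (\<lambda>x. ?c) = emb (\<lambda>x. ?c - wp \<tau> (x i - x j)) + emb (\<lambda>x. wp \<tau> (x i - x j))"
        using emb_add[rule_format, of "\<lambda>x. ?c - wp \<tau> (x i - x j)" "\<lambda>x. wp \<tau> (x i - x j)"] True that mw by simp
      then show ?thesis using True that rel1[rule_format, of i j] by (simp add: br0_def p0_def w0_def N_def)
    qed (auto simp: br0_def p0_def w0_def)
    show "br0 i j * br0 k l = br0 k l * br0 i j" if "distinct [i, j, k, l]" for i j k l
      using that rel2[rule_format, of i j k l] by (auto simp: br0_def N_def)
    show "br0 i j * br0 j k + br0 j k * br0 k i + br0 k i * br0 i j = 0" if "distinct [i, j, k]" for i j k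
      using that rel3[rule_format, of i j k] by (auto simp: br0_def N_def)
    show "p0 i j * br0 k l = br0 k l * p0 i j" if "k \<noteq> l" for i j k l
      using that br_const[of k l "wp \<tau> (lam i - lam j)"] by (auto simp: br0_def p0_def)
    show "p0 i j * ph0 A = ph0 A * p0 i j" for i j A
      using emb_commute[OF meromorphic_const mph[of A]] by (auto simp: p0_def ph0_def)
    show "w0 i j = w0 j i" for i j
    proof -
      have "wp \<tau> (x i - x j) = wp \<tau> (x j - x i)" for x :: "nat \<Rightarrow> complex"
        using wp_minus[of \<tau> "x i - x j"] by simp
      then show ?thesis by (auto simp: w0_def)
    qed
    show "w0 i j * ph0 A = ph0 A * w0 i j" for i j A
      using emb_commute[OF mw[of i j] mph[of A]] by (auto simp: w0_def ph0_def)
    show "br0 a j * w0 i j = w0 i a * br0 a j" if "distinct [a, i, j]" for a i j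
      using that br_emb_w[of a j i j] by (auto simp: br0_def w0_def swapf_def)
    show "br0 a b * w0 c d = w0 c d * br0 a b" if "distinct [a, b, c, d]" for a b c d
      using that br_emb_w[of a b c d] by (auto simp: br0_def w0_def swapf_def)
    show "ph0 {} = 1"
      by (simp add: ph0_def phi_empty emb_one)
    show "ph0 A = (\<Sum>i\<in>A - {a}. w0 i a * ph0 (A - {i, a}))" if "finite A" "a \<in> A" for A a
    proof (cases "A \<subseteq> N")
      case True
      have m: "meromorphic n (\<lambda>x. wp \<tau> (x i - x a) * phi \<tau> (A - {i, a}) x)" if "i \<in> A - {a}" for i
        using that True \<open>a \<in> A\<close> by (intro meromorphic_mult mw mph) auto
      have "emb (phi \<tau> A) = (\<Sum>i\<in>A - {a}. emb (\<lambda>x. wp \<tau> (x i - x a) * phi \<tau> (A - {i, a}) x))"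
        unfolding phi_rec[OF that] using \<open>finite A\<close> m by (intro emb_sum) auto
      also have "\<dots> = (\<Sum>i\<in>A - {a}. w0 i a * ph0 (A - {i, a}))"
      proof (rule sum.cong[OF refl])
        fix i assume i: "i \<in> A - {a}"
        then have "i \<in> N" "a \<in> N" "i \<noteq> a" "A - {i, a} \<subseteq> N" using True \<open>a \<in> A\<close> by auto
        then show "emb (\<lambda>x. wp \<tau> (x i - x a) * phi \<tau> (A - {i, a}) x) = w0 i a * ph0 (A - {i, a})"
          using emb_mult[rule_format, OF mw[of i a] mph[of "A - {i, a}"]] by (simp add: w0_def ph0_def)
      qed
      finally show ?thesis using True by (simp add: ph0_def)
    next
      case False
      \<comment> \<open>If A is not contained in N, then either A - {i, a} is not contained in N or
        one of i, a lies outside N. So one factor is 0 by the extension.\<close>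
      have "w0 i a * ph0 (A - {i, a}) = 0" for i
        using False by (auto simp: w0_def ph0_def)
      then show ?thesis using False by (simp add: ph0_def)
    qed
  qed
  have finN: "finite N" and IN: "I \<subseteq> N" and finI: "finite I"
    using I finite_subset by (auto simp: N_def)
  have "Edef (\<lambda>i j. emb (\<lambda>x. wp \<tau> (lam i - lam j))) (\<lambda>i. \<Sum>j\<in>N - {i}. br i j) k I = pieri_sum N k I"
    unfolding Edef_def
  proof (rule Eaux_unique[where G = "pieri_sum N" and N = N, OF pieri_sum_empty _ finI IN])
    fix k j J assume J: "insert j J \<subseteq> N" "j \<notin> J"
    have "(\<Sum>b\<in>N - {j}. br0 j b) = (\<Sum>b\<in>N - {j}. br j b)"
      using J by (intro sum.cong) (auto simp: br0_def)
    moreover have "(\<Sum>i\<in>J. p0 i j * pieri_sum N (k - 2) (J - {i})) = (\<Sum>i\<in>J. emb (\<lambda>x. wp \<tau> (lam i - lam j)) * pieri_sum N (k - 2) (J - {i}))"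
      using J by (intro sum.cong) (auto simp: p0_def)
    ultimately show "pieri_sum N k (insert j J) = pieri_sum N k J + (if 1 \<le> k then pieri_sum N (k - 1) J * (\<Sum>b\<in>N - {j}. br j b) else 0)
      + (if 2 \<le> k then \<Sum>i\<in>J. emb (\<lambda>x. wp \<tau> (lam i - lam j)) * pieri_sum N (k - 2) (J - {i}) else 0)"
      using pieri_sum_insert[OF finN J, of k] by simp
  qed simp
  also have "pieri_sum N k I = (\<Sum>l = 0..k div 2. \<Sum>I0\<in>{I0. I0 \<subseteq> I \<and> card I0 = 2 * l}.
    ph0 I0 * (\<Sum>T\<in>Pow (I - I0). if card T = k - 2 * l then seq_sum T (N - I) else 0))"
    using finI by (rule pieri_sum_expand_even)
  also have "\<dots> = (\<Sum>l = 0..k div 2. \<Sum>I0\<in>{I0. I0 \<subseteq> I \<and> card I0 = 2 * l}.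
            emb (phi \<tau> I0) *
            (\<Sum>ps\<in>seqs n I I0 (k - 2 * l). prod_list (map (\<lambda>(a, b). br a b) ps)))"
  proof (intro sum.cong refl)
    fix l I0 assume I0: "I0 \<in> {I0. I0 \<subseteq> I \<and> card I0 = 2 * l}"
    have "(\<Sum>T\<in>Pow (I - I0). if card T = k - 2 * l then seq_sum T (N - I) else 0) =
        (\<Sum>ps\<in>seqs n I I0 (k - 2 * l). prod_list (map (\<lambda>(a, b). br0 a b) ps))"
      unfolding seqs_def N_def[symmetric] by (rule sum_seq_sum_card[symmetric]) (use finI finN in auto)
    also have "\<dots> = (\<Sum>ps\<in>seqs n I I0 (k - 2 * l). prod_list (map (\<lambda>(a, b). br a b) ps))"
    proof (rule sum.cong[OF refl])
      fix ps assume ps: "ps \<in> seqs n I I0 (k - 2 * l)"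
      \<comment> \<open>In these sequences a lies in I and b in N - I, so a and b are distinct
        elements of N and the extension by 0 does not intervene.\<close>
      have "map (\<lambda>(a, b). br0 a b) ps = map (\<lambda>(a, b). br a b) ps"
        using ps IN by (fastforce simp: seqs_def br0_def N_def)
      then show "prod_list (map (\<lambda>(a, b). br0 a b) ps) = prod_list (map (\<lambda>(a, b). br a b) ps)"
        by (simp only:)
    qed
    finally show "ph0 I0 * (\<Sum>T\<in>Pow (I - I0). if card T = k - 2 * l then seq_sum T (N - I) else 0) =
      emb (phi \<tau> I0) * (\<Sum>ps\<in>seqs n I I0 (k - 2 * l). prod_list (map (\<lambda>(a, b). br a b) ps))"
      using I0 order_trans[OF _ IN, of I0] by (simp add: ph0_def)
  qed
  finally show ?thesis by (simp add: N_def)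
qed

end
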